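(* Let $X$ be a Banach space, let $(\Omega,\Sigma)$ be a measurable space and let $\nu:\Sigma\to X$ be a countably additive vector measure. The following statements are equivalent: (i) $L_1(\nu)$ has the positive Schur property. (ii) For all weakly null sequences $(f_n)_{n\in\mathbb{N}}$ in $L_1(\nu)$ and $(g_n)_{n\in\mathbb{N}}$ in $L_\infty(\nu)$, the sequence $(I_\nu(f_ng_n))_{n\in\mathbb{N}}$ is norm null in $X$.
   Context: All Banach spaces are real; $X^*$ is the dual of $X$ and $B_{X^*}$ is its closed unit ball. Let $(\Omega,\Sigma)$ be a measurable space ($\Sigma$ a $\sigma$-algebra on $\Omega$) and $\nu:\Sigma\to X$ a countably additive vector measure. For $x^*\in X^*$, $x^*\nu$ is the signed measure $A\mapsto x^*(\nu(A))$ and $|x^*\nu|$ is its variation. A $\Sigma$-measurable function $f:\Omega\to\mathbb{R}$ is $\nu$-integrable if it is $|x^*\nu|$-integrable for all $x^*\in X^*$ and, for each $A\in\Sigma$, there is $\int_A f\,d\nu\in X$ such that $x^*(\int_A f\,d\nu)=\int_A f\,d(x^*\nu)$ for all $x^*\in X^*$. A set $A\in\Sigma$ is $\nu$-null if $\nu(B)=0$ for every $B\in\Sigma$ with $B\subseteq A$. $L_1(\nu)$ is the Banach lattice of all (classes, modulo equality outside a $\nu$-null set, of) $\nu$-integrable functions with the $\nu$-a.e. order and the norm $\|f\|_{L_1(\nu)}=\sup_{x^*\in B_{X^*}}\int_\Omega|f|\,d|x^*\nu|$. $L_\infty(\nu)$ is the Banach lattice of all (classes of) $\nu$-essentially bounded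 $\Sigma$-measurable real functions with the $\nu$-essential supremum norm; if $f\in L_1(\nu)$ and $g\in L_\infty(\nu)$ then $fg\in L_1(\nu)$. The integration operator is $I_\nu:L_1(\nu)\to X$, $I_\nu(f)=\int_\Omega f\,d\nu$. A Banach lattice $E$ has the positive Schur property if every weakly null sequence in $E^+=\{x\in E: x\ge 0\}$ is norm null. *)

theory Defs
  imports "HOL-Analysis.Analysis"
begin

text \<open>
  A measurable space is given by \<open>M :: 'b measure\<close>, of which only \<open>space M\<close> and \<open>sets M\<close> are
  ever used. Set functions are total on \<open>'b set\<close>; their values outside \<open>sets M\<close> never matter.
  The dual of the Banach space \<open>'a\<close> is the type \<open>'a \<Rightarrow>\<^sub>L real\<close> of bounded linear functionals
  with the operator norm.
\<close>

definition vector_measure :: "'b measure \<Rightarrow> ('b set \<Rightarrow> 'a::banach) \<Rightarrow> bool" where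
  "vector_measure M \<nu> \<longleftrightarrow>
     (\<forall>A :: nat \<Rightarrow> 'b set. range A \<subseteq> sets M \<longrightarrow> disjoint_family A \<longrightarrow>
        (\<lambda>i. \<nu> (A i)) sums \<nu> (\<Union>i. A i))"

definition scalar_measure ::
    "('a::banach \<Rightarrow>\<^sub>L real) \<Rightarrow> ('b set \<Rightarrow> 'a) \<Rightarrow> 'b set \<Rightarrow> real" where
  "scalar_measure x \<nu> A = blinfun_apply x (\<nu> A)"


section \<open>Signed measures\<close>

text \<open>
  Both set functions below are countably additive whenever \<open>\<mu>\<close> is a signed measure, so that
  \<^const>\<open>measure_of\<close> turns them into measures with these very values on \<open>sets M\<close>.
\<close>

definition variation :: "'b measure \<Rightarrow> ('b set \<Rightarrow> real) \<Rightarrow> 'b measure" where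
  "variation M \<mu> = measure_of (space M) (sets M)
     (\<lambda>A. SUP P \<in> {P. finite P \<and> P \<subseteq> sets M \<and> partition_on A P}. \<Sum>B\<in>P. ennreal \<bar>\<mu> B\<bar>)"

text \<open>
  The positive part of the Jordan decomposition; \<^const>\<open>ennreal\<close> sends negative numbers to 0.
  The negative part is the positive part of \<open>- \<mu>\<close>.
\<close>

definition pos_part :: "'b measure \<Rightarrow> ('b set \<Rightarrow> real) \<Rightarrow> 'b measure" where
  "pos_part M \<mu> = measure_of (space M) (sets M)
     (\<lambda>A. SUP B \<in> {B \<in> sets M. B \<subseteq> A}. ennreal (\<mu> B))"

definition signed_integral ::
    "'b measure \<Rightarrow> ('b set \<Rightarrow> real) \<Rightarrow> 'b set \<Rightarrow> ('b \<Rightarrow> real) \<Rightarrow> real" where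
  "signed_integral M \<mu> A f =
     (LINT \<omega>:A | pos_part M \<mu>. f \<omega>) - (LINT \<omega>:A | pos_part M (\<lambda>B. - \<mu> B). f \<omega>)"


section \<open>Integration with respect to a vector measure\<close>

definition has_vm_integral ::
    "'b measure \<Rightarrow> ('b set \<Rightarrow> 'a::banach) \<Rightarrow> ('b \<Rightarrow> real) \<Rightarrow> 'b set \<Rightarrow> 'a \<Rightarrow> bool" where
  "has_vm_integral M \<nu> f A y \<longleftrightarrow>
     (\<forall>x :: 'a \<Rightarrow>\<^sub>L real. blinfun_apply x y = signed_integral M (scalar_measure x \<nu>) A f)"

definition vm_integrable ::
    "'b measure \<Rightarrow> ('b set \<Rightarrow> 'a::banach) \<Rightarrow> ('b \<Rightarrow> real) \<Rightarrow> bool" where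
  "vm_integrable M \<nu> f \<longleftrightarrow>
     f \<in> borel_measurable M \<and>
     (\<forall>x :: 'a \<Rightarrow>\<^sub>L real. integrable (variation M (scalar_measure x \<nu>)) f) \<and>
     (\<forall>A\<in>sets M. \<exists>y. has_vm_integral M \<nu> f A y)"

definition vm_integral ::
    "'b measure \<Rightarrow> ('b set \<Rightarrow> 'a::banach) \<Rightarrow> ('b \<Rightarrow> real) \<Rightarrow> 'b set \<Rightarrow> 'a" where
  "vm_integral M \<nu> f A = (THE y. has_vm_integral M \<nu> f A y)"

definition vm_null :: "'b measure \<Rightarrow> ('b set \<Rightarrow> 'a::banach) \<Rightarrow> 'b set \<Rightarrow> bool" where
  "vm_null M \<nu> A \<longleftrightarrow> A \<in> sets M \<and> (\<forall>B\<in>sets M. B \<subseteq> A \<longrightarrow> \<nu> B = 0)"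

definition ess_bounded :: "'b measure \<Rightarrow> ('b set \<Rightarrow> 'a::banach) \<Rightarrow> ('b \<Rightarrow> real) \<Rightarrow> bool" where
  "ess_bounded M \<nu> g \<longleftrightarrow>
     g \<in> borel_measurable M \<and> (\<exists>C. vm_null M \<nu> {\<omega> \<in> space M. \<bar>g \<omega>\<bar> > C})"

text \<open>
  The supremum is over a nonempty set, which is bounded above for integrable \<open>f\<close> by the uniform
  boundedness principle.
\<close>

definition L1_norm :: "'b measure \<Rightarrow> ('b set \<Rightarrow> 'a::banach) \<Rightarrow> ('b \<Rightarrow> real) \<Rightarrow> real" where
  "L1_norm M \<nu> f =
     (SUP x \<in> cball (0 :: 'a \<Rightarrow>\<^sub>L real) 1. LINT \<omega> | variation M (scalar_measure x \<nu>). \<bar>f \<omega>\<bar>)"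

text \<open>The condition \<open>0 \<le> C\<close> only matters if \<open>space M\<close> itself is null.\<close>

definition Linf_norm :: "'b measure \<Rightarrow> ('b set \<Rightarrow> 'a::banach) \<Rightarrow> ('b \<Rightarrow> real) \<Rightarrow> real" where
  "Linf_norm M \<nu> g = Inf {C. 0 \<le> C \<and> vm_null M \<nu> {\<omega> \<in> space M. \<bar>g \<omega>\<bar> > C}}"


section \<open>Normed vector lattices with a carrier set\<close>

text \<open>
  The spaces below depend on the term \<open>\<nu>\<close> and hence are not types; their operations are
  meaningful on the carrier only.
\<close>

record 'e normed_lattice =
  elems :: "'e set"
  nl_zero :: 'e
  nl_add :: "'e \<Rightarrow> 'e \<Rightarrow> 'e"
  nl_scale :: "real \<Rightarrow> 'e \<Rightarrow> 'e"
  nl_le :: "'e \<Rightarrow> 'e \<Rightarrow> bool"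
  nl_norm :: "'e \<Rightarrow> real"

definition bounded_functional :: "'e normed_lattice \<Rightarrow> ('e \<Rightarrow> real) \<Rightarrow> bool" where
  "bounded_functional E \<phi> \<longleftrightarrow>
     (\<forall>u\<in>elems E. \<forall>v\<in>elems E. \<phi> (nl_add E u v) = \<phi> u + \<phi> v) \<and>
     (\<forall>c. \<forall>u\<in>elems E. \<phi> (nl_scale E c u) = c * \<phi> u) \<and>
     (\<exists>K. \<forall>u\<in>elems E. \<bar>\<phi> u\<bar> \<le> K * nl_norm E u)"

definition weakly_null :: "'e normed_lattice \<Rightarrow> (nat \<Rightarrow> 'e) \<Rightarrow> bool" where
  "weakly_null E u \<longleftrightarrow>
     (\<forall>n. u n \<in> elems E) \<and> (\<forall>\<phi>. bounded_functional E \<phi> \<longrightarrow> (\<lambda>n. \<phi> (u n)) \<longlonglongrightarrow> 0)"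

definition positive_Schur_property :: "'e normed_lattice \<Rightarrow> bool" where
  "positive_Schur_property E \<longleftrightarrow>
     (\<forall>u. weakly_null E u \<longrightarrow> (\<forall>n. nl_le E (nl_zero E) (u n)) \<longrightarrow> (\<lambda>n. nl_norm E (u n)) \<longlonglongrightarrow> 0)"


section \<open>The spaces of classes of functions\<close>

definition ae_equal ::
    "'b measure \<Rightarrow> ('b set \<Rightarrow> 'a::banach) \<Rightarrow> (('b \<Rightarrow> real) \<times> ('b \<Rightarrow> real)) set" where
  "ae_equal M \<nu> = {(f, g). f \<in> borel_measurable M \<and> g \<in> borel_measurable M \<and>
                          vm_null M \<nu> {\<omega> \<in> space M. f \<omega> \<noteq> g \<omega>}}"

abbreviation fun_class ::
    "'b measure \<Rightarrow> ('b set \<Rightarrow> 'a::banach) \<Rightarrow> ('b \<Rightarrow> real) \<Rightarrow> ('b \<Rightarrow> real) set" where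
  "fun_class M \<nu> f \<equiv> ae_equal M \<nu> `` {f}"

definition rep :: "('b \<Rightarrow> real) set \<Rightarrow> 'b \<Rightarrow> real" where
  "rep F = (SOME f. f \<in> F)"

text \<open>
  The space of classes of the functions in \<open>S\<close>, with the pointwise operations, the almost
  everywhere order and the norm induced by a seminorm \<open>p\<close>. For the two instances below, nothing
  depends on the representatives picked by \<^const>\<open>rep\<close>.
\<close>

definition class_space ::
    "'b measure \<Rightarrow> ('b set \<Rightarrow> 'a::banach) \<Rightarrow> ('b \<Rightarrow> real) set \<Rightarrow> (('b \<Rightarrow> real) \<Rightarrow> real) \<Rightarrow>
     ('b \<Rightarrow> real) set normed_lattice" where
  "class_space M \<nu> S p = \<lparr>
     elems = S // ae_equal M \<nu>,
     nl_zero = fun_class M \<nu> (\<lambda>_. 0),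
     nl_add = (\<lambda>F G. fun_class M \<nu> (\<lambda>\<omega>. rep F \<omega> + rep G \<omega>)),
     nl_scale = (\<lambda>c F. fun_class M \<nu> (\<lambda>\<omega>. c * rep F \<omega>)),
     nl_le = (\<lambda>F G. vm_null M \<nu> {\<omega> \<in> space M. \<not> rep F \<omega> \<le> rep G \<omega>}),
     nl_norm = (\<lambda>F. p (rep F)) \<rparr>"

definition L1_space ::
    "'b measure \<Rightarrow> ('b set \<Rightarrow> 'a::banach) \<Rightarrow> ('b \<Rightarrow> real) set normed_lattice" where
  "L1_space M \<nu> = class_space M \<nu> {f. vm_integrable M \<nu> f} (L1_norm M \<nu>)"

definition Linf_space ::
    "'b measure \<Rightarrow> ('b set \<Rightarrow> 'a::banach) \<Rightarrow> ('b \<Rightarrow> real) set normed_lattice" where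
  "Linf_space M \<nu> = class_space M \<nu> {g. ess_bounded M \<nu> g} (Linf_norm M \<nu>)"

definition class_mult ::
    "'b measure \<Rightarrow> ('b set \<Rightarrow> 'a::banach) \<Rightarrow>
     ('b \<Rightarrow> real) set \<Rightarrow> ('b \<Rightarrow> real) set \<Rightarrow> ('b \<Rightarrow> real) set" where
  "class_mult M \<nu> F G = fun_class M \<nu> (\<lambda>\<omega>. rep F \<omega> * rep G \<omega>)"

definition integration_operator ::
    "'b measure \<Rightarrow> ('b set \<Rightarrow> 'a::banach) \<Rightarrow> ('b \<Rightarrow> real) set \<Rightarrow> 'a" where
  "integration_operator M \<nu> F = vm_integral M \<nu> (rep F) (space M)"

end

theory Submission
  imports Defs "HOL-Library.Diagonal_Subsequence"
begin

text \<open>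
  Both implications rest on the same splitting. For \<open>f\<close> in \<open>L\<^sub>1(\<nu>)\<close> the norm of \<open>f \<chi>\<^sub>A\<close> is absolutely
  continuous with respect to finitely many of the measures \<open>|x\<^sup>*\<nu>|\<close> (up to any given error), by
  Orlicz--Pettis and the argument of Bartle, Dunford and Schwartz. Hence, if the sets \<open>D\<^sub>n\<close> tend to zero
  for every \<open>|x\<^sup>*\<nu>|\<close>, the restrictions to \<open>D\<^sub>n\<close> of some subsequence of \<open>f\<^sub>n\<close> are disjoint up to a small error.

  If the positive weakly null \<open>f\<^sub>n\<close> are not norm null, split at \<open>D\<^sub>n = {f\<^sub>n > \<eta>}\<close>; signs \<open>g\<^sub>n\<close> supported on
  the disjoint pieces recover the norm of \<open>f\<^sub>n\<close> in the integral of \<open>f\<^sub>n g\<^sub>n\<close>, and a bounded disjoint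
  sequence is weakly null in \<open>L\<^sub>\<infinity>(\<nu>)\<close>. Conversely, a weakly null sequence \<open>g\<^sub>n\<close> in \<open>L\<^sub>\<infinity>(\<nu>)\<close> tends to zero in
  every measure \<open>|x\<^sup>*\<nu>|\<close>, so \<open>f\<^sub>n g\<^sub>n\<close> can be split at \<open>D\<^sub>n = {|g\<^sub>n| > \<epsilon>}\<close>. The moduli of the disjoint
  pieces are weakly null, because the matrix \<open>\<psi>(f\<^sub>n h\<^sub>k)\<close>, with \<open>h\<^sub>k\<close> disjoint and bounded, has null diagonal
  by a gliding hump (Schur's theorem in \<open>l\<^sub>1\<close>), and the positive Schur property applies.
\<close>

section \<open>Bounded linear functionals\<close>

text \<open>Both directions need sets that are small for every measure \<open>V x\<close>, and they
  find them in different places. For positive \<open>f n\<close> the integral against a variation is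
  itself a bounded functional, so weak nullity and Chebyshev's inequality suffice. Without
  positivity the smallness must come from the second sequence. There the obstacle is the dual of the
  space of essentially bounded functions, whose functionals need not be integrals; this is turned to
  advantage, since a limit of averages is a functional that detects any failure of convergence in
  measure. The moduli of a weakly null sequence need not be weakly null, so the positive Schur
  property does not apply to the moduli of the products directly. On disjoint supports the signs are
  absorbed into a disjoint sequence of bounded multipliers, which preserves weak nullity. No single
  functional whose variation controls \<open>\<nu>\<close> is chosen. Each \<open>f n\<close> has
  its own finite set of functionals, and the choice of the subsequence copes with all of these
  sets.\<close>

definition sublinear :: "('v::real_vector \<Rightarrow> real) \<Rightarrow> bool" where
  "sublinear p \<longleftrightarrow> (\<forall>x y. p (x + y) \<le> p x + p y) \<and> (\<forall>c x. 0 \<le> c \<longrightarrow> p (c *\<^sub>R x) = c * p x)"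

text \<open>One inequality is enough for homogeneity: applied with \<open>1 / c\<close> it yields
  the other.\<close>

lemma sublinearI:
  assumes "\<And>x y. p (x + y) \<le> p x + p y"
    and "\<And>c x. 0 < c \<Longrightarrow> p (c *\<^sub>R x) \<le> c * p x"
    and "p 0 = 0"
  shows "sublinear p"
proof -
  have "p (c *\<^sub>R x) = c * p x" if "0 < c" for c x
  proof (rule antisym)
    have "p ((1 / c) *\<^sub>R (c *\<^sub>R x)) \<le> 1 / c * p (c *\<^sub>R x)"
      using that by (intro assms(2)) auto
    then show "c * p x \<le> p (c *\<^sub>R x)"
      using that by (simp add: field_simps)
  qed (use assms(2) that in auto)
  moreover have "p (0 *\<^sub>R x) = 0 * p x" for x
    using assms(3) by simp
  ultimately show ?thesis
    using assms(1) unfolding sublinear_def by (metis less_eq_real_def)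
qed

lemma sublinear_zero: "sublinear p \<Longrightarrow> p 0 = 0"
  unfolding sublinear_def by (metis mult_zero_left order_refl scaleR_zero_left)

lemma sublinear_lower:
  assumes "sublinear p"
  shows "- p (- x) \<le> p x"
proof -
  have "p (x + - x) \<le> p x + p (- x)"
    using assms unfolding sublinear_def by blast
  then show ?thesis
    using sublinear_zero[OF assms] by simp
qed

text \<open>The standard device of the Hahn-Banach theorem. For sublinear \<open>p\<close> it lies
  below \<open>p\<close> (take \<open>t = 0\<close>), and its value at \<open>- y\<close> is at most
  \<open>- p y\<close> (take \<open>t = 1\<close>), so a linear functional below it must agree with
  \<open>p\<close> at \<open>y\<close>.\<close>

definition lower_along :: "('v::real_vector \<Rightarrow> real) \<Rightarrow> 'v \<Rightarrow> 'v \<Rightarrow> real" where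
  "lower_along p y x = (INF t\<in>{0..}. p (x + t *\<^sub>R y) - t * p y)"

lemma lower_along_bdd:
  assumes "sublinear p"
  shows "bdd_below ((\<lambda>t. p (x + t *\<^sub>R y) - t * p y) ` {0..})"
proof (rule bdd_belowI2)
  fix t :: real assume t: "t \<in> {0..}"
  have "p (t *\<^sub>R y) \<le> p (x + t *\<^sub>R y) + p (- x)"
    using assms unfolding sublinear_def by (metis add.commute add_minus_cancel)
  moreover have "p (t *\<^sub>R y) = t * p y"
    using assms t unfolding sublinear_def by auto
  ultimately show "- p (- x) \<le> p (x + t *\<^sub>R y) - t * p y"
    by linarith
qed

lemma lower_along_le:
  assumes "sublinear p" "0 \<le> t"
  shows "lower_along p y x \<le> p (x + t *\<^sub>R y) - t * p y"
  unfolding lower_along_def using assms by (intro cINF_lower lower_along_bdd) auto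

lemma sublinear_lower_along:
  assumes "sublinear p"
  shows "sublinear (lower_along p y)"
proof (rule sublinearI)
  fix x x'
  have "lower_along p y (x + x') - (p (x' + t' *\<^sub>R y) - t' * p y) \<le> p (x + t *\<^sub>R y) - t * p y"
    if t: "t \<ge> 0" "t' \<ge> 0" for t t'
  proof -
    have "lower_along p y (x + x') \<le> p (x + x' + (t + t') *\<^sub>R y) - (t + t') * p y"
      using t by (intro lower_along_le assms) auto
    moreover have "x + x' + (t + t') *\<^sub>R y = (x + t *\<^sub>R y) + (x' + t' *\<^sub>R y)"
      by (simp add: algebra_simps)
    moreover have "p ((x + t *\<^sub>R y) + (x' + t' *\<^sub>R y)) \<le> p (x + t *\<^sub>R y) + p (x' + t' *\<^sub>R y)"
      using assms unfolding sublinear_def by blast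
    ultimately show ?thesis
      by (simp add: algebra_simps)
  qed
  then have "lower_along p y (x + x') - (p (x' + t' *\<^sub>R y) - t' * p y) \<le> lower_along p y x"
    if "t' \<ge> 0" for t'
    unfolding lower_along_def[of p y x] using that by (intro cINF_greatest) auto
  then have "lower_along p y (x + x') - lower_along p y x \<le> p (x' + t' *\<^sub>R y) - t' * p y"
    if "t' \<ge> 0" for t'
    using that by (simp add: algebra_simps)
  then have "lower_along p y (x + x') - lower_along p y x \<le> lower_along p y x'"
    unfolding lower_along_def[of p y x'] by (intro cINF_greatest) auto
  then show "lower_along p y (x + x') \<le> lower_along p y x + lower_along p y x'"
    by linarith
next
  fix c :: real and x assume c: "0 < c"
  have "lower_along p y (c *\<^sub>R x) / c \<le> p (x + t *\<^sub>R y) - t * p y" if t: "t \<ge> 0" for t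
  proof -
    have "lower_along p y (c *\<^sub>R x) \<le> p (c *\<^sub>R x + (c * t) *\<^sub>R y) - (c * t) * p y"
      using t c by (intro lower_along_le assms) auto
    moreover have "p (c *\<^sub>R x + (c * t) *\<^sub>R y) = c * p (x + t *\<^sub>R y)"
      using assms c unfolding sublinear_def by (metis less_imp_le scaleR_add_right scaleR_scaleR)
    ultimately show ?thesis
      using c by (simp add: field_simps)
  qed
  then have "lower_along p y (c *\<^sub>R x) / c \<le> lower_along p y x"
    unfolding lower_along_def[of p y x] by (intro cINF_greatest) auto
  then show "lower_along p y (c *\<^sub>R x) \<le> c * lower_along p y x"
    using c by (simp add: field_simps)
next
  have "p (0 + t *\<^sub>R y) - t * p y = 0" if "t \<in> {0..}" for t
    using assms that unfolding sublinear_def by auto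
  then have "(\<lambda>t. p (0 + t *\<^sub>R y) - t * p y) ` {0..} = {0}"
    by (auto simp: image_iff intro!: bexI[of _ 0])
  then show "lower_along p y 0 = 0"
    unfolding lower_along_def by simp
qed

text \<open>A minimal sublinear functional is linear, because it equals its own lowering along each vector.\<close>

lemma exists_linear_le_sublinear:
  fixes p :: "'v::real_vector \<Rightarrow> real"
  assumes p: "sublinear p"
  shows "\<exists>\<phi>. linear \<phi> \<and> (\<forall>x. \<phi> x \<le> p x)"
proof -
  define Q where "Q = {q. sublinear q \<and> q \<le> p}"
  have po: "partial_order_on Q (relation_of (\<lambda>a b. b \<le> a) Q)"
    unfolding partial_order_on_def preorder_on_def refl_on_def trans_def antisym_def relation_of_def
    by auto
  have "\<exists>u\<in>Q. \<forall>a\<in>C. u \<le> a" if C: "C \<in> Chains (relation_of (\<lambda>a b. b \<le> a) Q)" for C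
  proof (cases "C = {}")
    case True
    then show ?thesis using p by (auto simp: Q_def)
  next
    case False
    have CQ: "C \<subseteq> Q" and ch: "\<And>a b. a \<in> C \<Longrightarrow> b \<in> C \<Longrightarrow> a \<le> b \<or> b \<le> a"
      using C unfolding Chains_def relation_of_def by auto
    have bdd: "bdd_below ((\<lambda>q. q x) ` C)" for x
    proof (rule bdd_belowI2)
      fix q assume "q \<in> C"
      then have "sublinear q" "q \<le> p"
        using CQ by (auto simp: Q_def)
      then show "- p (- x) \<le> q x"
        using sublinear_lower[of q x] by (meson le_funD neg_le_iff_le order_trans)
    qed
    define u where "u x = (INF q\<in>C. q x)" for x
    have u_le: "u x \<le> q x" if "q \<in> C" for q x
      unfolding u_def using bdd that by (intro cINF_lower)
    have "sublinear u"
    proof (rule sublinearI)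
      fix x y
      have *: "u (x + y) \<le> q x + r y" if qr: "q \<in> C" "r \<in> C" for q r
      proof -
        \<comment> \<open>An infimum of sublinear functionals need not be subadditive. In a chain,
          however, the smaller of two members bounds both summands.\<close>
        obtain s where s: "s \<in> C" "s \<le> q" "s \<le> r"
          using ch[OF qr] qr by (metis order_refl)
        have "u (x + y) \<le> s (x + y)"
          using s u_le by auto
        also have "\<dots> \<le> s x + s y"
          using s CQ unfolding Q_def sublinear_def by blast
        also have "\<dots> \<le> q x + r y"
          using s by (intro add_mono) (auto simp: le_fun_def)
        finally show ?thesis .
      qed
      have "u (x + y) - r y \<le> u x" if "r \<in> C" for r
        unfolding u_def[of x] using *[OF _ that] False by (intro cINF_greatest) (auto simp: algebra_simps)
      then have "u (x + y) - u x \<le> r y" if "r \<in> C" for r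
        using that by (simp add: algebra_simps)
      then have "u (x + y) - u x \<le> u y"
        unfolding u_def[of y] using False by (intro cINF_greatest) auto
      then show "u (x + y) \<le> u x + u y" by simp
    next
      fix c :: real and x assume c: "0 < c"
      have "u (c *\<^sub>R x) / c \<le> q x" if q: "q \<in> C" for q
      proof -
        have "q (c *\<^sub>R x) = c * q x"
          using q CQ c unfolding Q_def sublinear_def by (auto simp: subset_eq)
        then show ?thesis
          using u_le[OF q, of "c *\<^sub>R x"] c by (simp add: field_simps)
      qed
      then have "u (c *\<^sub>R x) / c \<le> u x"
        unfolding u_def[of x] using False by (intro cINF_greatest) auto
      then show "u (c *\<^sub>R x) \<le> c * u x"
        using c by (simp add: field_simps)
    next
      have "(\<lambda>q. q 0) ` C = {0}"
        using CQ False sublinear_zero unfolding Q_def by fastforce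
      then show "u 0 = 0" unfolding u_def by simp
    qed
    moreover have "u \<le> p"
    proof -
      obtain q where "q \<in> C" "q \<le> p"
        using False CQ by (auto simp: Q_def)
      then show ?thesis
        using u_le unfolding le_fun_def by (meson order_trans)
    qed
    ultimately show ?thesis
      using u_le by (intro bexI[of _ u]) (auto simp: Q_def le_fun_def)
  qed
  from predicate_Zorn[where P = "\<lambda>a b. b \<le> a", OF po this] obtain m where m: "m \<in> Q" and min: "\<And>a. a \<in> Q \<Longrightarrow> a \<le> m \<Longrightarrow> a = m"
    by blast
  have sm: "sublinear m" and mp: "m \<le> p"
    using m by (auto simp: Q_def)
  have add: "m (x + y) = m x + m y" for x y
  proof (rule antisym)
    have "lower_along m y \<le> m"
      using lower_along_le[OF sm, of 0 y] by (simp add: le_fun_def)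
    then have "lower_along m y = m"
      using sublinear_lower_along[OF sm] mp by (intro min) (auto simp: Q_def)
    \<comment> \<open>At \<open>t = 1\<close> the lowering is \<open>m (x + y) - m y\<close>, and it
      now dominates \<open>m x\<close>.\<close>
    then show "m x + m y \<le> m (x + y)"
      using lower_along_le[OF sm, of 1 y x] by simp
  qed (use sm in \<open>auto simp: sublinear_def\<close>)
  have neg: "m (- x) = - m x" for x
    using add[of x "- x"] sublinear_zero[OF sm] by simp
  have "m (c *\<^sub>R x) = c * m x" for c x
  proof (cases "0 \<le> c")
    case False
    then have "m ((- c) *\<^sub>R x) = - c * m x"
      using sm unfolding sublinear_def by (metis linear neg_0_le_iff_le)
    then show ?thesis
      using neg[of "c *\<^sub>R x"] by simp
  qed (use sm in \<open>auto simp: sublinear_def\<close>)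
  then have "linear m"
    using add by (intro linearI) auto
  then show ?thesis
    using mp by (auto simp: le_fun_def)
qed

lemma exists_linear_le_sublinear_eq:
  fixes p :: "'v::real_vector \<Rightarrow> real"
  assumes p: "sublinear p"
  shows "\<exists>\<phi>. linear \<phi> \<and> (\<forall>x. \<phi> x \<le> p x) \<and> \<phi> y = p y"
proof -
  obtain \<phi> where lin: "linear \<phi>" and le: "\<And>x. \<phi> x \<le> lower_along p y x"
    using exists_linear_le_sublinear[OF sublinear_lower_along[OF p]] by blast
  have le': "\<phi> x \<le> p x" for x
    using le[of x] lower_along_le[OF p, of 0 y x] by simp
  have "\<phi> (- y) \<le> p (- y + 1 *\<^sub>R y) - 1 * p y"
    using le lower_along_le[OF p, of 1 y "- y"] by (meson order_trans zero_le_one)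
  then have "p y \<le> \<phi> y"
    using sublinear_zero[OF p] linear_neg[OF lin] by simp
  then show ?thesis
    using lin le' by (metis antisym)
qed

section \<open>Consequences of the Hahn-Banach theorem in normed spaces\<close>

lemma linear_bounded_blinfun:
  fixes \<phi> :: "'v::real_normed_vector \<Rightarrow> real"
  assumes "linear \<phi>" "0 \<le> C" "\<And>x. \<bar>\<phi> x\<bar> \<le> C * norm x"
  obtains x where "norm x \<le> C" "\<And>v. blinfun_apply x v = \<phi> v"
proof -
  have "bounded_linear \<phi>"
    using assms by (intro bounded_linear_intro[where K = C])
      (auto simp: linear_add linear_scale mult.commute)
  then have *: "blinfun_apply (Blinfun \<phi>) v = \<phi> v" for v
    by (simp add: bounded_linear_Blinfun_apply)
  then have "norm (Blinfun \<phi>) \<le> C"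
    using assms by (intro norm_blinfun_bound) auto
  then show ?thesis using * that by blast
qed

lemma linear_le_abs_le:
  assumes "linear \<phi>" "\<And>x. \<phi> x \<le> (p x :: real)" "\<And>x. p (- x) = p x"
  shows "\<bar>\<phi> x\<bar> \<le> p x"
  using assms(2)[of x] assms(2)[of "- x"] assms(3)[of x] linear_neg[OF assms(1), of x] by auto

lemma exists_norming_functional:
  fixes y :: "'a::real_normed_vector"
  obtains x :: "'a \<Rightarrow>\<^sub>L real" where "norm x \<le> 1" "blinfun_apply x y = norm y"
proof -
  have "sublinear (norm :: 'a \<Rightarrow> real)"
    unfolding sublinear_def by (simp add: norm_triangle_ineq)
  then obtain \<phi> where \<phi>: "linear \<phi>" "\<And>x. \<phi> x \<le> norm x" "\<phi> y = norm y"
    using exists_linear_le_sublinear_eq by blast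
  then show ?thesis
    using linear_bounded_blinfun[of \<phi> 1] linear_le_abs_le[of \<phi> norm] that
    by (metis mult_1 norm_minus_cancel zero_le_one)
qed

lemma abs_blinfun_apply_le:
  fixes x :: "'a::real_normed_vector \<Rightarrow>\<^sub>L real"
  assumes "norm x \<le> 1"
  shows "\<bar>blinfun_apply x y\<bar> \<le> norm y"
  using norm_blinfun[of x y] mult_right_mono[OF assms norm_ge_zero[of y]] by simp

lemma norm_le_by_functionals:
  fixes y :: "'a::real_normed_vector"
  assumes "\<And>x :: 'a \<Rightarrow>\<^sub>L real. norm x \<le> 1 \<Longrightarrow> blinfun_apply x y \<le> K"
  shows "norm y \<le> K"
  using exists_norming_functional[of y] assms by metis

lemma blinfun_separate:
  fixes y z :: "'a::real_normed_vector"
  assumes "\<And>x :: 'a \<Rightarrow>\<^sub>L real. blinfun_apply x y = blinfun_apply x z"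
  shows "y = z"
  using norm_le_by_functionals[of "y - z" 0] assms by (simp add: blinfun.diff_right)

text \<open>The distance to the span is sublinear and at most the norm. A linear functional below it
  that attains it at \<open>z\<close> vanishes on \<open>Y\<close>; the hypothesis then makes the
  distance of \<open>z\<close> zero.\<close>

lemma in_closure_span_by_functionals:
  fixes z :: "'a::real_normed_vector"
  assumes "\<And>x :: 'a \<Rightarrow>\<^sub>L real. (\<And>y. y \<in> Y \<Longrightarrow> blinfun_apply x y = 0) \<Longrightarrow> blinfun_apply x z = 0"
  shows "z \<in> closure (span Y)"
proof -
  let ?p = "\<lambda>v. infdist v (span Y)"
  have ne: "span Y \<noteq> {}"
    using span_zero by blast
  have p_le: "?p v \<le> norm (v - w)" if "w \<in> span Y" for v w
    using infdist_le[OF that, of v] by (simp add: dist_norm)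
  have p_approx: "\<exists>w\<in>span Y. norm (v - w) < ?p v + e" if "e > 0" for v e
  proof (rule ccontr)
    assume "\<not> ?thesis"
    then have "?p v + e \<le> ?p v"
      unfolding infdist_notempty[OF ne] using ne
      by (intro cINF_greatest) (auto simp: dist_norm infdist_notempty[OF ne] not_less)
    then show False using that by simp
  qed
  have "sublinear ?p"
  proof (rule sublinearI)
    fix v w
    show "?p (v + w) \<le> ?p v + ?p w"
    proof (rule field_le_epsilon)
      fix e :: real assume "e > 0"
      then obtain a b where ab: "a \<in> span Y" "b \<in> span Y"
        "norm (v - a) < ?p v + e / 2" "norm (w - b) < ?p w + e / 2"
        using p_approx[of "e / 2"] by (metis half_gt_zero)
      have "?p (v + w) \<le> norm ((v + w) - (a + b))"
        by (intro p_le span_add ab)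
      also have "\<dots> \<le> norm (v - a) + norm (w - b)"
        by (metis add_diff_add norm_triangle_ineq)
      finally show "?p (v + w) \<le> ?p v + ?p w + e" using ab by argo
    qed
  next
    fix c :: real and v assume c: "c > 0"
    show "?p (c *\<^sub>R v) \<le> c * ?p v"
    proof (rule field_le_epsilon)
      fix e :: real assume e: "e > 0"
      then obtain a where a: "a \<in> span Y" "norm (v - a) < ?p v + e / c"
        using p_approx[of "e / c" v] c by auto
      have "?p (c *\<^sub>R v) \<le> norm (c *\<^sub>R v - c *\<^sub>R a)"
        by (intro p_le span_scale a)
      also have "\<dots> = c * norm (v - a)"
        using c by (simp flip: scaleR_diff_right)
      also have "\<dots> \<le> c * (?p v + e / c)"
        using c a by (intro mult_left_mono) auto
      also have "\<dots> = c * ?p v + e"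
        using c by (simp add: distrib_left)
      finally show "?p (c *\<^sub>R v) \<le> c * ?p v + e" .
    qed
  next
    show "?p 0 = 0" using span_zero by (rule infdist_zero)
  qed
  then obtain \<phi> where \<phi>: "linear \<phi>" "\<And>v. \<phi> v \<le> ?p v" "\<phi> z = ?p z"
    using exists_linear_le_sublinear_eq by blast
  have pn: "?p v \<le> norm v" for v
    using p_le[OF span_zero] by simp
  obtain x where x: "\<And>v. blinfun_apply x v = \<phi> v"
  proof (rule linear_bounded_blinfun[OF \<phi>(1), of 1])
    show "\<bar>\<phi> v\<bar> \<le> 1 * norm v" for v
      using linear_le_abs_le[of \<phi> norm v] \<phi> pn by (simp, meson norm_minus_cancel order_trans)
  qed auto
  have "blinfun_apply x y = 0" if "y \<in> Y" for y
  proof -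
    have "y \<in> span Y" "- y \<in> span Y"
      using that by (auto simp: span_base span_neg)
    then show ?thesis
      using \<phi>(2)[of y] \<phi>(2)[of "- y"] linear_neg[OF \<phi>(1), of y] by (simp add: x)
  qed
  then have "?p z = 0"
    using assms[of x] \<phi>(3) by (simp add: x)
  then show ?thesis
    using in_closure_iff_infdist_zero[OF ne] by blast
qed

text \<open>A Banach limit without shift invariance.\<close>

definition generalized_limit :: "((nat \<Rightarrow> real) \<Rightarrow> real) \<Rightarrow> bool" where
  "generalized_limit \<Lambda> \<longleftrightarrow>
     (\<forall>s t. bounded (range s) \<longrightarrow> bounded (range t) \<longrightarrow> \<Lambda> (\<lambda>k. s k + t k) = \<Lambda> s + \<Lambda> t) \<and>
     (\<forall>c s. bounded (range s) \<longrightarrow> \<Lambda> (\<lambda>k. c * s k) = c * \<Lambda> s) \<and>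
     (\<forall>c s. bounded (range s) \<longrightarrow> (\<forall>\<^sub>F k in sequentially. s k \<le> c) \<longrightarrow> \<Lambda> s \<le> c)"

lemma generalized_limitD:
  assumes "generalized_limit \<Lambda>" "bounded (range s)"
  shows "bounded (range t) \<Longrightarrow> \<Lambda> (\<lambda>k. s k + t k) = \<Lambda> s + \<Lambda> t"
    and "\<Lambda> (\<lambda>k. c * s k) = c * \<Lambda> s"
    and "\<forall>\<^sub>F k in sequentially. s k \<le> c \<Longrightarrow> \<Lambda> s \<le> c"
  using assms unfolding generalized_limit_def by blast+

lemma generalized_limit_ge:
  assumes "generalized_limit \<Lambda>" "bounded (range s)" "\<forall>\<^sub>F k in sequentially. c \<le> s k"
  shows "c \<le> \<Lambda> s"
proof -
  have "\<Lambda> (\<lambda>k. (- 1) * s k) \<le> - c"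
    using assms(2,3) by (intro generalized_limitD(3)[OF assms(1)]) (auto simp: bounded_iff)
  then show ?thesis
    using generalized_limitD(2)[OF assms(1,2), of "- 1"] by simp
qed

lemma generalized_limit_abs_le:
  assumes "generalized_limit \<Lambda>" "\<And>k. \<bar>s k\<bar> \<le> C"
  shows "\<bar>\<Lambda> s\<bar> \<le> C"
proof -
  have bdd: "bounded (range s)"
    using assms(2) by (auto simp: bounded_iff)
  have le: "s k \<le> C" "- C \<le> s k" for k
    using assms(2)[of k] by (auto simp: abs_le_iff)
  have "\<Lambda> s \<le> C"
    using le(1) by (intro generalized_limitD(3)[OF assms(1) bdd] always_eventually) blast
  moreover have "- C \<le> \<Lambda> s"
    using le(2) by (intro generalized_limit_ge[OF assms(1) bdd] always_eventually) blast
  ultimately show ?thesis by linarith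
qed

text \<open>The infimum \<open>p\<close> of the eventual upper bounds is the limit superior. It is
  sublinear on bounded sequences, and every linear functional below it is a generalized limit.
  Bounded sequences are represented as bounded continuous functions on the discrete space of natural
  numbers.\<close>

lemma exists_generalized_limit: "\<exists>\<Lambda>. generalized_limit \<Lambda>"
proof -
  define U where "U s = {c. eventually (\<lambda>k. apply_bcontfun s k \<le> c) sequentially}"
    for s :: "nat \<Rightarrow>\<^sub>C real"
  define p where "p s = Inf (U s)" for s
  have bound: "\<bar>apply_bcontfun s k\<bar> \<le> norm s" for s :: "nat \<Rightarrow>\<^sub>C real" and k
    using norm_bounded[of s k] by simp
  have ne: "norm s \<in> U s" for s
    using bound[of s] unfolding U_def by (auto intro!: always_eventually simp: abs_le_iff)
  have low: "- norm s \<le> c" if c: "c \<in> U s" for s c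
  proof -
    obtain k where "apply_bcontfun s k \<le> c"
      using c eventually_happens'[of sequentially] unfolding U_def by auto
    then show ?thesis using bound[of s k] by linarith
  qed
  have bdd: "bdd_below (U s)" for s
    using low by (intro bdd_belowI)
  have up: "c + e \<in> U s" if "p s \<le> c" "e > 0" for s c e
  proof -
    have "Inf (U s) < c + e" using that by (simp add: p_def)
    then obtain d where "d \<in> U s" "d < c + e"
      using cInf_lessD[of "U s"] ne by blast
    then show ?thesis unfolding U_def by (auto elim: eventually_mono)
  qed
  have p_le: "p s \<le> c" if "c \<in> U s" for s c
    unfolding p_def using that bdd by (rule cInf_lower)
  have "sublinear p"
  proof (rule sublinearI)
    fix s t
    show "p (s + t) \<le> p s + p t"
    proof (rule field_le_epsilon)
      fix e :: real assume "e > 0"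
      then have "p s + e / 2 \<in> U s" "p t + e / 2 \<in> U t"
        by (auto intro!: up)
      then have "(p s + e / 2) + (p t + e / 2) \<in> U (s + t)"
        unfolding U_def by (auto simp: plus_bcontfun.rep_eq elim: eventually_elim2)
      then show "p (s + t) \<le> p s + p t + e"
        using p_le[of "(p s + e / 2) + (p t + e / 2)"] by (simp add: add.assoc add.left_commute add.commute)
    qed
  next
    fix c :: real and s assume c: "c > 0"
    show "p (c *\<^sub>R s) \<le> c * p s"
    proof (rule field_le_epsilon)
      fix e :: real assume "e > 0"
      then have "p s + e / c \<in> U s"
        using c by (auto intro!: up)
      then have "c * (p s + e / c) \<in> U (c *\<^sub>R s)"
        unfolding U_def using c by (auto elim!: eventually_mono)
      then show "p (c *\<^sub>R s) \<le> c * p s + e"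
        using p_le[of "c * (p s + e / c)" "c *\<^sub>R s"] c by (simp add: distrib_left)
    qed
  next
    have "U 0 = {0..}" unfolding U_def by auto
    then show "p 0 = 0" by (simp add: p_def)
  qed
  then obtain \<phi> where \<phi>: "linear \<phi>" "\<And>x. \<phi> x \<le> p x"
    using exists_linear_le_sublinear by blast
  have in_bc: "s \<in> bcontfun" if "bounded (range s)" for s :: "nat \<Rightarrow> real"
    using that by (simp add: bcontfun_def)
  define \<Lambda> where "\<Lambda> s = \<phi> (Bcontfun s)" for s
  have "generalized_limit \<Lambda>"
    unfolding generalized_limit_def
  proof (intro conjI allI impI)
    fix s t :: "nat \<Rightarrow> real" assume "bounded (range s)" "bounded (range t)"
    then have "Bcontfun (\<lambda>k. s k + t k) = Bcontfun s + Bcontfun t"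
      by (intro bcontfun_eqI) (simp add: Bcontfun_inverse in_bc plus_cont)
    then show "\<Lambda> (\<lambda>k. s k + t k) = \<Lambda> s + \<Lambda> t"
      by (simp add: \<Lambda>_def linear_add[OF \<phi>(1)])
  next
    fix c and s :: "nat \<Rightarrow> real" assume "bounded (range s)"
    then have "Bcontfun (\<lambda>k. c * s k) = c *\<^sub>R Bcontfun s"
      using scaleR_cont[of s c] by (intro bcontfun_eqI) (simp add: Bcontfun_inverse in_bc)
    then show "\<Lambda> (\<lambda>k. c * s k) = c * \<Lambda> s"
      by (simp add: \<Lambda>_def linear_scale[OF \<phi>(1)])
  next
    fix c and s :: "nat \<Rightarrow> real"
    assume "bounded (range s)" "eventually (\<lambda>k. s k \<le> c) sequentially"
    then have "c \<in> U (Bcontfun s)"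
      by (simp add: U_def Bcontfun_inverse in_bc)
    then show "\<Lambda> s \<le> c"
      using p_le \<phi>(2)[of "Bcontfun s"] unfolding \<Lambda>_def by (meson order_trans)
  qed
  then show ?thesis by blast
qed

section \<open>Gliding hump arguments\<close>

text \<open>The selection of indices in the gliding humps. Only consecutive values are controlled;
  where all earlier indices matter, \<open>P n m\<close> has to speak about every index up to
  \<open>n\<close>.\<close>

lemma exists_strict_mono_extension:
  assumes "\<And>n :: nat. eventually (\<lambda>m. P n m) sequentially"
  shows "\<exists>r :: nat \<Rightarrow> nat. strict_mono r \<and> (\<forall>k. P (r k) (r (Suc k)))"
proof -
  have "\<exists>r. \<forall>k. r k < r (Suc k) \<and> P (r k) (r (Suc k))"
  proof -
    have "\<exists>m. n < m \<and> P n m" for n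
    proof -
      have "eventually (\<lambda>m. n < m \<and> P n m) sequentially"
        by (intro eventually_conj eventually_gt_at_top assms)
      then show ?thesis by (auto simp: eventually_sequentially)
    qed
    then obtain h where h: "\<And>n. n < h n \<and> P n (h n)" by metis
    show ?thesis
      using h by (intro exI[of _ "\<lambda>k. (h ^^ k) 0"]) auto
  qed
  then show ?thesis by (auto simp: strict_mono_Suc_iff)
qed

lemma not_tendsto_zero_subseq:
  fixes u :: "nat \<Rightarrow> real"
  assumes "\<not> u \<longlonglongrightarrow> 0"
  obtains e r where "0 < e" "strict_mono (r :: nat \<Rightarrow> nat)" "\<And>n. e \<le> \<bar>u (r n)\<bar>"
proof -
  obtain e where e: "0 < e" "\<And>N. \<exists>n\<ge>N. e \<le> \<bar>u n\<bar>"
    using assms unfolding LIMSEQ_iff by (auto simp: not_less)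
  then have "infinite {n. e \<le> \<bar>u n\<bar>}"
    unfolding infinite_nat_iff_unbounded_le by auto
  then obtain r :: "nat \<Rightarrow> nat" where "strict_mono r" "\<forall>n. r n \<in> {n. e \<le> \<bar>u n\<bar>}"
    using infinite_enumerate[of "{n. e \<le> \<bar>u n\<bar>}"] by auto
  then show ?thesis
    using e that by blast
qed

text \<open>If the diagonal stays away from zero, sparse indices make each selected diagonal entry
  dominate its row: earlier columns have become small in that row, and later columns lie in its
  small tail. The sums over the set of selected indices then cannot tend to zero.\<close>

lemma diagonal_tendsto_zero:
  fixes a :: "nat \<Rightarrow> nat \<Rightarrow> real"
  assumes abs_summable: "\<And>n. summable (\<lambda>k. \<bar>a n k\<bar>)"
    and lim: "\<And>\<sigma>. (\<lambda>n. \<Sum>k. if k \<in> \<sigma> then a n k else 0) \<longlonglongrightarrow> 0"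
  shows "(\<lambda>n. a n n) \<longlonglongrightarrow> 0"
proof (rule ccontr)
  assume "\<not> ?thesis"
  then obtain e q where e: "0 < e" and q: "strict_mono (q :: nat \<Rightarrow> nat)"
    and big: "\<And>n. e \<le> \<bar>a (q n) (q n)\<bar>"
    using not_tendsto_zero_subseq by blast
  have col: "(\<lambda>n. a n k) \<longlonglongrightarrow> 0" for k
  proof -
    have "(\<Sum>j. if j \<in> {k} then a n j else 0) = a n k" for n
      by (subst suminf_finite[of "{k}"]) auto
    then show ?thesis using lim[of "{k}"] by simp
  qed
  \<comment> \<open>The first condition can be met because the columns tend to zero, the second
    because the rows are summable. Two errors below \<open>e / 4\<close> leave more than
    \<open>e / 2\<close> of a diagonal entry of size at least \<open>e\<close>.\<close>
  define P where "P n m \<longleftrightarrow> (\<Sum>k\<le>q n. \<bar>a (q m) k\<bar>) < e / 4 \<and>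
      (\<Sum>k. \<bar>a (q n) (k + q m)\<bar>) < e / 4" for n m
  have "eventually (P n) sequentially" for n
  proof -
    have "(\<lambda>m. \<Sum>k\<le>q n. \<bar>a (q m) k\<bar>) \<longlonglongrightarrow> (\<Sum>k\<le>q n. \<bar>0\<bar>)"
      by (intro tendsto_intros) (rule LIMSEQ_subseq_LIMSEQ[OF col q, unfolded o_def])
    then have 1: "eventually (\<lambda>m. (\<Sum>k\<le>q n. \<bar>a (q m) k\<bar>) < e / 4) sequentially"
      using e by (intro order_tendstoD) auto
    have "(\<lambda>m. \<Sum>k. \<bar>a (q n) (k + m)\<bar>) \<longlonglongrightarrow> 0"
      using suminf_exist_split2[OF abs_summable] by simp
    then have "(\<lambda>m. \<Sum>k. \<bar>a (q n) (k + q m)\<bar>) \<longlonglongrightarrow> 0"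
      using LIMSEQ_subseq_LIMSEQ[OF _ q] unfolding o_def by fast
    then have 2: "eventually (\<lambda>m. (\<Sum>k. \<bar>a (q n) (k + q m)\<bar>) < e / 4) sequentially"
      using e by (intro order_tendstoD) auto
    show ?thesis
      using 1 2 unfolding P_def by (rule eventually_conj)
  qed
  then obtain r where r: "strict_mono r" and P: "\<And>k. P (r k) (r (Suc k))"
    using exists_strict_mono_extension[of P] by blast
  define s where "s = q \<circ> r"
  have s: "strict_mono s"
    unfolding s_def using q r by (rule strict_mono_o)
  define \<sigma> where "\<sigma> = range s"
  let ?b = "\<lambda>n k. if k \<in> \<sigma> then a n k else 0"
  \<comment> \<open>Row \<open>s (Suc i)\<close> and not \<open>s i\<close>: the estimate needs a
    selected index before it as well as one after it.\<close>
  have lower: "e / 2 < \<bar>\<Sum>k. ?b (s (Suc i)) k\<bar>" for i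
  proof -
    let ?n = "s (Suc i)" and ?m = "s (Suc (Suc i))"
    have summ: "summable (?b ?n)"
      by (rule summable_comparison_test'[OF abs_summable[of ?n], of 0]) auto
    have head: "(\<Sum>k<?m. ?b ?n k) = (\<Sum>k\<in>\<sigma> \<inter> {..<?m}. a ?n k)"
      by (simp add: sum.inter_restrict[symmetric] Int_commute)
    have \<sigma>_sub: "\<sigma> \<inter> {..<?m} \<subseteq> {..s i} \<union> {?n}"
    proof
      fix k assume "k \<in> \<sigma> \<inter> {..<?m}"
      then obtain j where j: "k = s j" "s j < ?m" by (auto simp: \<sigma>_def)
      then have "j < Suc (Suc i)" using strict_mono_less[OF s] by blast
      then have "j \<le> i \<or> j = Suc i" by auto
      then show "k \<in> {..s i} \<union> {?n}"
        using j strict_mono_less_eq[OF s] by auto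
    qed
    have n_in: "?n \<in> \<sigma> \<inter> {..<?m}"
      using strict_mono_less[OF s] by (auto simp: \<sigma>_def)
    have "(\<Sum>k\<in>\<sigma> \<inter> {..<?m}. a ?n k) = a ?n ?n + (\<Sum>k\<in>\<sigma> \<inter> {..<?m} - {?n}. a ?n k)"
      using n_in by (intro sum.remove) auto
    moreover have "\<bar>\<Sum>k\<in>\<sigma> \<inter> {..<?m} - {?n}. a ?n k\<bar> \<le> (\<Sum>k\<le>s i. \<bar>a ?n k\<bar>)"
      using \<sigma>_sub by (intro order_trans[OF sum_abs] sum_mono2) auto
    moreover have "(\<Sum>k\<le>s i. \<bar>a ?n k\<bar>) < e / 4"
      using P[of i] by (simp add: P_def s_def)
    moreover have "\<bar>\<Sum>k. ?b ?n (k + ?m)\<bar> \<le> (\<Sum>k. \<bar>a ?n (k + ?m)\<bar>)"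
    proof -
      have 1: "summable (\<lambda>k. \<bar>a ?n (k + ?m)\<bar>)"
        using abs_summable summable_ignore_initial_segment by blast
      have 2: "summable (\<lambda>k. \<bar>?b ?n (k + ?m)\<bar>)"
        by (rule summable_comparison_test'[OF 1, of 0]) auto
      have "\<bar>\<Sum>k. ?b ?n (k + ?m)\<bar> \<le> (\<Sum>k. \<bar>?b ?n (k + ?m)\<bar>)"
        by (rule summable_rabs[OF 2])
      also have "\<dots> \<le> (\<Sum>k. \<bar>a ?n (k + ?m)\<bar>)"
        by (rule suminf_le[OF _ 2 1]) auto
      finally show ?thesis .
    qed
    moreover have "(\<Sum>k. \<bar>a ?n (k + ?m)\<bar>) < e / 4"
      using P[of "Suc i"] by (simp add: P_def s_def)
    moreover have "e \<le> \<bar>a ?n ?n\<bar>"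
      using big by (simp add: s_def)
    moreover have "(\<Sum>k. ?b ?n k) = (\<Sum>k. ?b ?n (k + ?m)) + (\<Sum>k<?m. ?b ?n k)"
      using suminf_split_initial_segment[OF summ] by blast
    ultimately show ?thesis
      unfolding head by linarith
  qed
  have "(\<lambda>i. \<Sum>k. ?b (s (Suc i)) k) \<longlonglongrightarrow> 0"
    using LIMSEQ_subseq_LIMSEQ[OF LIMSEQ_subseq_LIMSEQ[OF lim[of \<sigma>] s], of Suc]
    by (simp add: o_def strict_mono_Suc_iff)
  then have "eventually (\<lambda>i. \<bar>\<Sum>k. ?b (s (Suc i)) k\<bar> < e / 2) sequentially"
    using e by (intro order_tendstoD[OF tendsto_rabs_zero]) auto
  from eventually_happens'[OF sequentially_bot this] obtain i
    where "\<bar>\<Sum>k. ?b (s (Suc i)) k\<bar> < e / 2" ..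
  with lower[of i] show False by linarith
qed

text \<open>
  A special case of the uniform boundedness principle. The set \<open>T\<close> plays the role of the unit ball
  of the dual.
\<close>

lemma weakly_null_imp_bounded:
  fixes p :: "'u \<Rightarrow> real" and T :: "('u \<Rightarrow> real) set"
  assumes bound: "\<And>\<phi> n. \<phi> \<in> T \<Longrightarrow> \<bar>\<phi> (u n)\<bar> \<le> p (u n)"
    and null: "\<And>\<phi>. \<phi> \<in> T \<Longrightarrow> (\<lambda>n. \<phi> (u n)) \<longlonglongrightarrow> 0"
    and norming: "\<And>n. \<exists>\<phi>\<in>T. p (u n) \<le> 2 * \<phi> (u n)"
    and series: "\<And>\<phi> \<sigma>. range \<phi> \<subseteq> T \<Longrightarrow>
      (\<lambda>v. \<Sum>k. if k \<in> \<sigma> then (1 / 2) ^ Suc k * \<phi> k v else 0) \<in> T"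
  shows "\<exists>K. \<forall>n. p (u n) \<le> K"
proof (rule ccontr)
  assume "\<not> ?thesis"
  then have unb: "\<exists>n. K < p (u n)" for K
    by (metis not_less)
  have "\<exists>n\<ge>N. K < p (u n)" for N K
  proof -
    obtain n where n: "Max (insert K ((\<lambda>n. p (u n)) ` {..N})) < p (u n)"
      using unb by blast
    then have "K < p (u n)" by simp
    moreover have "\<not> n \<le> N" using n by auto
    ultimately show ?thesis by (meson linear)
  qed
  \<comment> \<open>The power of 2 outweighs the weight of the \<open>n\<close>th functional in the
    series below; the additional factor 2 pays for norming only up to a factor 2. Thus the diagonal
    entries of \<open>?a\<close> are at least 1.\<close>
  then have "\<exists>m>n. 2 * 2 ^ Suc n < p (u m)" for n
    by (meson Suc_le_eq)
  then obtain h where h: "\<And>n. n < h n" "\<And>n. 2 * 2 ^ Suc n < p (u (h n))"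
    by metis
  obtain \<phi> where \<phi>: "\<And>n. \<phi> n \<in> T" "\<And>n. p (u n) \<le> 2 * \<phi> n (u n)"
    using norming by metis
  \<comment> \<open>The map \<open>h\<close> may fail to be increasing, but tending to infinity is
    enough for limits along it.\<close>
  have "eventually (\<lambda>n. n \<le> h n) sequentially"
    using h(1) less_imp_le by (intro always_eventually) blast
  then have hlim: "filterlim h sequentially sequentially"
    by (rule filterlim_at_top_mono[OF filterlim_ident])
  let ?a = "\<lambda>n k. (1 / 2) ^ Suc k * \<phi> (h k) (u (h n))"
  have "(\<lambda>n. ?a n n) \<longlonglongrightarrow> 0"
  proof (rule diagonal_tendsto_zero[of ?a])
    fix n
    show "summable (\<lambda>k. \<bar>?a n k\<bar>)"
    proof (rule summable_comparison_test'[of "\<lambda>k. (1 / 2) ^ Suc k * p (u (h n))" 0])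
      show "summable (\<lambda>k. (1 / 2) ^ Suc k * p (u (h n)))"
        by (intro summable_mult2) (simp add: summable_geometric)
      show "norm \<bar>?a n k\<bar> \<le> (1 / 2) ^ Suc k * p (u (h n))" if "0 \<le> k" for k
        using bound[OF \<phi>(1), of "h k" "h n"] by (simp add: abs_mult mult_left_mono)
    qed
  next
    fix \<sigma>
    have "(\<lambda>v. \<Sum>k. if k \<in> \<sigma> then (1 / 2) ^ Suc k * \<phi> (h k) v else 0) \<in> T"
      by (rule series) (use \<phi> in auto)
    from filterlim_compose[OF null[OF this] hlim]
    show "(\<lambda>n. \<Sum>k. if k \<in> \<sigma> then ?a n k else 0) \<longlonglongrightarrow> 0" by simp
  qed
  then have "eventually (\<lambda>n. ?a n n < 1) sequentially"
    by (rule order_tendstoD) simp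
  then obtain n where "?a n n < 1"
    by (auto simp: eventually_sequentially)
  moreover have "2 ^ Suc n \<le> \<phi> (h n) (u (h n))"
    using \<phi>(2)[of "h n"] h(2)[of n] by linarith
  then have "1 \<le> ?a n n"
    by (simp add: field_simps power_one_over)
  ultimately show False by simp
qed

lemma suminf_half_pow_abs_le:
  assumes "\<And>k. \<bar>b k\<bar> \<le> (B::real)"
  shows "summable (\<lambda>k. if k \<in> \<sigma> then (1 / 2) ^ Suc k * b k else 0)"
    and "\<bar>\<Sum>k. if k \<in> \<sigma> then (1 / 2) ^ Suc k * b k else 0\<bar> \<le> B"
proof -
  let ?f = "\<lambda>k. if k \<in> \<sigma> then (1 / 2) ^ Suc k * b k else 0"
  have B: "(\<lambda>k. (1 / 2) ^ Suc k * B) sums (1 * B)"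
    by (intro sums_mult2 power_half_series)
  have le: "norm (?f k) \<le> (1 / 2) ^ Suc k * B" for k
  proof -
    have "0 \<le> B" using assms[of k] by linarith
    then show ?thesis
      using assms[of k] by (auto simp: abs_mult mult_left_mono)
  qed
  show "summable ?f"
    by (rule summable_comparison_test'[OF sums_summable[OF B] le])
  show "\<bar>\<Sum>k. ?f k\<bar> \<le> B"
  proof -
    have abs: "summable (\<lambda>k. \<bar>?f k\<bar>)"
      by (rule summable_comparison_test'[OF sums_summable[OF B], of 0]) (use le in auto)
    have "\<bar>\<Sum>k. ?f k\<bar> \<le> (\<Sum>k. \<bar>?f k\<bar>)"
      by (rule summable_rabs[OF abs])
    also have "\<dots> \<le> (\<Sum>k. (1 / 2) ^ Suc k * B)"
      using le by (intro suminf_le abs sums_summable[OF B]) auto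
    finally show ?thesis
      using sums_unique[OF B] by simp
  qed
qed

text \<open>Here \<open>w\<close> stands for the combination of \<open>u\<close> and
  \<open>v\<close> with coefficients \<open>c\<close> and \<open>d\<close>. It is left abstract
  because the combination is formed by vector operations in one use and by pointwise operations in
  another.\<close>

lemma linear_half_pow_series:
  fixes \<phi> :: "nat \<Rightarrow> 'u \<Rightarrow> real"
  assumes "\<And>k. \<phi> k w = c * \<phi> k u + d * \<phi> k v" "\<And>k. \<bar>\<phi> k u\<bar> \<le> B" "\<And>k. \<bar>\<phi> k v\<bar> \<le> C"
  shows "(\<Sum>k. if k \<in> \<sigma> then (1 / 2) ^ Suc k * \<phi> k w else 0) =
    c * (\<Sum>k. if k \<in> \<sigma> then (1 / 2) ^ Suc k * \<phi> k u else 0) +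
    d * (\<Sum>k. if k \<in> \<sigma> then (1 / 2) ^ Suc k * \<phi> k v else 0)"
proof -
  let ?S = "\<lambda>v k. if k \<in> \<sigma> then (1 / 2) ^ Suc k * \<phi> k v else 0"
  have "summable (?S u)" "summable (?S v)"
    by (rule suminf_half_pow_abs_le(1)[where B = B, OF assms(2)],
        rule suminf_half_pow_abs_le(1)[where B = C, OF assms(3)])
  then have "(\<Sum>k. c * ?S u k + d * ?S v k) = c * (\<Sum>k. ?S u k) + d * (\<Sum>k. ?S v k)"
    by (simp add: suminf_add[symmetric] suminf_mult summable_mult)
  moreover have "c * ?S u k + d * ?S v k = ?S w k" for k
    by (auto simp: assms(1) algebra_simps)
  ultimately show ?thesis by simp
qed

section \<open>Uniform boundedness and the Orlicz-Pettis theorem\<close>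

text \<open>A reduction to weakly null sequences: weak boundedness makes \<open>y n\<close> divided
  by \<open>2 ^ n\<close> weakly null, while norms above \<open>n * 2 ^ n\<close> keep the quotients
  unbounded.\<close>

lemma uniform_boundedness_dual:
  fixes Y :: "'a::real_normed_vector set"
  assumes "\<And>x :: 'a \<Rightarrow>\<^sub>L real. \<exists>K. \<forall>y\<in>Y. \<bar>blinfun_apply x y\<bar> \<le> K"
  shows "\<exists>K. \<forall>y\<in>Y. norm y \<le> K"
proof (rule ccontr)
  assume "\<not> ?thesis"
  then have "\<exists>y\<in>Y. K < norm y" for K
    by (meson not_less)
  then have "\<forall>n::nat. \<exists>y\<in>Y. real n * 2 ^ n < norm y" by blast
  then obtain y where y: "\<And>n::nat. y n \<in> Y" "\<And>n. real n * 2 ^ n < norm (y n)"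
    by metis
  define u where "u n = (1 / 2 ^ n) *\<^sub>R y n" for n
  define T :: "('a \<Rightarrow> real) set" where "T = {\<phi>. linear \<phi> \<and> (\<forall>v. \<bar>\<phi> v\<bar> \<le> norm v)}"
  have "\<exists>K. \<forall>n. norm (u n) \<le> K"
  proof (rule weakly_null_imp_bounded[of T u norm])
    fix \<phi> assume "\<phi> \<in> T"
    then obtain x where x: "\<And>v. blinfun_apply x v = \<phi> v"
      using linear_bounded_blinfun[of \<phi> 1] unfolding T_def by (metis (mono_tags) mem_Collect_eq mult_1 zero_le_one)
    obtain K where K: "\<And>n. \<bar>\<phi> (y n)\<bar> \<le> K"
      using assms[of x] y(1) by (auto simp: x)
    show "(\<lambda>n. \<phi> (u n)) \<longlonglongrightarrow> 0"
    proof (rule Lim_null_comparison)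
      show "eventually (\<lambda>n. norm (\<phi> (u n)) \<le> K * (1 / 2) ^ n) sequentially"
        using K by (intro always_eventually)
          (auto simp: u_def x[symmetric] blinfun.scaleR_right power_one_over field_simps)
      show "(\<lambda>n. K * (1 / 2) ^ n) \<longlonglongrightarrow> 0"
        by (intro tendsto_mult_right_zero LIMSEQ_power_zero) simp
    qed
  next
    fix n
    obtain x :: "'a \<Rightarrow>\<^sub>L real" where x: "norm x \<le> 1" "blinfun_apply x (u n) = norm (u n)"
      using exists_norming_functional by blast
    have "blinfun_apply x \<in> T"
      unfolding T_def using abs_blinfun_apply_le[OF x(1)] by (auto intro!: linearI simp: blinfun.add_right blinfun.scaleR_right)
    then show "\<exists>\<phi>\<in>T. norm (u n) \<le> 2 * \<phi> (u n)"
      using x by (intro bexI[of _ "blinfun_apply x"]) auto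
  next
    fix \<phi> :: "nat \<Rightarrow> 'a \<Rightarrow> real" and \<sigma> assume "range \<phi> \<subseteq> T"
    then have lin: "linear (\<phi> k)" and bd: "\<bar>\<phi> k v\<bar> \<le> norm v" for k v
      by (auto simp: T_def)
    show "(\<lambda>v. \<Sum>k. if k \<in> \<sigma> then (1 / 2) ^ Suc k * \<phi> k v else 0) \<in> T"
      unfolding T_def
    proof (intro CollectI conjI allI linearI)
      fix v w
      show "(\<Sum>k. if k \<in> \<sigma> then (1 / 2) ^ Suc k * \<phi> k (v + w) else 0) =
        (\<Sum>k. if k \<in> \<sigma> then (1 / 2) ^ Suc k * \<phi> k v else 0) +
        (\<Sum>k. if k \<in> \<sigma> then (1 / 2) ^ Suc k * \<phi> k w else 0)"
        using linear_half_pow_series[of \<phi> "v + w" 1 v 1 w "norm v" "norm w"] bd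
        by (simp add: linear_add[OF lin])
    next
      fix c v
      show "(\<Sum>k. if k \<in> \<sigma> then (1 / 2) ^ Suc k * \<phi> k (c *\<^sub>R v) else 0) =
        c *\<^sub>R (\<Sum>k. if k \<in> \<sigma> then (1 / 2) ^ Suc k * \<phi> k v else 0)"
        using linear_half_pow_series[of \<phi> "c *\<^sub>R v" c v 0 v "norm v" "norm v"] bd
        by (simp add: linear_scale[OF lin])
    next
      fix v
      show "\<bar>\<Sum>k. if k \<in> \<sigma> then (1 / 2) ^ Suc k * \<phi> k v else 0\<bar> \<le> norm v"
        using bd by (rule suminf_half_pow_abs_le(2))
    qed
  qed (auto simp: T_def)
  then obtain K where K: "\<And>n. norm (u n) \<le> K" by blast
  obtain n where "K < real n" using reals_Archimedean2 by blast
  moreover have "real n < norm (u n)"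
    using y(2)[of n] by (simp add: u_def field_simps)
  ultimately show False using K[of n] by linarith
qed

text \<open>Two subseries, over the positive and over the negative terms, show absolute convergence.\<close>

lemma subseries_imp_abs_summable:
  fixes b :: "nat \<Rightarrow> real"
  assumes "\<And>\<sigma>. summable (\<lambda>k. if k \<in> \<sigma> then b k else 0)"
  shows "summable (\<lambda>k. \<bar>b k\<bar>)"
proof -
  have "summable (\<lambda>k. (if k \<in> {k. 0 \<le> b k} then b k else 0) - (if k \<in> {k. b k < 0} then b k else 0))"
    by (intro summable_diff assms)
  moreover have "(if k \<in> {k. 0 \<le> b k} then b k else 0) - (if k \<in> {k. b k < 0} then b k else 0) = \<bar>b k\<bar>" for k
    by auto
  ultimately show ?thesis by simp
qed

lemma diagonal_convergent_subseq:
  fixes u :: "nat \<Rightarrow> nat \<Rightarrow> real"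
  assumes "\<And>j k. \<bar>u j k\<bar> \<le> B k"
  obtains d where "strict_mono (d :: nat \<Rightarrow> nat)" "\<And>k. convergent (\<lambda>j. u (d j) k)"
proof -
  interpret subseqs "\<lambda>k s. convergent (\<lambda>j. u (s j) k)"
  proof
    fix k and s :: "nat \<Rightarrow> nat"
    have "bounded (range (\<lambda>j. u (s j) k))"
      using assms by (auto simp: bounded_iff)
    then obtain l r where "strict_mono r" "((\<lambda>j. u (s j) k) \<circ> r) \<longlonglongrightarrow> l"
      using bounded_imp_convergent_subsequence by blast
    then show "\<exists>r. strict_mono r \<and> convergent (\<lambda>j. u ((s \<circ> r) j) k)"
      by (auto simp: convergent_def o_def)
  qed
  \<comment> \<open>The diagonal sequence is a subsequence of the \<open>k\<close>th selection only
    from index \<open>Suc k\<close> on; the finitely many omitted terms do not affect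
    convergence.\<close>
  have "convergent (\<lambda>j. u ((diagseq \<circ> (+) (Suc k)) j) k)" for k
    by (rule diagseq_holds) (use convergent_subseq_convergent in \<open>force simp: o_def\<close>)
  then have "convergent (\<lambda>j. u (diagseq (j + Suc k)) k)" for k
    unfolding o_def by (subst add.commute) blast
  then have "convergent (\<lambda>j. u (diagseq j) k)" for k
    using convergent_ignore_initial_segment[of "\<lambda>j. u (diagseq j) k"] by blast
  then show ?thesis
    using that subseq_diagseq by blast
qed

text \<open>
  The core of the Orlicz--Pettis theorem. Norming functionals of the terms are made pointwise
  convergent on the closed span of the terms by passing to a subsequence, and a generalized limit
  extends their pointwise limit to the whole space.
\<close>

lemma weak_subseries_convergent_imp_null:
  fixes y :: "nat \<Rightarrow> 'a::real_normed_vector"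
  assumes subseries: "\<And>\<sigma>. \<exists>z. \<forall>x :: 'a \<Rightarrow>\<^sub>L real.
      (\<lambda>k. if k \<in> \<sigma> then blinfun_apply x (y k) else 0) sums blinfun_apply x z"
  shows "y \<longlonglongrightarrow> 0"
proof (rule ccontr)
  assume "\<not> ?thesis"
  then have "\<not> (\<lambda>n. norm (y n)) \<longlonglongrightarrow> 0"
    by (simp add: tendsto_norm_zero_iff)
  then obtain e q where e: "0 < e" and q: "strict_mono (q :: nat \<Rightarrow> nat)"
    and big: "\<And>n. e \<le> norm (y (q n))"
    using not_tendsto_zero_subseq[of "\<lambda>n. norm (y n)"] by (metis abs_norm_cancel)
  have sub: "\<exists>z. \<forall>x :: 'a \<Rightarrow>\<^sub>L real.
      (\<lambda>k. if k \<in> \<sigma> then blinfun_apply x (y (g k)) else 0) sums blinfun_apply x z"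
    if g: "strict_mono (g :: nat \<Rightarrow> nat)" for \<sigma> g
  proof -
    \<comment> \<open>A subseries of a subsequence is a subseries of the original sequence, indexed
      by the image of \<open>\<sigma>\<close>.\<close>
    have inj: "g k \<in> g ` \<sigma> \<longleftrightarrow> k \<in> \<sigma>" for k
      using strict_mono_eq[OF g] by auto
    obtain z where z: "\<And>x :: 'a \<Rightarrow>\<^sub>L real.
        (\<lambda>k. if k \<in> g ` \<sigma> then blinfun_apply x (y k) else 0) sums blinfun_apply x z"
      using subseries by blast
    have "(\<lambda>k. if g k \<in> g ` \<sigma> then blinfun_apply x (y (g k)) else 0) sums blinfun_apply x z"
      for x :: "'a \<Rightarrow>\<^sub>L real"
      using z[of x] sums_mono_reindex[OF g, of "\<lambda>k. if k \<in> g ` \<sigma> then blinfun_apply x (y k) else 0"]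
      by (auto simp: image_iff)
    then show ?thesis unfolding inj by blast
  qed
  define w where "w n = y (q n)" for n
  obtain X :: "nat \<Rightarrow> 'a \<Rightarrow>\<^sub>L real"
    where X: "\<And>n. norm (X n) \<le> 1" "\<And>n. blinfun_apply (X n) (w n) = norm (w n)"
  proof -
    have "\<forall>n. \<exists>x :: 'a \<Rightarrow>\<^sub>L real. norm x \<le> 1 \<and> blinfun_apply x (w n) = norm (w n)"
      using exists_norming_functional by blast
    then show ?thesis using that by metis
  qed
  have Xb: "\<bar>blinfun_apply (X n) v\<bar> \<le> norm v" for n v
    by (rule abs_blinfun_apply_le[OF X(1)])
  obtain d where d: "strict_mono (d :: nat \<Rightarrow> nat)"
    and conv: "\<And>k. convergent (\<lambda>j. blinfun_apply (X (d j)) (w k))"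
    using diagonal_convergent_subseq[of "\<lambda>j k. blinfun_apply (X j) (w k)" "\<lambda>k. norm (w k)", OF Xb]
    by blast
  obtain \<Lambda> where \<Lambda>: "generalized_limit \<Lambda>"
    using exists_generalized_limit by blast
  have bdd: "bounded (range (\<lambda>j. blinfun_apply (X (d j)) v))" for v
    using Xb by (auto simp: bounded_iff)
  have lin: "linear (\<lambda>v. \<Lambda> (\<lambda>j. blinfun_apply (X (d j)) v))"
    using generalized_limitD(1,2)[OF \<Lambda> bdd] bdd
    by (intro linearI) (auto simp: blinfun.add_right blinfun.scaleR_right)
  have le: "\<bar>\<Lambda> (\<lambda>j. blinfun_apply (X (d j)) v)\<bar> \<le> 1 * norm v" for v
    using generalized_limit_abs_le[OF \<Lambda> Xb] by simp
  obtain l where l: "norm l \<le> 1"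
    "\<And>v. blinfun_apply l v = \<Lambda> (\<lambda>j. blinfun_apply (X (d j)) v)"
    using linear_bounded_blinfun[OF lin zero_le_one le] by blast
  define D where "D j = X (d j) - l" for j
  have D_bound: "\<bar>blinfun_apply (D j) v\<bar> \<le> 2 * norm v" for j v
  proof -
    have "norm (D j) \<le> 2"
      unfolding D_def using X(1)[of "d j"] l(1) norm_triangle_ineq4[of "X (d j)" l] by linarith
    then show ?thesis
      using norm_blinfun[of "D j" v] mult_right_mono[OF _ norm_ge_zero, of "norm (D j)" 2 v] by simp
  qed
  have D_w: "(\<lambda>j. blinfun_apply (D j) (w k)) \<longlonglongrightarrow> 0" for k
  proof -
    obtain c where c: "(\<lambda>j. blinfun_apply (X (d j)) (w k)) \<longlonglongrightarrow> c"
      using conv by (auto simp: convergent_def)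
    \<comment> \<open>A generalized limit agrees with the ordinary limit of a convergent
      sequence.\<close>
    have "blinfun_apply l (w k) = c"
    proof (rule antisym; rule field_le_epsilon)
      fix e :: real assume "e > 0"
      then have "eventually (\<lambda>j. \<bar>blinfun_apply (X (d j)) (w k) - c\<bar> < e) sequentially"
        using c by (simp add: tendsto_iff dist_real_def)
      then have "eventually (\<lambda>j. blinfun_apply (X (d j)) (w k) \<le> c + e) sequentially"
        "eventually (\<lambda>j. c - e \<le> blinfun_apply (X (d j)) (w k)) sequentially"
        by (auto elim!: eventually_mono)
      from generalized_limitD(3)[OF \<Lambda> bdd this(1)] generalized_limit_ge[OF \<Lambda> bdd this(2)]
      show "blinfun_apply l (w k) \<le> c + e" "c \<le> blinfun_apply l (w k) + e"
        by (auto simp: l(2))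
    qed
    then show ?thesis
      using c by (simp add: D_def blinfun.diff_left LIM_zero_iff)
  qed
  have D_span: "(\<lambda>j. blinfun_apply (D j) v) \<longlonglongrightarrow> 0" if "v \<in> span (range w)" for v
    using that
  proof (induction rule: span_induct_alt)
    case base
    then show ?case by (simp add: blinfun.zero_right)
  next
    case (step c x z)
    then show ?case
      using tendsto_add[OF tendsto_mult_right_zero[of "\<lambda>j. blinfun_apply (D j) x" _ c]] D_w
      by (auto simp: blinfun.add_right blinfun.scaleR_right)
  qed
  have D_closure: "(\<lambda>j. blinfun_apply (D j) v) \<longlonglongrightarrow> 0" if v: "v \<in> closure (span (range w))" for v
    unfolding tendsto_iff
  proof (intro allI impI)
    fix e :: real assume e: "e > 0"
    then obtain v' where v': "v' \<in> span (range w)" "dist v' v < e / 4"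
      using v unfolding closure_approachable by (metis zero_less_divide_iff zero_less_numeral)
    have "eventually (\<lambda>j. \<bar>blinfun_apply (D j) v'\<bar> < e / 2) sequentially"
      using tendstoD[OF D_span[OF v'(1)], of "e / 2"] e by (simp add: dist_real_def)
    then show "eventually (\<lambda>j. dist (blinfun_apply (D j) v) 0 < e) sequentially"
    proof (rule eventually_mono)
      fix j assume "\<bar>blinfun_apply (D j) v'\<bar> < e / 2"
      moreover have "\<bar>blinfun_apply (D j) (v' - v)\<bar> < e / 2"
        using D_bound[of j "v' - v"] v'(2) by (simp add: dist_norm)
      ultimately show "dist (blinfun_apply (D j) v) 0 < e"
        unfolding blinfun.diff_right dist_real_def by argo
    qed
  qed
  have qd: "strict_mono (q \<circ> d)"
    using q d by (rule strict_mono_o)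
  have subw: "\<exists>z. \<forall>x :: 'a \<Rightarrow>\<^sub>L real.
      (\<lambda>k. if k \<in> \<sigma> then blinfun_apply x (w (d k)) else 0) sums blinfun_apply x z" for \<sigma>
    using sub[OF qd, of \<sigma>] unfolding w_def o_def .
  have abs: "summable (\<lambda>k. \<bar>blinfun_apply x (w (d k))\<bar>)" for x :: "'a \<Rightarrow>\<^sub>L real"
    using subw sums_summable by (intro subseries_imp_abs_summable) blast
  \<comment> \<open>The sum of row \<open>j\<close> over \<open>\<sigma>\<close> is
    \<open>D j\<close> at the weak sum \<open>z\<close> of a subseries. As \<open>z\<close> lies in
    the closed span of the terms, these values tend to zero, and the diagonal lemma applies. Since
    \<open>l (w (d j))\<close> also tends to zero, so does the norm of \<open>w (d j)\<close>, which
    \<open>X (d j)\<close> attains.\<close>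
  have "(\<lambda>j. blinfun_apply (D j) (w (d j))) \<longlonglongrightarrow> 0"
  proof (rule diagonal_tendsto_zero[OF abs])
    fix \<sigma>
    obtain z where z: "\<And>x :: 'a \<Rightarrow>\<^sub>L real.
        (\<lambda>k. if k \<in> \<sigma> then blinfun_apply x (w (d k)) else 0) sums blinfun_apply x z"
      using subw by blast
    have "z \<in> closure (span (range w))"
    proof (rule in_closure_span_by_functionals)
      fix x :: "'a \<Rightarrow>\<^sub>L real" assume "\<And>y. y \<in> range w \<Longrightarrow> blinfun_apply x y = 0"
      then have "(\<lambda>k. if k \<in> \<sigma> then blinfun_apply x (w (d k)) else 0) = (\<lambda>_. 0)"
        by auto
      then show "blinfun_apply x z = 0"
        using z[of x] sums_unique2[OF _ sums_zero] by metis
    qed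
    from D_closure[OF this]
    show "(\<lambda>j. \<Sum>k. if k \<in> \<sigma> then blinfun_apply (D j) (w (d k)) else 0) \<longlonglongrightarrow> 0"
      using sums_unique[OF z] by simp
  qed
  moreover have "(\<lambda>j. blinfun_apply l (w (d j))) \<longlonglongrightarrow> 0"
    using summable_LIMSEQ_zero[OF abs[of l]] by (rule tendsto_rabs_zero_cancel)
  ultimately have "(\<lambda>j. blinfun_apply (D j) (w (d j)) + blinfun_apply l (w (d j))) \<longlonglongrightarrow> 0 + 0"
    by (rule tendsto_add)
  then have "(\<lambda>j. norm (w (d j))) \<longlonglongrightarrow> 0"
    by (simp add: D_def blinfun.diff_left X(2))
  then have "eventually (\<lambda>j. norm (w (d j)) < e) sequentially"
    using e by (rule order_tendstoD)
  then show False
    using big by (auto simp: w_def eventually_sequentially not_less[symmetric])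
qed

section \<open>Finite signed measures\<close>

text \<open>Countable additivity for the constant empty sequence makes a constant series
  converge.\<close>

lemma vector_measure_empty:
  fixes \<mu> :: "'b set \<Rightarrow> 'a::banach"
  assumes "vector_measure M \<mu>"
  shows "\<mu> {} = 0"
proof -
  have "(\<lambda>_::nat. \<mu> {}) sums \<mu> {}"
    using assms[unfolded vector_measure_def, rule_format, of "\<lambda>_. {}"]
    by (simp add: disjoint_family_on_def)
  then have "(\<lambda>_::nat. \<mu> {}) \<longlonglongrightarrow> 0"
    using sums_summable summable_LIMSEQ_zero by blast
  then show ?thesis by (simp add: LIMSEQ_const_iff)
qed

lemma vector_measure_Un:
  fixes \<mu> :: "'b set \<Rightarrow> 'a::banach"
  assumes \<mu>: "vector_measure M \<mu>" and "A \<in> sets M" "B \<in> sets M" "A \<inter> B = {}"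
  shows "\<mu> (A \<union> B) = \<mu> A + \<mu> B"
proof -
  have "range (binaryset A B) \<subseteq> sets M" "disjoint_family (binaryset A B)"
    using assms by (auto simp: binaryset_def disjoint_family_on_def)
  then have "(\<lambda>i. \<mu> (binaryset A B i)) sums \<mu> (A \<union> B)"
    using \<mu> unfolding vector_measure_def by (metis UN_binaryset_eq)
  moreover have "(\<lambda>i. \<mu> (binaryset A B i)) sums (\<mu> A + \<mu> B)"
    by (rule binaryset_sums) (rule vector_measure_empty[OF \<mu>])
  ultimately show ?thesis by (rule sums_unique2)
qed

lemma vector_measure_Diff:
  fixes \<mu> :: "'b set \<Rightarrow> 'a::banach"
  assumes "vector_measure M \<mu>" and "A \<in> sets M" "B \<in> sets M" "B \<subseteq> A"
  shows "\<mu> (A - B) = \<mu> A - \<mu> B"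
proof -
  have "B \<union> (A - B) = A" using assms by auto
  then show ?thesis
    using vector_measure_Un[OF assms(1), of B "A - B"] assms by auto
qed

lemma vector_measure_uminus:
  fixes \<mu> :: "'b set \<Rightarrow> 'a::banach"
  assumes "vector_measure M \<mu>"
  shows "vector_measure M (\<lambda>A. - \<mu> A)"
  using assms unfolding vector_measure_def by (auto intro: sums_minus)

lemma vector_measure_scalar_measure:
  assumes "vector_measure M \<nu>"
  shows "vector_measure M (scalar_measure x \<nu>)"
  using assms bounded_linear.sums[OF blinfun.bounded_linear_right]
  unfolding vector_measure_def scalar_measure_def by blast

section \<open>Jordan and Hahn decompositions and the variation\<close>

locale signed_measure =
  fixes M :: "'b measure" and \<mu> :: "'b set \<Rightarrow> real"
  assumes vector_measure: "vector_measure M \<mu>"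
begin

abbreviation pos :: "'b measure" where
  "pos \<equiv> pos_part M \<mu>"

abbreviation neg :: "'b measure" where
  "neg \<equiv> pos_part M (\<lambda>A. - \<mu> A)"

abbreviation total :: "'b measure" where
  "total \<equiv> variation M \<mu>"

lemma empty: "\<mu> {} = 0"
  by (rule vector_measure_empty[OF vector_measure])

lemma Un: "A \<in> sets M \<Longrightarrow> B \<in> sets M \<Longrightarrow> A \<inter> B = {} \<Longrightarrow> \<mu> (A \<union> B) = \<mu> A + \<mu> B"
  by (rule vector_measure_Un[OF vector_measure])

lemma Diff: "A \<in> sets M \<Longrightarrow> B \<in> sets M \<Longrightarrow> B \<subseteq> A \<Longrightarrow> \<mu> (A - B) = \<mu> A - \<mu> B"
  by (rule vector_measure_Diff[OF vector_measure])

text \<open>The set function inside \<open>pos_part\<close>, studied before it is known to be a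
  measure.\<close>

definition upper :: "'b set \<Rightarrow> ennreal" where
  "upper A = (SUP B \<in> {B \<in> sets M. B \<subseteq> A}. ennreal (\<mu> B))"

lemma upper_ge: "B \<in> sets M \<Longrightarrow> B \<subseteq> A \<Longrightarrow> ennreal (\<mu> B) \<le> upper A"
  unfolding upper_def by (rule SUP_upper) auto

lemma upper_mono: "A \<subseteq> B \<Longrightarrow> upper A \<le> upper B"
  unfolding upper_def by (rule SUP_subset_mono) auto

lemma upper_empty: "upper {} = 0"
proof -
  have "{B \<in> sets M. B \<subseteq> {}} = {{}}" by auto
  then show ?thesis by (simp add: upper_def empty)
qed

lemma upper_superadditive:
  assumes "A \<in> sets M" "B \<in> sets M" "A \<inter> B = {}"
  shows "upper A + upper B \<le> upper (A \<union> B)"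
proof -
  have *: "ennreal (\<mu> C) + ennreal (\<mu> D) \<le> upper (A \<union> B)"
    if CD: "C \<in> sets M" "C \<subseteq> A" "D \<in> sets M" "D \<subseteq> B" for C D
  proof -
    \<comment> \<open>Sets of negative value contribute 0 after \<open>ennreal\<close>. Replacing
      them by the empty set makes both values nonnegative, so that additivity of
      \<open>\<mu>\<close> carries over.\<close>
    define C' where "C' = (if \<mu> C \<ge> 0 then C else {})"
    define D' where "D' = (if \<mu> D \<ge> 0 then D else {})"
    have *: "C' \<in> sets M" "C' \<subseteq> A" "D' \<in> sets M" "D' \<subseteq> B" "0 \<le> \<mu> C'" "0 \<le> \<mu> D'"
      using CD by (auto simp: C'_def D'_def empty)
    have "ennreal (\<mu> C) + ennreal (\<mu> D) = ennreal (\<mu> C') + ennreal (\<mu> D')"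
      by (auto simp: C'_def D'_def empty ennreal_neg)
    also have "\<dots> = ennreal (\<mu> (C' \<union> D'))"
      using * assms by (subst Un) auto
    also have "\<dots> \<le> upper (A \<union> B)"
      using * by (intro upper_ge) auto
    finally show ?thesis .
  qed
  have ne: "{C \<in> sets M. C \<subseteq> A} \<noteq> {}" for A by auto
  have "ennreal (\<mu> C) + upper B \<le> upper (A \<union> B)" if "C \<in> sets M" "C \<subseteq> A" for C
    unfolding upper_def[of B] ennreal_SUP_add_right[OF ne]
    using * that by (intro SUP_least) auto
  then show ?thesis
    unfolding upper_def[of A] ennreal_SUP_add_left[OF ne, symmetric]
    by (intro SUP_least) auto
qed

text \<open>Finite superadditivity and monotonicity bound the sum of the values. Conversely, a
  competitor \<open>B\<close> for the union is cut into the pieces \<open>B \<inter> A i\<close>,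
  which compete for the single sets.\<close>

lemma countably_additive_upper: "countably_additive (sets M) upper"
proof (rule countably_additiveI)
  fix A :: "nat \<Rightarrow> 'b set"
  assume A: "range A \<subseteq> sets M" "disjoint_family A" "(\<Union>i. A i) \<in> sets M"
  show "(\<Sum>i. upper (A i)) = upper (\<Union>i. A i)"
  proof (rule antisym)
    have "(\<Sum>i<n. upper (A i)) \<le> upper (\<Union>i<n. A i)" for n
    proof (induction n)
      case (Suc n)
      have "(\<Sum>i<Suc n. upper (A i)) \<le> upper (\<Union>i<n. A i) + upper (A n)"
        using Suc by (simp add: add_right_mono)
      also have "\<dots> \<le> upper ((\<Union>i<n. A i) \<union> A n)"
      proof (rule upper_superadditive)
        have "A i \<inter> A n = {}" if "i < n" for i
          using A(2) that by (auto simp: disjoint_family_on_def)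
        then show "(\<Union>i<n. A i) \<inter> A n = {}" by auto
        have "A i \<in> sets M" for i
          using A(1) by auto
        then show "(\<Union>i<n. A i) \<in> sets M" "A n \<in> sets M" by auto
      qed
      also have "(\<Union>i<n. A i) \<union> A n = (\<Union>i<Suc n. A i)"
        by (auto simp: less_Suc_eq)
      finally show ?case .
    qed simp
    then have "(\<Sum>i<n. upper (A i)) \<le> upper (\<Union>i. A i)" for n
      using upper_mono[of "\<Union>i<n. A i" "\<Union>i. A i"] by (meson UN_mono order_trans subset_UNIV subset_refl)
    then show "(\<Sum>i. upper (A i)) \<le> upper (\<Union>i. A i)"
      by (intro suminf_le_const) auto
  next
    show "upper (\<Union>i. A i) \<le> (\<Sum>i. upper (A i))"
      unfolding upper_def[of "\<Union>i. A i"]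
    proof (rule SUP_least)
      fix B assume B: "B \<in> {B \<in> sets M. B \<subseteq> (\<Union>i. A i)}"
      have "range (\<lambda>i. B \<inter> A i) \<subseteq> sets M" "disjoint_family (\<lambda>i. B \<inter> A i)"
        using A(1) B disjoint_family_on_bisimulation[OF A(2), of "\<lambda>i. B \<inter> A i"] by auto
      then have "(\<lambda>i. \<mu> (B \<inter> A i)) sums \<mu> (\<Union>i. B \<inter> A i)"
        using vector_measure unfolding vector_measure_def by blast
      moreover have "(\<Union>i. B \<inter> A i) = B" using B by auto
      ultimately have "(\<lambda>n. \<Sum>i<n. \<mu> (B \<inter> A i)) \<longlonglongrightarrow> \<mu> B"
        by (simp add: sums_def)
      then have "(\<lambda>n. ennreal (\<Sum>i<n. \<mu> (B \<inter> A i))) \<longlonglongrightarrow> ennreal (\<mu> B)"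
        by (rule tendsto_ennrealI)
      moreover have "ennreal (\<Sum>i<n. \<mu> (B \<inter> A i)) \<le> (\<Sum>i. upper (A i))" for n
      proof -
        \<comment> \<open>The terms are truncated at 0 first, because \<open>ennreal\<close>
          commutes with sums of nonnegative terms only.\<close>
        have "ennreal (\<Sum>i<n. \<mu> (B \<inter> A i)) \<le> ennreal (\<Sum>i<n. max 0 (\<mu> (B \<inter> A i)))"
          by (intro ennreal_leI sum_mono) auto
        also have "\<dots> = (\<Sum>i<n. ennreal (max 0 (\<mu> (B \<inter> A i))))"
          by (simp add: sum_ennreal)
        also have "\<dots> \<le> (\<Sum>i<n. upper (A i))"
        proof (rule sum_mono)
          fix i
          have "ennreal (\<mu> (B \<inter> A i)) \<le> upper (A i)"
            using A B by (intro upper_ge) auto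
          then show "ennreal (max 0 (\<mu> (B \<inter> A i))) \<le> upper (A i)"
            by (simp add: max_def ennreal_neg)
        qed
        also have "\<dots> \<le> (\<Sum>i. upper (A i))"
          by (rule sum_le_suminf) auto
        finally show ?thesis .
      qed
      ultimately show "ennreal (\<mu> B) \<le> (\<Sum>i. upper (A i))"
        by (intro LIMSEQ_le_const2) auto
    qed
  qed
qed

lemma sets_pos_part [simp]: "sets pos = sets M"
  and space_pos_part [simp]: "space pos = space M"
  by (simp_all add: pos_part_def)

lemma emeasure_pos_part:
  assumes "A \<in> sets M"
  shows "emeasure pos A = upper A"
  unfolding pos_part_def upper_def[symmetric]
  by (rule emeasure_measure_of_sigma)
     (auto simp: assms sets.sigma_algebra_axioms countably_additive_upper positive_def upper_empty)

text \<open>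
  If \<open>\<mu>\<close> were unbounded, one could repeatedly split off a set of absolute value at least 1 from a
  set on which \<open>\<mu>\<close> is still unbounded.
\<close>

lemma upper_finite: "upper (space M) < \<infinity>"
proof (rule ccontr)
  assume "\<not> ?thesis"
  then have inf: "upper (space M) = \<infinity>" by (simp add: less_top[symmetric])
  let ?bad = "\<lambda>A. A \<in> sets M \<and> upper A = \<infinity>"
  have step: "\<exists>A'. ?bad A' \<and> A' \<subseteq> A \<and> 1 \<le> \<bar>\<mu> (A - A')\<bar>" if A: "?bad A" for A
  proof -
    \<comment> \<open>With \<open>\<mu> B\<close> above this bound, both \<open>\<mu> B\<close> and
      \<open>\<mu> (A - B)\<close> have absolute value at least 1. So it does not matter which of
      \<open>B\<close> and \<open>A - B\<close> is kept because \<open>upper\<close> is infinite on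
      it.\<close>
    have "ennreal (1 + \<bar>\<mu> A\<bar>) < upper A" using A by simp
    then obtain B where B: "B \<in> sets M" "B \<subseteq> A" "ennreal (1 + \<bar>\<mu> A\<bar>) < ennreal (\<mu> B)"
      unfolding upper_def less_SUP_iff by auto
    then have big: "1 + \<bar>\<mu> A\<bar> < \<mu> B"
      by (subst (asm) ennreal_less_iff) auto
    have dif: "\<mu> (A - B) = \<mu> A - \<mu> B" "\<mu> (A - (A - B)) = \<mu> B"
      using A B Diff[of A B] Diff[of A "A - B"] by auto
    have "A - B \<in> sets M" using A B by auto
    then have "upper B + upper (A - B) = \<infinity>"
      using A B plus_emeasure[of B "pos" "A - B"]
      by (auto simp: emeasure_pos_part Un_absorb1)
    then have "upper B = \<infinity> \<or> upper (A - B) = \<infinity>"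
      by (simp add: ennreal_add_eq_top)
    then show ?thesis
    proof
      assume "upper B = \<infinity>"
      then show ?thesis using A B big dif by (intro exI[of _ B]) auto
    next
      assume "upper (A - B) = \<infinity>"
      then show ?thesis using A B big dif by (intro exI[of _ "A - B"]) auto
    qed
  qed
  then obtain h where h: "\<And>A. ?bad A \<Longrightarrow> ?bad (h A) \<and> h A \<subseteq> A \<and> 1 \<le> \<bar>\<mu> (A - h A)\<bar>"
    by metis
  define A where "A n = (h ^^ n) (space M)" for n
  have bad: "?bad (A n)" for n
    by (induction n) (use inf h in \<open>auto simp: A_def\<close>)
  have A_Suc: "A (Suc n) \<subseteq> A n" "1 \<le> \<bar>\<mu> (A n - A (Suc n))\<bar>" for n
    using h[OF bad] by (auto simp: A_def)
  have dec: "A n \<subseteq> A m" if "m \<le> n" for m n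
    using that A_Suc(1) by (rule lift_Suc_antimono_le[rotated])
  have "disjoint_family (\<lambda>n. A n - A (Suc n))"
    unfolding disjoint_family_on_def
  proof (intro ballI impI)
    fix m n :: nat assume "m \<noteq> n"
    then have "Suc m \<le> n \<or> Suc n \<le> m" by auto
    then show "(A m - A (Suc m)) \<inter> (A n - A (Suc n)) = {}"
      using dec by blast
  qed
  moreover have "range (\<lambda>n. A n - A (Suc n)) \<subseteq> sets M"
    using bad by auto
  ultimately have "summable (\<lambda>n. \<mu> (A n - A (Suc n)))"
    using vector_measure sums_summable unfolding vector_measure_def by blast
  then have "(\<lambda>n. \<mu> (A n - A (Suc n))) \<longlonglongrightarrow> 0"
    by (rule summable_LIMSEQ_zero)
  then have "eventually (\<lambda>n. \<bar>\<mu> (A n - A (Suc n))\<bar> < 1) sequentially"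
    using order_tendstoD(2)[OF tendsto_rabs_zero] by fastforce
  then show False
    using A_Suc(2) by (auto simp: eventually_sequentially not_less[symmetric])
qed

lemma finite_measure_pos_part: "finite_measure pos"
  by (rule finite_measureI) (use upper_finite in \<open>auto simp: emeasure_pos_part\<close>)

end

context signed_measure
begin

interpretation neg: signed_measure M "\<lambda>A. - \<mu> A"
  by unfold_locales (rule vector_measure_uminus[OF vector_measure])

interpretation P: finite_measure "pos"
  by (rule finite_measure_pos_part)

interpretation N: finite_measure "neg"
  by (rule neg.finite_measure_pos_part)

text \<open>For \<open>B \<subseteq> A\<close>, \<open>\<mu> B = \<mu> A - \<mu> (A - B)\<close>,
  and the last term is controlled by the negative part. The reverse inequality is this one for
  \<open>- \<mu>\<close>; the context is closed and reopened so that the interpretation for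
  \<open>- \<mu>\<close> contains the lemma.\<close>

lemma pos_part_le:
  assumes "A \<in> sets M"
  shows "measure pos A \<le> \<mu> A + measure neg A"
proof -
  have ge: "- \<mu> B \<le> measure neg A" if "B \<in> sets M" "B \<subseteq> A" for B
    using neg.upper_ge[OF that] assms
    by (simp flip: neg.emeasure_pos_part add: N.emeasure_eq_measure)
  have "emeasure pos A \<le> ennreal (\<mu> A + measure neg A)"
    unfolding emeasure_pos_part[OF assms] upper_def
  proof (rule SUP_least)
    fix B assume "B \<in> {B \<in> sets M. B \<subseteq> A}"
    then show "ennreal (\<mu> B) \<le> ennreal (\<mu> A + measure neg A)"
      using assms ge[of "A - B"] Diff[of A B] by (intro ennreal_leI) auto
  qed
  then show ?thesis
    using ge[of A] assms by (simp add: P.emeasure_eq_measure)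
qed

end

context signed_measure
begin

interpretation neg: signed_measure M "\<lambda>A. - \<mu> A"
  by unfold_locales (rule vector_measure_uminus[OF vector_measure])

interpretation P: finite_measure "pos"
  by (rule finite_measure_pos_part)

interpretation N: finite_measure "neg"
  by (rule neg.finite_measure_pos_part)

lemma Jordan_decomposition:
  assumes "A \<in> sets M"
  shows "\<mu> A = measure pos A - measure neg A"
  using pos_part_le[OF assms] neg.pos_part_le[OF assms] by simp

text \<open>The decomposition for two measures only compares \<open>pos\<close> and
  \<open>neg\<close> on either side of \<open>Y\<close>. By the Jordan decomposition the comparison
  is a sign of \<open>\<mu>\<close> on subsets, and the supremum that defines the other part
  vanishes.\<close>

lemma Hahn_decomposition:
  obtains Y where "Y \<in> sets M" "emeasure neg Y = 0"
    "emeasure pos (space M - Y) = 0"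
proof -
  obtain Y where Y: "Y \<in> sets M"
    and pos: "\<And>X. X \<in> sets M \<Longrightarrow> X \<subseteq> Y \<Longrightarrow> neg X \<le> pos X"
    and neg: "\<And>X. X \<in> sets M \<Longrightarrow> X \<inter> Y = {} \<Longrightarrow> pos X \<le> neg X"
    using finite_unsigned_Hahn_decomposition[OF P.finite_measure_axioms N.finite_measure_axioms]
    by auto
  have "- \<mu> B \<le> 0" if "B \<in> sets M" "B \<subseteq> Y" for B
    using pos[OF that] Jordan_decomposition[OF that(1)]
    by (simp add: P.emeasure_eq_measure N.emeasure_eq_measure)
  then have "emeasure neg Y \<le> 0"
    unfolding neg.emeasure_pos_part[OF Y] neg.upper_def by (intro SUP_least) (auto simp: ennreal_neg)
  moreover have "\<mu> B \<le> 0" if "B \<in> sets M" "B \<subseteq> space M - Y" for B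
    using neg[of B] Jordan_decomposition[OF that(1)] that
    by (auto simp: P.emeasure_eq_measure N.emeasure_eq_measure)
  then have "upper (space M - Y) \<le> 0"
    unfolding upper_def by (intro SUP_least) (auto simp: ennreal_neg)
  then have "emeasure pos (space M - Y) \<le> 0"
    using Y by (simp add: emeasure_pos_part)
  ultimately show ?thesis
    using that Y by (metis le_zero_eq)
qed

lemma emeasure_pos_part_Int:
  assumes Y: "Y \<in> sets M" "emeasure neg Y = 0" "emeasure pos (space M - Y) = 0"
    and A: "A \<in> sets M"
  shows "emeasure pos A = emeasure pos (A \<inter> Y)"
    and "emeasure neg (A \<inter> Y) = 0"
proof -
  have "emeasure pos (A - Y) = 0"
    using emeasure_mono[of "A - Y" "space M - Y" "pos"] Y A sets.sets_into_space by fastforce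
  then show "emeasure pos A = emeasure pos (A \<inter> Y)"
    using A Y plus_emeasure[of "A \<inter> Y" "pos" "A - Y"] by (simp add: Int_Diff_Un Int_Diff_disjoint)
  show "emeasure neg (A \<inter> Y) = 0"
    using emeasure_mono[of "A \<inter> Y" Y "neg"] Y by simp
qed

end

context signed_measure
begin

interpretation neg: signed_measure M "\<lambda>A. - \<mu> A"
  by unfold_locales (rule vector_measure_uminus[OF vector_measure])

interpretation P: finite_measure "pos"
  by (rule finite_measure_pos_part)

interpretation N: finite_measure "neg"
  by (rule neg.finite_measure_pos_part)

lemma sets_variation [simp]: "sets total = sets M"
  and space_variation [simp]: "space total = space M"
  by (simp_all add: variation_def)

lemma partition_sums_eq:
  assumes A: "A \<in> sets M"
  shows "(SUP P \<in> {P. finite P \<and> P \<subseteq> sets M \<and> partition_on A P}. \<Sum>B\<in>P. ennreal \<bar>\<mu> B\<bar>) =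
    emeasure pos A + emeasure neg A" (is "Sup (?v ` ?S) = _")
proof (rule antisym)
  show "Sup (?v ` ?S) \<le> emeasure pos A + emeasure neg A"
  proof (rule SUP_least)
    fix Q assume Q: "Q \<in> ?S"
    have "(\<Sum>B\<in>Q. ennreal \<bar>\<mu> B\<bar>) \<le>
        (\<Sum>B\<in>Q. emeasure pos B + emeasure neg B)"
    proof (rule sum_mono)
      fix B assume "B \<in> Q"
      then have B: "B \<in> sets M" using Q by auto
      have "\<bar>\<mu> B\<bar> \<le> measure pos B + measure neg B"
        unfolding Jordan_decomposition[OF B] by (simp add: abs_le_iff)
      then show "ennreal \<bar>\<mu> B\<bar> \<le> emeasure pos B + emeasure neg B"
        by (simp add: P.emeasure_eq_measure N.emeasure_eq_measure ennreal_leI flip: ennreal_plus)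
    qed
    also have "\<dots> = emeasure pos A + emeasure neg A"
    proof -
      have "disjoint_family_on (\<lambda>B. B) Q"
        using Q by (auto simp: partition_on_def disjoint_family_on_disjoint_image disjoint_def disjoint_family_on_def)
      then have "(\<Sum>B\<in>Q. emeasure pos B) = emeasure pos (\<Union>B\<in>Q. B)"
        "(\<Sum>B\<in>Q. emeasure neg B) = emeasure neg (\<Union>B\<in>Q. B)"
        using Q sum_emeasure[of "\<lambda>B. B" Q] by auto
      moreover have "(\<Union>B\<in>Q. B) = A" using Q by (auto simp: partition_on_def)
      ultimately show ?thesis by (simp add: sum.distrib)
    qed
    finally show "?v Q \<le> emeasure pos A + emeasure neg A" .
  qed
next
  obtain Y where Y: "Y \<in> sets M" "emeasure neg Y = 0"
    "emeasure pos (space M - Y) = 0"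
    by (rule Hahn_decomposition)
  \<comment> \<open>The Hahn partition attains the supremum. Empty pieces are removed because a
    partition has none; the two pieces coincide only if both are empty, hence the case
    distinctions.\<close>
  let ?Q = "{A \<inter> Y, A - Y} - {{}}"
  have AY: "A \<inter> Y \<in> sets M" "A - Y \<in> sets M" "A \<subseteq> space M"
    using A Y sets.sets_into_space by auto
  have A_eq: "A \<inter> (space M - Y) = A - Y" "space M - (space M - Y) = Y"
    using AY Y(1) sets.sets_into_space by auto
  have 1: "emeasure pos A = ennreal \<bar>\<mu> (A \<inter> Y)\<bar>"
    using emeasure_pos_part_Int[OF Y A] Jordan_decomposition[OF AY(1)]
    by (simp add: P.emeasure_eq_measure N.emeasure_eq_measure)
  have 2: "emeasure neg A = ennreal \<bar>\<mu> (A - Y)\<bar>"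
    using neg.emeasure_pos_part_Int[of "space M - Y", OF _ _ _ A] Y Jordan_decomposition[OF AY(2)]
    by (simp add: A_eq P.emeasure_eq_measure N.emeasure_eq_measure)
  have "emeasure pos A + emeasure neg A = ?v ?Q"
  proof (cases "A \<inter> Y = A - Y")
    case True
    then have em: "A \<inter> Y = {}" "A - Y = {}" by auto
    show ?thesis unfolding 1 2 em by (simp add: empty)
  next
    case False
    show ?thesis
    proof (cases "A - Y = {}")
      case True
      show ?thesis unfolding 1 2 True using False True by (auto simp: empty insert_Diff_if)
    next
      case ne: False
      then show ?thesis unfolding 1 2
        using False by (cases "A \<inter> Y = {}") (auto simp: empty insert_Diff_if)
    qed
  qed
  also have "\<dots> \<le> Sup (?v ` ?S)"
  proof (rule SUP_upper)
    have "partition_on A ?Q"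
      by (rule partition_onI) (auto simp: disjnt_def)
    then show "?Q \<in> ?S" using AY by auto
  qed
  finally show "emeasure pos A + emeasure neg A \<le> Sup (?v ` ?S)" .
qed

lemma emeasure_variation:
  assumes "A \<in> sets M"
  shows "emeasure total A =
    emeasure pos A + emeasure neg A"
proof -
  let ?V = "\<lambda>A. SUP P \<in> {P. finite P \<and> P \<subseteq> sets M \<and> partition_on A P}. \<Sum>B\<in>P. ennreal \<bar>\<mu> B\<bar>"
  have "countably_additive (sets M) ?V"
  proof (rule countably_additiveI)
    fix A :: "nat \<Rightarrow> 'b set"
    assume A: "range A \<subseteq> sets M" "disjoint_family A" "(\<Union>i. A i) \<in> sets M"
    then have "A i \<in> sets M" for i by auto
    then have "?V (A i) = emeasure pos (A i) + emeasure neg (A i)" for i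
      by (rule partition_sums_eq)
    then show "(\<Sum>i. ?V (A i)) = ?V (\<Union>i. A i)"
      using A suminf_emeasure[of A "pos"] suminf_emeasure[of A "neg"]
      unfolding partition_sums_eq[OF A(3)] by (simp add: suminf_add[symmetric])
  qed
  moreover have "positive (sets M) ?V"
    unfolding positive_def partition_sums_eq[OF sets.empty_sets] by simp
  ultimately have "emeasure total A = ?V A"
    unfolding variation_def by (intro emeasure_measure_of_sigma sets.sigma_algebra_axioms assms)
  then show ?thesis
    using partition_sums_eq[OF assms] by simp
qed

lemma finite_measure_variation: "finite_measure total"
  by (rule finite_measureI) (simp add: emeasure_variation)

lemma variation_null_iff:
  assumes "A \<in> sets M"
  shows "emeasure total A = 0 \<longleftrightarrow> (\<forall>B\<in>sets M. B \<subseteq> A \<longrightarrow> \<mu> B = 0)"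
proof
  assume "emeasure total A = 0"
  then have "upper A = 0" "neg.upper A = 0"
    using assms by (auto simp: emeasure_variation emeasure_pos_part neg.emeasure_pos_part)
  then have "\<mu> B \<le> 0" "- \<mu> B \<le> 0" if "B \<in> sets M" "B \<subseteq> A" for B
    using upper_ge[OF that] neg.upper_ge[OF that] by (simp_all add: ennreal_eq_0_iff)
  then show "\<forall>B\<in>sets M. B \<subseteq> A \<longrightarrow> \<mu> B = 0"
    by (metis antisym neg_le_0_iff_le)
next
  assume "\<forall>B\<in>sets M. B \<subseteq> A \<longrightarrow> \<mu> B = 0"
  then have "upper A \<le> 0" "neg.upper A \<le> 0"
    unfolding upper_def neg.upper_def by (rule_tac [!] SUP_least) auto
  then show "emeasure total A = 0"
    using assms by (auto simp: emeasure_variation emeasure_pos_part neg.emeasure_pos_part)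
qed

lemma variation_uminus: "variation M (\<lambda>A. - \<mu> A) = total"
  by (simp add: variation_def)

lemma pos_part_eq_density:
  assumes Y: "Y \<in> sets M" "emeasure neg Y = 0" "emeasure pos (space M - Y) = 0"
  shows "pos = density total (\<lambda>t. ennreal (indicator Y t))"
proof (rule measure_eqI)
  fix A assume "A \<in> sets pos"
  then have A: "A \<in> sets M" by simp
  have "emeasure pos A = emeasure total (Y \<inter> A)"
    using emeasure_pos_part_Int[OF Y A] A Y(1) by (simp add: emeasure_variation Int_commute)
  then show "emeasure pos A =
      emeasure (density total (\<lambda>t. ennreal (indicator Y t))) A"
    using A Y(1) by (simp add: ennreal_indicator emeasure_restricted)
qed simp

end

context signed_measure
begin

interpretation neg: signed_measure M "\<lambda>A. - \<mu> A"
  by unfold_locales (rule vector_measure_uminus[OF vector_measure])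

text \<open>The density of \<open>\<mu>\<close> with respect to its variation. It turns a difference
  of two integrals into one integral against a single finite measure.\<close>

lemma exists_sign_density:
  obtains s :: "'b \<Rightarrow> real" where "s \<in> borel_measurable M" "\<And>t. \<bar>s t\<bar> = 1"
    "\<And>A f. A \<in> sets M \<Longrightarrow> integrable total f \<Longrightarrow>
      signed_integral M \<mu> A f = (LINT t|total. indicator A t * f t * s t)"
proof -
  obtain Y where Y [measurable]: "Y \<in> sets M" and Y0: "emeasure neg Y = 0"
    "emeasure pos (space M - Y) = 0"
    by (rule Hahn_decomposition)
  note dens_P = pos_part_eq_density[OF Y Y0]
  have "space M - (space M - Y) = Y"
    using sets.sets_into_space[OF Y] by auto
  then have dens_N: "neg = density total (\<lambda>t. ennreal (indicator (space M - Y) t))"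
    using neg.pos_part_eq_density[of "space M - Y"] Y Y0 by (simp add: variation_uminus)
  \<comment> \<open>The full complement \<open>- Y\<close>, and not \<open>space M - Y\<close>,
    makes the modulus 1 everywhere.\<close>
  define s :: "'b \<Rightarrow> real" where "s t = indicator Y t - indicator (- Y) t" for t
  have s_eq: "s t = indicator Y t - indicator (space M - Y) t" if "t \<in> space M" for t
    using that by (auto simp: s_def indicator_def)
  show ?thesis
  proof (rule that[of s])
    have "(\<lambda>t. indicator Y t - indicator (space M - Y) t :: real) \<in> borel_measurable M"
      by measurable
    then show "s \<in> borel_measurable M"
      by (rule measurable_cong[THEN iffD1, rotated]) (simp add: s_eq)
    show "\<bar>s t\<bar> = 1" for t by (auto simp: s_def indicator_def)
  next
    fix A and f :: "'b \<Rightarrow> real" assume A [measurable]: "A \<in> sets M" and f: "integrable total f"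
    have fm [measurable]: "f \<in> borel_measurable M"
      using borel_measurable_integrable[OF f] by (simp cong: measurable_cong_sets)
    have int: "integrable total (\<lambda>t. indicator B t * (indicator A t * f t))"
      if "B \<in> sets M" for B
      using integrable_mult_indicator[OF _ integrable_mult_indicator[OF _ f, of A], of B] that A by simp
    have "(LINT t:A|pos. f t) = (LINT t|total. indicator Y t * (indicator A t * f t))"
      unfolding set_lebesgue_integral_def dens_P
      by (subst integral_density) (auto cong: measurable_cong_sets)
    moreover have "(LINT t:A|neg. f t) =
        (LINT t|total. indicator (space M - Y) t * (indicator A t * f t))"
      unfolding set_lebesgue_integral_def dens_N
      by (subst integral_density) (auto cong: measurable_cong_sets)
    ultimately have "signed_integral M \<mu> A f = (LINT t|total.
        indicator Y t * (indicator A t * f t) - indicator (space M - Y) t * (indicator A t * f t))"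
      unfolding signed_integral_def using int Y by (subst Bochner_Integration.integral_diff) auto
    also have "\<dots> = (LINT t|total. indicator A t * f t * s t)"
      by (rule Bochner_Integration.integral_cong) (auto simp: s_eq algebra_simps)
    finally show "signed_integral M \<mu> A f = (LINT t|total. indicator A t * f t * s t)" .
  qed
qed

lemma signed_integral_one:
  assumes "A \<in> sets M"
  shows "signed_integral M \<mu> A (\<lambda>_. 1) = \<mu> A"
  using assms by (simp add: signed_integral_def set_lebesgue_integral_def Jordan_decomposition)

end

section \<open>The space of integrable functions\<close>

locale vmeasure =
  fixes M :: "'b measure" and \<nu> :: "'b set \<Rightarrow> 'a::banach"
  assumes vector_measure: "vector_measure M \<nu>"
begin

abbreviation V :: "('a \<Rightarrow>\<^sub>L real) \<Rightarrow> 'b measure" where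
  "V x \<equiv> variation M (scalar_measure x \<nu>)"

definition L1 :: "('b \<Rightarrow> real) set" where
  "L1 = {f. vm_integrable M \<nu> f}"

abbreviation N :: "('b \<Rightarrow> real) \<Rightarrow> real" where
  "N \<equiv> L1_norm M \<nu>"

abbreviation null :: "'b set \<Rightarrow> bool" where
  "null \<equiv> vm_null M \<nu>"

abbreviation vint :: "('b \<Rightarrow> real) \<Rightarrow> 'a" where
  "vint f \<equiv> vm_integral M \<nu> f (space M)"

lemma signed: "signed_measure M (scalar_measure x \<nu>)"
  by unfold_locales (rule vector_measure_scalar_measure[OF vector_measure])

lemma sets_V [simp, measurable_cong]: "sets (V x) = sets M"
  by (rule signed_measure.sets_variation[OF signed])

lemma space_V [simp]: "space (V x) = space M"
  by (rule signed_measure.space_variation[OF signed])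

lemma finite_V: "finite_measure (V x)"
  by (rule signed_measure.finite_measure_variation[OF signed])

text \<open>A fixed choice of the density of \<open>scalar_measure x \<nu>\<close> with respect to
  its variation, with values 1 and -1. Since it is its own inverse, a multiplier containing it
  cancels the sign of the measure.\<close>

definition sgd :: "('a \<Rightarrow>\<^sub>L real) \<Rightarrow> 'b \<Rightarrow> real" where
  "sgd x = (SOME s. s \<in> borel_measurable M \<and> (\<forall>t. \<bar>s t\<bar> = 1) \<and>
     (\<forall>A f. A \<in> sets M \<longrightarrow> integrable (V x) f \<longrightarrow>
        signed_integral M (scalar_measure x \<nu>) A f = (LINT t|V x. indicator A t * f t * s t)))"

lemma sgd:
  shows measurable_sgd [measurable]: "sgd x \<in> borel_measurable M"
    and abs_sgd [simp]: "\<bar>sgd x t\<bar> = 1"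
    and signed_integral_eq: "A \<in> sets M \<Longrightarrow> integrable (V x) f \<Longrightarrow>
      signed_integral M (scalar_measure x \<nu>) A f = (LINT t|V x. indicator A t * f t * sgd x t)"
proof -
  obtain s where "s \<in> borel_measurable M \<and> (\<forall>t. \<bar>s t\<bar> = 1) \<and>
     (\<forall>A f. A \<in> sets M \<longrightarrow> integrable (V x) f \<longrightarrow>
        signed_integral M (scalar_measure x \<nu>) A f = (LINT t|V x. indicator A t * f t * s t))"
    using signed_measure.exists_sign_density[OF signed, of x] by metis
  from someI[of "\<lambda>s. s \<in> borel_measurable M \<and> (\<forall>t. \<bar>s t\<bar> = 1) \<and>
     (\<forall>A f. A \<in> sets M \<longrightarrow> integrable (V x) f \<longrightarrow>
        signed_integral M (scalar_measure x \<nu>) A f = (LINT t|V x. indicator A t * f t * s t))", OF this]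
  show "sgd x \<in> borel_measurable M" "\<bar>sgd x t\<bar> = 1"
    "A \<in> sets M \<Longrightarrow> integrable (V x) f \<Longrightarrow>
      signed_integral M (scalar_measure x \<nu>) A f = (LINT t|V x. indicator A t * f t * sgd x t)"
    unfolding sgd_def[symmetric] by blast+
qed

lemma sgd_mult_self [simp]: "sgd x t * sgd x t = 1"
  using abs_sgd[of x t] by (metis abs_mult_self_eq mult_1)

lemma abs_mult_le:
  fixes a b :: real
  assumes "\<bar>b\<bar> \<le> C"
  shows "\<bar>a * b\<bar> \<le> C * \<bar>a\<bar>"
  using mult_right_mono[OF assms, of "\<bar>a\<bar>"] by (simp add: abs_mult mult.commute)

lemma integrable_mult_bounded:
  fixes f h :: "'b \<Rightarrow> real"
  assumes "integrable (V x) f" "h \<in> borel_measurable M" "\<And>t. \<bar>h t\<bar> \<le> C"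
  shows "integrable (V x) (\<lambda>t. f t * h t)"
proof (rule Bochner_Integration.integrable_bound)
  show "integrable (V x) (\<lambda>t. C * f t)" using assms(1) by simp
  show "(\<lambda>t. f t * h t) \<in> borel_measurable (V x)"
    using assms(2) borel_measurable_integrable[OF assms(1)] by measurable
  show "AE t in V x. norm (f t * h t) \<le> norm (C * f t)"
  proof (rule AE_I2)
    fix t
    have "\<bar>f t * h t\<bar> \<le> \<bar>C\<bar> * \<bar>f t\<bar>"
      by (rule abs_mult_le) (use assms(3)[of t] in linarith)
    then show "norm (f t * h t) \<le> norm (C * f t)" by (simp add: abs_mult)
  qed
qed

lemma abs_integral_le:
  fixes f h :: "'b \<Rightarrow> real"
  assumes "integrable (V x) f" "h \<in> borel_measurable M" "\<And>t. \<bar>h t\<bar> \<le> C"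
  shows "\<bar>LINT t|V x. f t * h t\<bar> \<le> C * (LINT t|V x. \<bar>f t\<bar>)"
proof -
  have "\<bar>LINT t|V x. f t * h t\<bar> \<le> (LINT t|V x. \<bar>f t * h t\<bar>)"
    by (rule integral_abs_bound)
  also have "\<dots> \<le> (LINT t|V x. C * \<bar>f t\<bar>)"
    using assms by (intro integral_mono integrable_abs integrable_mult_bounded[OF assms]
      integrable_mult_right abs_mult_le)
  finally show ?thesis by simp
qed

lemma has_vm_integral_iff:
  assumes "\<And>x. integrable (V x) f" "A \<in> sets M"
  shows "has_vm_integral M \<nu> f A y \<longleftrightarrow>
    (\<forall>x. blinfun_apply x y = (LINT t|V x. f t * (indicator A t * sgd x t)))"
  unfolding has_vm_integral_def using signed_integral_eq[OF assms(2) assms(1)]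
  by (simp add: mult.assoc mult.left_commute)

lemma L1_iff:
  "f \<in> L1 \<longleftrightarrow> f \<in> borel_measurable M \<and> (\<forall>x. integrable (V x) f) \<and>
    (\<forall>A\<in>sets M. \<exists>y. \<forall>x. blinfun_apply x y = (LINT t|V x. f t * (indicator A t * sgd x t)))"
proof -
  have "(\<forall>A\<in>sets M. Ex (has_vm_integral M \<nu> f A)) \<longleftrightarrow>
      (\<forall>A\<in>sets M. \<exists>y. \<forall>x. blinfun_apply x y = (LINT t|V x. f t * (indicator A t * sgd x t)))"
    if "\<forall>x. integrable (V x) f"
  proof (intro ball_cong refl iff_exI)
    fix A y assume "A \<in> sets M"
    with that show "has_vm_integral M \<nu> f A y \<longleftrightarrow>
        (\<forall>x. blinfun_apply x y = (LINT t|V x. f t * (indicator A t * sgd x t)))"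
      by (intro has_vm_integral_iff) auto
  qed
  then show ?thesis
    unfolding L1_def vm_integrable_def by blast
qed

lemma L1_measurable [measurable_dest]: "f \<in> L1 \<Longrightarrow> f \<in> borel_measurable M"
  and L1_integrable: "f \<in> L1 \<Longrightarrow> integrable (V x) f"
  by (simp_all add: L1_iff)

lemma L1_integral_exists:
  assumes "f \<in> L1" "A \<in> sets M"
  obtains y where "\<And>x. blinfun_apply x y = (LINT t|V x. f t * (indicator A t * sgd x t))"
  using assms unfolding L1_iff by blast

lemma vm_integral_eq:
  assumes "f \<in> L1"
  shows "blinfun_apply x (vint f) = (LINT t|V x. f t * sgd x t)"
proof -
  have iff: "has_vm_integral M \<nu> f (space M) y \<longleftrightarrow>
      (\<forall>x. blinfun_apply x y = (LINT t|V x. f t * sgd x t))" for y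
  proof -
    have "(LINT t|V x. f t * (indicator (space M) t * sgd x t)) = (LINT t|V x. f t * sgd x t)" for x
      by (rule Bochner_Integration.integral_cong) auto
    then show ?thesis
      using assms by (simp add: has_vm_integral_iff L1_iff)
  qed
  have "\<exists>!y. has_vm_integral M \<nu> f (space M) y"
  proof (rule ex_ex1I)
    show "\<exists>y. has_vm_integral M \<nu> f (space M) y"
      using assms by (auto simp: L1_def vm_integrable_def)
    show "y = z" if "has_vm_integral M \<nu> f (space M) y" "has_vm_integral M \<nu> f (space M) z" for y z
    proof (rule blinfun_separate)
      fix x :: "'a \<Rightarrow>\<^sub>L real"
      show "blinfun_apply x y = blinfun_apply x z"
        using that[unfolded iff] by presburger
    qed
  qed
  from theI'[OF this] have "has_vm_integral M \<nu> f (space M) (vint f)"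
    unfolding vm_integral_def .
  then show ?thesis
    unfolding iff by (rule spec)
qed

text \<open>The integrals of \<open>f\<close> over measurable sets form a weakly bounded set, hence
  a bounded one. The integral of \<open>\<bar>f\<bar>\<close> is the difference of two of their
  values under \<open>x\<close>, over the set where \<open>f t * sgd x t\<close> is nonnegative and
  over its complement; this gives \<open>2 * K\<close>.\<close>

lemma L1_bounded:
  assumes f: "f \<in> L1"
  shows "bdd_above ((\<lambda>x. LINT t|V x. \<bar>f t\<bar>) ` cball 0 1)"
proof -
  note fm [measurable] = L1_measurable[OF f] and fi = L1_integrable[OF f]
  define Y where "Y = {y. \<exists>A\<in>sets M. \<forall>x. blinfun_apply x y = (LINT t|V x. f t * (indicator A t * sgd x t))}"
  have "\<exists>K. \<forall>y\<in>Y. norm y \<le> K"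
  proof (rule uniform_boundedness_dual)
    fix x :: "'a \<Rightarrow>\<^sub>L real"
    have "\<bar>LINT t|V x. f t * (indicator A t * sgd x t)\<bar> \<le> 1 * (LINT t|V x. \<bar>f t\<bar>)"
      if [measurable]: "A \<in> sets M" for A
      by (rule abs_integral_le[OF fi]) (auto simp: abs_mult indicator_def)
    then show "\<exists>K. \<forall>y\<in>Y. \<bar>blinfun_apply x y\<bar> \<le> K"
      by (intro exI[of _ "LINT t|V x. \<bar>f t\<bar>"]) (auto simp: Y_def)
  qed
  then obtain K where K: "\<And>y. y \<in> Y \<Longrightarrow> norm y \<le> K" by blast
  have "(LINT t|V x. \<bar>f t\<bar>) \<le> 2 * K" if x: "norm x \<le> 1" for x :: "'a \<Rightarrow>\<^sub>L real"
  proof -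
    define A where "A = {t \<in> space M. 0 \<le> f t * sgd x t}"
    have A [measurable]: "A \<in> sets M" unfolding A_def by measurable
    obtain y z where y: "y \<in> Y" "blinfun_apply x y = (LINT t|V x. f t * (indicator A t * sgd x t))"
      and z: "z \<in> Y" "blinfun_apply x z = (LINT t|V x. f t * (indicator (space M - A) t * sgd x t))"
      using f A sets.compl_sets[OF A] unfolding L1_iff Y_def by blast
    have le: "\<bar>blinfun_apply x w\<bar> \<le> K" if "w \<in> Y" for w
      using abs_blinfun_apply_le[OF x, of w] K[OF that] by linarith
    have "(LINT t|V x. \<bar>f t\<bar>) = (LINT t|V x. f t * (indicator A t * sgd x t) -
        f t * (indicator (space M - A) t * sgd x t))"
    proof (rule Bochner_Integration.integral_cong)
      fix t assume "t \<in> space (V x)"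
      moreover have "\<bar>f t\<bar> = \<bar>f t * sgd x t\<bar>" by (simp add: abs_mult)
      ultimately show "\<bar>f t\<bar> = f t * (indicator A t * sgd x t) -
          f t * (indicator (space M - A) t * sgd x t)"
        by (auto simp: A_def indicator_def)
    qed simp
    also have "\<dots> = blinfun_apply x y - blinfun_apply x z"
      unfolding y z
      by (intro Bochner_Integration.integral_diff integrable_mult_bounded[OF fi, of _ 1])
         (auto simp: abs_mult indicator_def)
    also have "\<dots> \<le> 2 * K"
      using le[OF y(1)] le[OF z(1)] by linarith
    finally show ?thesis .
  qed
  then show ?thesis by (intro bdd_aboveI2[of _ _ "2 * K"]) auto
qed

lemma integral_abs_le_N:
  assumes "f \<in> L1" "norm x \<le> 1"
  shows "(LINT t|V x. \<bar>f t\<bar>) \<le> N f"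
  unfolding L1_norm_def using assms by (intro cSUP_upper L1_bounded) auto

lemma N_le:
  assumes "\<And>x :: 'a \<Rightarrow>\<^sub>L real. norm x \<le> 1 \<Longrightarrow> (LINT t|V x. \<bar>f t\<bar>) \<le> K"
  shows "N f \<le> K"
  unfolding L1_norm_def using assms by (intro cSUP_least) auto

lemma N_nonneg:
  assumes "f \<in> L1"
  shows "0 \<le> N f"
proof -
  have "0 \<le> (LINT t|V 0. \<bar>f t\<bar>)" by (rule Bochner_Integration.integral_nonneg) simp
  also have "\<dots> \<le> N f" by (rule integral_abs_le_N[OF assms]) simp
  finally show ?thesis .
qed

lemma N_gt:
  assumes "K < N f"
  obtains x :: "'a \<Rightarrow>\<^sub>L real" where "norm x \<le> 1" "K < (LINT t|V x. \<bar>f t\<bar>)"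
  using N_le[of f K] assms by (meson not_less)

lemma N_mono:
  assumes "f \<in> L1" "g \<in> L1" "\<And>t. t \<in> space M \<Longrightarrow> \<bar>f t\<bar> \<le> c * \<bar>g t\<bar>" "0 \<le> c"
  shows "N f \<le> c * N g"
proof (rule N_le)
  fix x :: "'a \<Rightarrow>\<^sub>L real" assume x: "norm x \<le> 1"
  have "(LINT t|V x. \<bar>f t\<bar>) \<le> (LINT t|V x. c * \<bar>g t\<bar>)"
    using assms L1_integrable by (intro integral_mono) auto
  also have "\<dots> \<le> c * N g"
    using integral_abs_le_N[OF assms(2) x] assms(4) by (simp add: mult_left_mono)
  finally show "(LINT t|V x. \<bar>f t\<bar>) \<le> c * N g" .
qed

lemma N_triangle:
  assumes "f \<in> L1" "g \<in> L1" "\<And>t. t \<in> space M \<Longrightarrow> \<bar>h t\<bar> \<le> \<bar>f t\<bar> + \<bar>g t\<bar>" "h \<in> L1"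
  shows "N h \<le> N f + N g"
proof (rule N_le)
  fix x :: "'a \<Rightarrow>\<^sub>L real" assume x: "norm x \<le> 1"
  have "(LINT t|V x. \<bar>h t\<bar>) \<le> (LINT t|V x. \<bar>f t\<bar> + \<bar>g t\<bar>)"
    using assms L1_integrable by (intro integral_mono) auto
  also have "\<dots> = (LINT t|V x. \<bar>f t\<bar>) + (LINT t|V x. \<bar>g t\<bar>)"
    using assms L1_integrable by (intro Bochner_Integration.integral_add) auto
  also have "\<dots> \<le> N f + N g"
    using integral_abs_le_N x assms by (intro add_mono) auto
  finally show "(LINT t|V x. \<bar>h t\<bar>) \<le> N f + N g" .
qed

lemma norm_vm_integral_le:
  assumes "f \<in> L1"
  shows "norm (vint f) \<le> N f"
proof (rule norm_le_by_functionals)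
  fix x :: "'a \<Rightarrow>\<^sub>L real" assume x: "norm x \<le> 1"
  have "(LINT t|V x. f t * sgd x t) \<le> 1 * (LINT t|V x. \<bar>f t\<bar>)"
    using abs_integral_le[OF L1_integrable[OF assms], of "sgd x" 1] by (simp add: abs_le_iff)
  then show "blinfun_apply x (vint f) \<le> N f"
    unfolding vm_integral_eq[OF assms] using integral_abs_le_N[OF assms x] by linarith
qed

section \<open>Closure properties of the space of integrable functions\<close>

lemma L1_add:
  assumes f: "f \<in> L1" and g: "g \<in> L1"
  shows "(\<lambda>t. f t + g t) \<in> L1"
  unfolding L1_iff
proof (intro conjI allI ballI)
  show "(\<lambda>t. f t + g t) \<in> borel_measurable M"
    by (intro borel_measurable_add L1_measurable f g)
  show "integrable (V x) (\<lambda>t. f t + g t)" for x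
    by (intro Bochner_Integration.integrable_add L1_integrable f g)
next
  fix A assume A [measurable]: "A \<in> sets M"
  obtain y where y: "\<And>x. blinfun_apply x y = (LINT t|V x. f t * (indicator A t * sgd x t))"
    using L1_integral_exists[OF f A] by blast
  obtain z where z: "\<And>x. blinfun_apply x z = (LINT t|V x. g t * (indicator A t * sgd x t))"
    using L1_integral_exists[OF g A] by blast
  have "blinfun_apply x (y + z) = (LINT t|V x. (f t + g t) * (indicator A t * sgd x t))" for x
    unfolding blinfun.add_right y z distrib_right
    by (intro Bochner_Integration.integral_add[symmetric]
          integrable_mult_bounded[OF L1_integrable[OF f], of _ 1]
          integrable_mult_bounded[OF L1_integrable[OF g], of _ 1])
       (auto simp: abs_mult indicator_def)
  then show "\<exists>y. \<forall>x. blinfun_apply x y = (LINT t|V x. (f t + g t) * (indicator A t * sgd x t))"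
    by blast
qed

lemma L1_scale:
  assumes f: "f \<in> L1"
  shows "(\<lambda>t. c * f t) \<in> L1"
  unfolding L1_iff
proof (intro conjI allI ballI)
  show "(\<lambda>t. c * f t) \<in> borel_measurable M"
    by (intro borel_measurable_times borel_measurable_const L1_measurable f)
  show "integrable (V x) (\<lambda>t. c * f t)" for x
    by (intro integrable_mult_right L1_integrable f)
next
  fix A assume A [measurable]: "A \<in> sets M"
  obtain y where y: "\<And>x. blinfun_apply x y = (LINT t|V x. f t * (indicator A t * sgd x t))"
    using L1_integral_exists[OF f A] by blast
  have "blinfun_apply x (c *\<^sub>R y) = (LINT t|V x. c * f t * (indicator A t * sgd x t))" for x
    by (simp add: blinfun.scaleR_right y mult.assoc)
  then show "\<exists>y. \<forall>x. blinfun_apply x y = (LINT t|V x. c * f t * (indicator A t * sgd x t))"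
    by blast
qed

lemma L1_zero: "(\<lambda>_. 0) \<in> L1"
  unfolding L1_iff by (intro conjI ballI allI exI[of _ 0]) (simp_all add: blinfun.zero_right)

lemma L1_one: "(\<lambda>_. 1) \<in> L1"
  unfolding L1_iff
proof (intro conjI allI ballI)
  show int: "integrable (V x) (\<lambda>_. 1 :: real)" for x
    using finite_V finite_measure.integrable_const by blast
  fix A assume A: "A \<in> sets M"
  have "blinfun_apply x (\<nu> A) = (LINT t|V x. 1 * (indicator A t * sgd x t))" for x
    using signed_measure.signed_integral_one[OF signed A, of x] signed_integral_eq[OF A int, of x]
    by (simp add: scalar_measure_def)
  then show "\<exists>y. \<forall>x. blinfun_apply x y = (LINT t|V x. 1 * (indicator A t * sgd x t))"
    by blast
qed simp

lemma L1_sum: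
  assumes "\<And>i. i \<in> I \<Longrightarrow> f i \<in> L1"
  shows "(\<lambda>t. \<Sum>i\<in>I. f i t) \<in> L1"
  using assms by (induction I rule: infinite_finite_induct) (simp_all only: sum.infinite sum.empty
      sum.insert L1_zero insertI1 insertI2 L1_add not_False_eq_True)

lemma L1_mult_indicator:
  assumes f: "f \<in> L1" and B [measurable]: "B \<in> sets M"
  shows "(\<lambda>t. f t * indicator B t) \<in> L1"
  unfolding L1_iff
proof (intro conjI allI ballI)
  show "(\<lambda>t. f t * indicator B t) \<in> borel_measurable M"
    using f by measurable
  show "integrable (V x) (\<lambda>t. f t * indicator B t)" for x
    using L1_integrable[OF f] by (intro integrable_mult_bounded[of _ _ _ 1]) (auto simp: indicator_def)
  fix A assume A: "A \<in> sets M"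
  then have "A \<inter> B \<in> sets M" by auto
  then obtain y where "\<And>x. blinfun_apply x y = (LINT t|V x. f t * (indicator (A \<inter> B) t * sgd x t))"
    using L1_integral_exists[OF f] by blast
  then show "\<exists>y. \<forall>x. blinfun_apply x y = (LINT t|V x. f t * indicator B t * (indicator A t * sgd x t))"
    by (intro exI[of _ y]) (simp add: indicator_inter_arith ac_simps)
qed

text \<open>Bounded functions are uniform limits of the simple functions \<open>\<lfloor>n h\<rfloor> / n\<close>.\<close>

lemma L1_mult:
  fixes h :: "'b \<Rightarrow> real"
  assumes f: "f \<in> L1" and h [measurable]: "h \<in> borel_measurable M" and C: "\<And>t. \<bar>h t\<bar> \<le> C"
  shows "(\<lambda>t. f t * h t) \<in> L1"
  unfolding L1_iff
proof (intro conjI allI ballI)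
  show "(\<lambda>t. f t * h t) \<in> borel_measurable M"
    using f by measurable
  show "integrable (V x) (\<lambda>t. f t * h t)" for x
    by (rule integrable_mult_bounded[OF L1_integrable[OF f] h C])
  fix A assume A [measurable]: "A \<in> sets M"
  define d where "d n = 1 / real (Suc n)" for n
  have d_pos: "0 < d n" for n by (simp add: d_def)
  define g where "g n t = d n * of_int \<lfloor>h t / d n\<rfloor>" for n t
  have g_diff: "\<bar>g n t - h t\<bar> \<le> d n" for n t
  proof -
    have "g n t - h t = d n * (of_int \<lfloor>h t / d n\<rfloor> - h t / d n)"
      using d_pos[of n] by (simp add: g_def right_diff_distrib)
    moreover have "\<bar>of_int \<lfloor>h t / d n\<rfloor> - h t / d n\<bar> \<le> 1" by linarith
    ultimately show ?thesis
      using d_pos[of n] by (simp add: abs_mult mult_left_le)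
  qed
  have gm [measurable]: "g n \<in> borel_measurable M" for n
    unfolding g_def by measurable
  have fg: "(\<lambda>t. f t * g n t) \<in> L1" for n
  proof -
    \<comment> \<open>The bound on \<open>h\<close> leaves finitely many values of the floor, so the
      product of \<open>f\<close> and \<open>g n\<close> is a finite combination of restrictions of
      \<open>f\<close>.\<close>
    define J where "J = {- \<lceil>C / d n\<rceil> - 1..\<lceil>C / d n\<rceil>}"
    define B where "B j = {t \<in> space M. \<lfloor>h t / d n\<rfloor> = j}" for j
    have [measurable]: "B j \<in> sets M" for j unfolding B_def by measurable
    have J: "\<lfloor>h t / d n\<rfloor> \<in> J" for t
    proof -
      have "h t / d n \<le> C / d n" "- (C / d n) \<le> h t / d n"
        using C[of t] d_pos[of n] by (simp_all add: divide_simps abs_le_iff)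
      then show ?thesis unfolding J_def by simp linarith
    qed
    have *: "(\<lambda>t. \<Sum>j\<in>J. (d n * of_int j) * (f t * indicator (B j) t)) \<in> L1"
      by (intro L1_sum L1_scale L1_mult_indicator f) auto
    define u where "u t = (\<Sum>j\<in>J. (d n * of_int j) * (f t * indicator (B j) t))" for t
    have u: "u \<in> L1" using * by (simp add: u_def[abs_def])
    have eq: "u t = f t * g n t" if "t \<in> space M" for t
    proof -
      have "u t = (\<Sum>j\<in>J. if j = \<lfloor>h t / d n\<rfloor> then f t * g n t else 0)"
        unfolding u_def by (rule sum.cong) (use that in \<open>auto simp: B_def g_def\<close>)
      also have "\<dots> = f t * g n t"
        using J[of t] by (simp add: J_def)
      finally show ?thesis .
    qed
    have int_eq: "(LINT t|V x. u t * k t) = (LINT t|V x. f t * g n t * k t)" for x k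
      by (rule Bochner_Integration.integral_cong) (auto simp: eq)
    have "integrable (V x) u \<longleftrightarrow> integrable (V x) (\<lambda>t. f t * g n t)" for x
      by (rule Bochner_Integration.integrable_cong) (auto simp: eq)
    moreover have "(\<lambda>t. f t * g n t) \<in> borel_measurable M"
      using f by measurable
    ultimately show ?thesis
      using u unfolding L1_iff int_eq by blast
  qed
  have "\<exists>y. \<forall>x. blinfun_apply x y = (LINT t|V x. f t * g n t * (indicator A t * sgd x t))" for n
    using fg[of n] A unfolding L1_iff by blast
  then obtain y where y: "\<And>n x. blinfun_apply x (y n) = (LINT t|V x. f t * g n t * (indicator A t * sgd x t))"
    by metis
  have int: "integrable (V x) (\<lambda>t. f t * g n t * (indicator A t * sgd x t))" for n x
    by (intro integrable_mult_bounded[OF L1_integrable[OF fg], of _ 1]) (auto simp: abs_mult indicator_def)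
  have inth: "integrable (V x) (\<lambda>t. f t * h t * (indicator A t * sgd x t))" for x
    by (intro integrable_mult_bounded[OF integrable_mult_bounded[OF L1_integrable[OF f] h C], of _ 1])
       (auto simp: abs_mult indicator_def)
  have close: "\<bar>blinfun_apply x (y n) - (LINT t|V x. f t * h t * (indicator A t * sgd x t))\<bar>
      \<le> d n * (LINT t|V x. \<bar>f t\<bar>)" for x n
  proof -
    have "blinfun_apply x (y n) - (LINT t|V x. f t * h t * (indicator A t * sgd x t)) =
        (LINT t|V x. f t * ((g n t - h t) * (indicator A t * sgd x t)))"
      unfolding y Bochner_Integration.integral_diff[OF int inth, symmetric]
      by (simp add: algebra_simps)
    also have "\<bar>\<dots>\<bar> \<le> d n * (LINT t|V x. \<bar>f t\<bar>)"
      by (rule abs_integral_le[OF L1_integrable[OF f]])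
         (use g_diff order_trans[OF abs_ge_zero g_diff] in \<open>auto simp: abs_mult indicator_def\<close>)
    finally show ?thesis .
  qed
  have d0: "d \<longlonglongrightarrow> 0"
    unfolding d_def[abs_def] by (rule LIMSEQ_inverse_real_of_nat[unfolded inverse_eq_divide])
  \<comment> \<open>The estimate is uniform over the functionals of norm at most 1, so it is an
    estimate in norm, and completeness supplies the candidate for the integral.\<close>
  have cauchy_bound: "norm (y m - y n) \<le> (d m + d n) * N f" for m n
  proof (rule norm_le_by_functionals)
    fix x :: "'a \<Rightarrow>\<^sub>L real" assume x: "norm x \<le> 1"
    have "blinfun_apply x (y m - y n) \<le> (d m + d n) * (LINT t|V x. \<bar>f t\<bar>)"
      using close[of x m] close[of x n] unfolding blinfun.diff_right distrib_right by linarith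
    also have "\<dots> \<le> (d m + d n) * N f"
      using integral_abs_le_N[OF f x] d_pos[of m] d_pos[of n] by (intro mult_left_mono) auto
    finally show "blinfun_apply x (y m - y n) \<le> (d m + d n) * N f" .
  qed
  have "Cauchy y"
  proof (rule CauchyI)
    fix e :: real assume e: "0 < e"
    have "(\<lambda>n. d n * N f) \<longlonglongrightarrow> 0"
      using d0 by (rule tendsto_mult_left_zero)
    then have "eventually (\<lambda>n. d n * N f < e / 2) sequentially"
      using e by (intro order_tendstoD) auto
    then obtain n0 where n0: "\<And>n. n \<ge> n0 \<Longrightarrow> d n * N f < e / 2"
      by (auto simp: eventually_sequentially)
    have "norm (y m - y n) < e" if "m \<ge> n0" "n \<ge> n0" for m n
      using cauchy_bound[of m n] n0[OF that(1)] n0[OF that(2)] by (simp add: distrib_right)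
    then show "\<exists>M. \<forall>m\<ge>M. \<forall>n\<ge>M. norm (y m - y n) < e" by blast
  qed
  then obtain z where z: "y \<longlonglongrightarrow> z"
    by (auto simp: Cauchy_convergent_iff convergent_def)
  have "blinfun_apply x z = (LINT t|V x. f t * h t * (indicator A t * sgd x t))" for x
  proof (rule LIMSEQ_unique)
    show "(\<lambda>n. blinfun_apply x (y n)) \<longlonglongrightarrow> blinfun_apply x z"
      using z by (rule blinfun.tendsto[OF tendsto_const])
    show "(\<lambda>n. blinfun_apply x (y n)) \<longlonglongrightarrow> (LINT t|V x. f t * h t * (indicator A t * sgd x t))"
    proof (rule Lim_transform[OF tendsto_const Lim_null_comparison])
      show "eventually (\<lambda>n. norm (blinfun_apply x (y n) - (LINT t|V x. f t * h t * (indicator A t * sgd x t)))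
          \<le> d n * (LINT t|V x. \<bar>f t\<bar>)) sequentially"
        using close by (intro always_eventually) simp
      show "(\<lambda>n. d n * (LINT t|V x. \<bar>f t\<bar>)) \<longlonglongrightarrow> 0"
        using d0 by (rule tendsto_mult_left_zero)
    qed
  qed
  then show "\<exists>z. \<forall>x. blinfun_apply x z = (LINT t|V x. f t * h t * (indicator A t * sgd x t))"
    by blast
qed

lemma N_scale:
  assumes f: "f \<in> L1"
  shows "N (\<lambda>t. c * f t) = \<bar>c\<bar> * N f"
proof (rule antisym)
  show le: "N (\<lambda>t. c * f t) \<le> \<bar>c\<bar> * N f"
    by (intro N_mono L1_scale f) (auto simp: abs_mult)
  show "\<bar>c\<bar> * N f \<le> N (\<lambda>t. c * f t)"
  proof (cases "c = 0")
    case True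
    then show ?thesis using N_nonneg[OF L1_zero] by simp
  next
    case False
    have "N f \<le> \<bar>1 / c\<bar> * N (\<lambda>t. c * f t)"
      by (intro N_mono L1_scale f) (use False in \<open>auto simp: abs_mult\<close>)
    then show ?thesis using False by (simp add: field_simps)
  qed
qed

section \<open>Null sets and independence of representatives\<close>

text \<open>Functionals separate points. This allows almost everywhere arguments to be made for each
  measure \<open>V x\<close> separately.\<close>

lemma vm_null_iff: "null A \<longleftrightarrow> A \<in> sets M \<and> (\<forall>x. emeasure (V x) A = 0)"
proof (cases "A \<in> sets M")
  case True
  have "(\<forall>x. emeasure (V x) A = 0) \<longleftrightarrow> (\<forall>x :: 'a \<Rightarrow>\<^sub>L real. \<forall>B\<in>sets M. B \<subseteq> A \<longrightarrow> blinfun_apply x (\<nu> B) = 0)"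
    by (simp add: signed_measure.variation_null_iff[OF signed True] scalar_measure_def)
  also have "\<dots> \<longleftrightarrow> (\<forall>B\<in>sets M. B \<subseteq> A \<longrightarrow> \<nu> B = 0)"
    by (metis blinfun.zero_right blinfun_separate)
  finally show ?thesis using True by (simp add: vm_null_def)
qed (simp add: vm_null_def)

lemma vm_null_AE:
  assumes "null {t \<in> space M. \<not> P t}"
  shows "AE t in V x. P t"
  using assms unfolding vm_null_iff by (intro AE_I'[of "{t \<in> space M. \<not> P t}"]) auto

lemma vm_null_subset:
  assumes "null A" "B \<in> sets M" "B \<subseteq> A"
  shows "null B"
  using assms by (auto simp: vm_null_def)

lemma vm_null_UN:
  assumes "\<And>i :: nat. null (A i)"
  shows "null (\<Union>i. A i)"
proof -
  have "emeasure (V x) (\<Union>i. A i) = 0" for x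
    using assms unfolding vm_null_iff by (intro emeasure_UN_eq_0) auto
  then show ?thesis using assms unfolding vm_null_iff by auto
qed

lemma vm_null_empty: "null {}"
  by (simp add: vm_null_iff)

lemma vm_null_Un:
  assumes "null A" "null B"
  shows "null (A \<union> B)"
proof -
  have "null (\<Union>i. binaryset A B i)"
    using assms vm_null_empty by (intro vm_null_UN) (auto simp: binaryset_def)
  then show ?thesis by (simp add: UN_binaryset_eq)
qed

lemma L1_cong:
  assumes f: "f \<in> L1" and g: "g \<in> borel_measurable M"
    and eq: "null {t \<in> space M. f t \<noteq> g t}"
  shows "g \<in> L1" "N g = N f" "vint g = vint f"
proof -
  have AE: "AE t in V x. f t = g t" for x
    using vm_null_AE[of "\<lambda>t. f t = g t"] eq by simp
  note [measurable] = g L1_measurable[OF f]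
  have gV [measurable]: "g \<in> borel_measurable (V x)" for x by measurable
  have int: "integrable (V x) g" for x
    by (rule integrable_cong_AE_imp[OF L1_integrable[OF f] gV AE])
  have cong: "(LINT t|V x. g t * k t) = (LINT t|V x. f t * k t)"
    if [measurable]: "k \<in> borel_measurable M" for x k
  proof (rule integral_cong_AE)
    show "AE t in V x. g t * k t = f t * k t"
      using AE[of x] by eventually_elim simp
  qed measurable
  show gL: "g \<in> L1"
    unfolding L1_iff
  proof (intro conjI allI ballI)
    fix A assume A [measurable]: "A \<in> sets M"
    obtain y where y: "\<And>x. blinfun_apply x y = (LINT t|V x. f t * (indicator A t * sgd x t))"
      using L1_integral_exists[OF f A] by blast
    have "blinfun_apply x y = (LINT t|V x. g t * (indicator A t * sgd x t))" for x
      unfolding y by (rule cong[symmetric]) measurable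
    then show "\<exists>y. \<forall>x. blinfun_apply x y = (LINT t|V x. g t * (indicator A t * sgd x t))"
      by blast
  qed (use g int in auto)
  show "N g = N f"
    unfolding L1_norm_def
  proof (rule SUP_cong[OF refl], rule integral_cong_AE)
    fix x
    show "AE t in V x. \<bar>g t\<bar> = \<bar>f t\<bar>"
      using AE[of x] by eventually_elim simp
  qed measurable
  show "vint g = vint f"
  proof (rule blinfun_separate)
    fix x :: "'a \<Rightarrow>\<^sub>L real"
    show "blinfun_apply x (vint g) = blinfun_apply x (vint f)"
      unfolding vm_integral_eq[OF f] vm_integral_eq[OF gL] by (rule cong) measurable
  qed
qed

end

section \<open>Absolute continuity of the norm and disjoint sequences\<close>

text \<open>At most one summand is nonzero at \<open>t\<close>. Signed sums of disjoint multipliers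
  are therefore multipliers bounded by 1, which is the source of the summability over disjoint
  sequences below.\<close>

lemma disjoint_support_sum_le:
  fixes h :: "nat \<Rightarrow> 'b \<Rightarrow> real"
  assumes disj: "disjoint_family G" and h: "\<And>i. \<bar>h i t\<bar> \<le> indicator (G i) t"
    and c: "\<And>i. \<bar>c i\<bar> \<le> 1" and K: "finite K"
  shows "\<bar>\<Sum>i\<in>K. c i * h i t\<bar> \<le> 1"
proof (cases "\<exists>i\<in>K. t \<in> G i")
  case True
  then obtain i where i: "i \<in> K" "t \<in> G i" by blast
  have "h j t = 0" if "j \<noteq> i" for j
  proof -
    have "t \<notin> G j" using disj i that by (auto simp: disjoint_family_on_def)
    then show ?thesis using h[of j] by simp
  qed
  then have "(\<Sum>i\<in>K. c i * h i t) = (\<Sum>j\<in>{i}. c j * h j t)"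
    using i K by (intro sum.mono_neutral_right) auto
  moreover have "\<bar>c i\<bar> * \<bar>h i t\<bar> \<le> 1 * 1"
    using h[of i] c[of i] i by (intro mult_mono) auto
  ultimately show ?thesis by (simp add: abs_mult)
next
  case False
  have "h i t = 0" if "i \<in> K" for i
    using h[of i] False that by auto
  then show ?thesis by simp
qed

lemma disjoint_support_summable:
  fixes h :: "nat \<Rightarrow> 'b \<Rightarrow> real"
  assumes disj: "disjoint_family G" and h: "\<And>i. \<bar>h i t\<bar> \<le> indicator (G i) t"
  shows "summable (\<lambda>i. if i \<in> \<sigma> then h i t else 0)"
proof (cases "\<exists>i. t \<in> G i")
  case True
  then obtain i where i: "t \<in> G i" by blast
  have "h j t = 0" if "j \<noteq> i" for j
  proof -
    have "t \<notin> G j" using disj i that by (auto simp: disjoint_family_on_def)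
    then show ?thesis using h[of j] by simp
  qed
  then show ?thesis by (intro summable_finite[of "{i}"]) auto
next
  case False
  have "h i t = 0" for i
    using h[of i] False by auto
  then show ?thesis by (intro summable_finite[of "{}"]) auto
qed

lemma decseq_disjoint_Diff:
  assumes E: "decseq E" and r: "strict_mono (r :: nat \<Rightarrow> nat)"
  shows "disjoint_family (\<lambda>i. E (r i) - E (r (Suc i)))"
  unfolding disjoint_family_on_def
proof (intro ballI impI)
  fix m n :: nat assume "m \<noteq> n"
  then have "Suc m \<le> n \<or> Suc n \<le> m" by auto
  then have "E (r n) \<subseteq> E (r (Suc m)) \<or> E (r m) \<subseteq> E (r (Suc n))"
    using E strict_mono_less_eq[OF r] by (metis decseqD)
  then show "(E (r m) - E (r (Suc m))) \<inter> (E (r n) - E (r (Suc n))) = {}"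
    by blast
qed

context vmeasure
begin

text \<open>
  Failure of the claim would produce disjoint pieces of \<open>f\<close> with integrals bounded away from zero,
  although all their subseries converge weakly.
\<close>

lemma N_decseq_tendsto_zero:
  assumes f: "f \<in> L1" and E [measurable]: "\<And>k. E k \<in> sets M" and dec: "decseq E"
    and Int: "(\<Inter>k. E k) = {}"
  shows "(\<lambda>k. N (\<lambda>t. f t * indicator (E k) t)) \<longlonglongrightarrow> 0"
proof (rule ccontr)
  assume not: "\<not> ?thesis"
  note fm [measurable] = L1_measurable[OF f] and fi = L1_integrable[OF f]
  have FL: "(\<lambda>t. f t * indicator (E k) t) \<in> L1" for k
    by (rule L1_mult_indicator[OF f E])
  obtain e q where e: "0 < e" and q: "strict_mono (q :: nat \<Rightarrow> nat)"
    and "\<And>n. e \<le> \<bar>N (\<lambda>t. f t * indicator (E (q n)) t)\<bar>"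
    using not_tendsto_zero_subseq[OF not] by blast
  then have big_q: "e \<le> N (\<lambda>t. f t * indicator (E (q n)) t)" for n
    using N_nonneg[OF FL] by (metis abs_of_nonneg)
  have big: "e \<le> N (\<lambda>t. f t * indicator (E k) t)" for k
  proof -
    have "E (q k) \<subseteq> E k"
      using dec seq_suble[OF q, of k] by (rule decseqD)
    then have "N (\<lambda>t. f t * indicator (E (q k)) t) \<le> 1 * N (\<lambda>t. f t * indicator (E k) t)"
      by (intro N_mono FL) (auto simp: indicator_def)
    then show ?thesis using big_q[of k] by simp
  qed
  have "\<exists>x :: 'a \<Rightarrow>\<^sub>L real. norm x \<le> 1 \<and> e / 2 < (LINT t|V x. \<bar>f t * indicator (E k) t\<bar>)" for k
  proof -
    have "e / 2 < N (\<lambda>t. f t * indicator (E k) t)" using big[of k] e by linarith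
    then show ?thesis by (elim N_gt) blast
  qed
  then obtain X :: "nat \<Rightarrow> 'a \<Rightarrow>\<^sub>L real" where X: "\<And>k. norm (X k) \<le> 1"
    "\<And>k. e / 2 < (LINT t|V (X k). \<bar>f t * indicator (E k) t\<bar>)"
    by metis
  \<comment> \<open>By dominated convergence, \<open>E m\<close> becomes negligible for a fixed
    functional. Of the \<open>e / 2\<close> that \<open>X (r k)\<close> sees on
    \<open>E (r k)\<close>, more than \<open>e / 4\<close> then remains on the difference with the
    next set.\<close>
  define P where "P n m \<longleftrightarrow> (LINT t|V (X n). \<bar>f t * indicator (E m) t\<bar>) < e / 4" for n m
  have "eventually (P n) sequentially" for n
  proof -
    have "(\<lambda>m. LINT t|V (X n). \<bar>f t * indicator (E m) t\<bar>) \<longlonglongrightarrow> (LINT t|V (X n). 0)"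
    proof (rule integral_dominated_convergence[where w = "\<lambda>t. \<bar>f t\<bar>"])
      show "integrable (V (X n)) (\<lambda>t. \<bar>f t\<bar>)" using fi by simp
      show "AE t in V (X n). (\<lambda>m. \<bar>f t * indicator (E m) t\<bar>) \<longlonglongrightarrow> 0"
      proof (rule AE_I2)
        fix t
        obtain m0 where m0: "t \<notin> E m0" using Int by blast
        have "\<bar>f t * indicator (E m) t\<bar> = 0" if "m \<ge> m0" for m
          using m0 decseqD[OF dec that] by (auto simp: indicator_def)
        then have "eventually (\<lambda>m. \<bar>f t * indicator (E m) t\<bar> = 0) sequentially"
          by (auto simp: eventually_sequentially)
        then show "(\<lambda>m. \<bar>f t * indicator (E m) t\<bar>) \<longlonglongrightarrow> 0"
          by (rule tendsto_eventually)
      qed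
      show "AE t in V (X n). norm \<bar>f t * indicator (E m) t\<bar> \<le> \<bar>f t\<bar>" for m
        by (rule AE_I2) (auto simp: indicator_def)
    qed measurable
    then show ?thesis
      unfolding P_def using e by (intro order_tendstoD) auto
  qed
  then obtain r where r: "strict_mono r" and P: "\<And>k. P (r k) (r (Suc k))"
    using exists_strict_mono_extension[of P] by blast
  define G where "G i = E (r i) - E (r (Suc i))" for i
  have [measurable]: "G i \<in> sets M" for i unfolding G_def by measurable
  have G_disj: "disjoint_family G"
    unfolding G_def[abs_def] by (rule decseq_disjoint_Diff[OF dec r])
  \<comment> \<open>The two signs turn the value of \<open>X (r i)\<close> at the integral of
    \<open>f * h i\<close> into the integral of \<open>\<bar>f\<bar>\<close> over \<open>G i\<close>
    against the variation.\<close>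
  define h where "h i t = indicator (G i) t * (sgn (f t) * sgd (X (r i)) t)" for i t
  have hm [measurable]: "h i \<in> borel_measurable M" for i unfolding h_def by measurable
  have h_le: "\<bar>h i t\<bar> \<le> indicator (G i) t" for i t
    by (auto simp: h_def indicator_def abs_mult abs_sgn_eq)
  have h_le1: "\<bar>h i t\<bar> \<le> 1" for i t
    by (rule order_trans[OF h_le indicator_le_1])
  have fh: "(\<lambda>t. f t * h i t) \<in> L1" for i
    by (rule L1_mult[OF f hm h_le1])
  define y where "y i = vint (\<lambda>t. f t * h i t)" for i
  have y: "blinfun_apply x (y i) = (LINT t|V x. f t * h i t * sgd x t)" for x i
    unfolding y_def by (rule vm_integral_eq[OF fh])
  have "y \<longlonglongrightarrow> 0"
  proof (rule weak_subseries_convergent_imp_null)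
    fix \<sigma> :: "nat set"
    \<comment> \<open>Any subfamily of the disjoint pieces adds up to one bounded multiplier. The
      integral of \<open>f * H\<close> is the weak sum that the Orlicz-Pettis argument asks
      for.\<close>
    define H where "H t = (\<Sum>i. if i \<in> \<sigma> then h i t else 0)" for t
    have summ: "summable (\<lambda>i. if i \<in> \<sigma> then h i t else 0)" for t
      by (rule disjoint_support_summable[OF G_disj h_le])
    have Hm [measurable]: "H \<in> borel_measurable M"
      unfolding H_def[abs_def] by measurable
    have part_le: "\<bar>\<Sum>i<n. if i \<in> \<sigma> then h i t else 0\<bar> \<le> 1" for n t
    proof -
      have "\<bar>\<Sum>i\<in>{..<n}. (if i \<in> \<sigma> then 1 else 0) * h i t\<bar> \<le> 1"
        by (rule disjoint_support_sum_le[OF G_disj h_le]) auto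
      moreover have "(if i \<in> \<sigma> then 1 else 0) * h i t = (if i \<in> \<sigma> then h i t else 0)" for i
        by simp
      ultimately show ?thesis by simp
    qed
    have part_lim: "(\<lambda>n. \<Sum>i<n. if i \<in> \<sigma> then h i t else 0) \<longlonglongrightarrow> H t" for t
      unfolding H_def by (rule summable_LIMSEQ[OF summ])
    have H_le: "\<bar>H t\<bar> \<le> 1" for t
      by (rule LIMSEQ_le_const2[OF tendsto_rabs[OF part_lim]]) (use part_le in blast)
    have fH: "(\<lambda>t. f t * H t) \<in> L1"
      by (rule L1_mult[OF f Hm H_le])
    have "(\<lambda>k. if k \<in> \<sigma> then blinfun_apply x (y k) else 0) sums
        blinfun_apply x (vint (\<lambda>t. f t * H t))" for x :: "'a \<Rightarrow>\<^sub>L real"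
      unfolding sums_def vm_integral_eq[OF fH]
    proof -
      have int: "integrable (V x) (\<lambda>t. if k \<in> \<sigma> then f t * h k t * sgd x t else 0)" for k
        using integrable_mult_bounded[OF L1_integrable[OF fh], of "sgd x" 1 x k] by (cases "k \<in> \<sigma>") auto
      have "(\<Sum>k<n. if k \<in> \<sigma> then blinfun_apply x (y k) else 0) =
          (LINT t|V x. f t * (\<Sum>k<n. if k \<in> \<sigma> then h k t else 0) * sgd x t)" for n
      proof -
        have "(\<Sum>k<n. if k \<in> \<sigma> then blinfun_apply x (y k) else 0) =
            (\<Sum>k<n. LINT t|V x. (if k \<in> \<sigma> then f t * h k t * sgd x t else 0))"
          by (intro sum.cong) (auto simp: y)
        also have "\<dots> = (LINT t|V x. (\<Sum>k<n. if k \<in> \<sigma> then f t * h k t * sgd x t else 0))"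
          by (rule Bochner_Integration.integral_sum[symmetric]) (rule int)
        also have "\<dots> = (LINT t|V x. f t * (\<Sum>k<n. if k \<in> \<sigma> then h k t else 0) * sgd x t)"
          unfolding sum_distrib_left sum_distrib_right
          by (intro Bochner_Integration.integral_cong sum.cong refl) auto
        finally show ?thesis .
      qed
      moreover have "(\<lambda>n. LINT t|V x. f t * (\<Sum>k<n. if k \<in> \<sigma> then h k t else 0) * sgd x t)
          \<longlonglongrightarrow> (LINT t|V x. f t * H t * sgd x t)"
      proof (rule integral_dominated_convergence[where w = "\<lambda>t. \<bar>f t\<bar>"])
        show "integrable (V x) (\<lambda>t. \<bar>f t\<bar>)" using fi by simp
        show "AE t in V x. (\<lambda>n. f t * (\<Sum>k<n. if k \<in> \<sigma> then h k t else 0) * sgd x t)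
            \<longlonglongrightarrow> f t * H t * sgd x t"
          by (intro AE_I2 tendsto_intros part_lim)
        show "AE t in V x. norm (f t * (\<Sum>k<n. if k \<in> \<sigma> then h k t else 0) * sgd x t) \<le> \<bar>f t\<bar>" for n
        proof (rule AE_I2)
          fix t
          show "norm (f t * (\<Sum>k<n. if k \<in> \<sigma> then h k t else 0) * sgd x t) \<le> \<bar>f t\<bar>"
            using abs_mult_le[OF part_le[where n = n and t = t], of "f t"] by (simp add: abs_mult)
        qed
      qed measurable
      ultimately show "(\<lambda>n. \<Sum>k<n. if k \<in> \<sigma> then blinfun_apply x (y k) else 0)
          \<longlonglongrightarrow> (LINT t|V x. f t * H t * sgd x t)"
        by simp
    qed
    then show "\<exists>z. \<forall>x :: 'a \<Rightarrow>\<^sub>L real.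
        (\<lambda>k. if k \<in> \<sigma> then blinfun_apply x (y k) else 0) sums blinfun_apply x z"
      by blast
  qed
  then have "(\<lambda>i. norm (y i)) \<longlonglongrightarrow> 0" by (rule tendsto_norm_zero)
  then have "eventually (\<lambda>i. norm (y i) < e / 4) sequentially"
    using e by (intro order_tendstoD) auto
  then obtain i where i: "norm (y i) < e / 4"
    using eventually_happens'[OF sequentially_bot] by blast
  let ?x = "X (r i)"
  have "blinfun_apply ?x (y i) = (LINT t|V ?x. \<bar>f t * indicator (E (r i)) t\<bar> - \<bar>f t * indicator (E (r (Suc i))) t\<bar>)"
    unfolding y
  proof (rule Bochner_Integration.integral_cong)
    fix t
    have sub: "E (r (Suc i)) \<subseteq> E (r i)"
      using strict_mono_less_eq[OF r] by (intro decseqD[OF dec]) simp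
    have "f t * h i t * sgd ?x t = \<bar>f t\<bar> * indicator (G i) t * (sgd ?x t * sgd ?x t)"
      by (simp only: h_def abs_sgn ac_simps)
    also have "\<dots> = \<bar>f t * indicator (E (r i)) t\<bar> - \<bar>f t * indicator (E (r (Suc i))) t\<bar>"
      using sub unfolding sgd_mult_self by (auto simp: G_def indicator_def)
    finally show "f t * h i t * sgd ?x t =
        \<bar>f t * indicator (E (r i)) t\<bar> - \<bar>f t * indicator (E (r (Suc i))) t\<bar>" .
  qed simp
  also have "\<dots> = (LINT t|V ?x. \<bar>f t * indicator (E (r i)) t\<bar>) - (LINT t|V ?x. \<bar>f t * indicator (E (r (Suc i))) t\<bar>)"
    by (intro Bochner_Integration.integral_diff integrable_abs L1_integrable FL)
  finally have "e / 4 < blinfun_apply ?x (y i)"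
    using X(2)[of "r i"] P[of i] unfolding P_def by linarith
  moreover have "blinfun_apply ?x (y i) \<le> norm (y i)"
    using abs_blinfun_apply_le[OF X(1)[of "r i"], of "y i"] by linarith
  ultimately show False using i by linarith
qed

text \<open>A local substitute for a control measure, with the proof of Bartle, Dunford and Schwartz.\<close>

lemma N_absolutely_continuous:
  assumes f: "f \<in> L1" and e: "0 < e"
  obtains F \<delta> where "finite F" "F \<subseteq> cball 0 1" "0 < \<delta>"
    "\<And>A. A \<in> sets M \<Longrightarrow> (\<And>x. x \<in> F \<Longrightarrow> measure (V x) A < \<delta>) \<Longrightarrow>
      N (\<lambda>t. f t * indicator A t) \<le> e"
proof (rule ccontr)
  assume "\<not> thesis"
  note no = this and witness = that
  note fm [measurable] = L1_measurable[OF f] and fi = L1_integrable[OF f]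
  \<comment> \<open>A counterexample to the claim for the finite set \<open>F\<close> and the
    threshold \<open>(1 / 2) ^ n\<close>: a set \<open>A\<close> small for all of \<open>F\<close>,
    and a functional \<open>x\<close> that still sees \<open>f\<close> on \<open>A\<close>.\<close>
  define Q where "Q F n A x \<longleftrightarrow> A \<in> sets M \<and> norm x \<le> 1 \<and>
      (\<forall>x'\<in>F. measure (V x') A < (1 / 2) ^ n) \<and> e < (LINT t|V x. \<bar>f t * indicator A t\<bar>)"
    for F :: "('a \<Rightarrow>\<^sub>L real) set" and n :: nat and A x
  have "\<exists>A x. Q F n A x" if F: "finite F" "F \<subseteq> cball 0 1" for F n
  proof (rule ccontr)
    assume none: "\<not> ?thesis"
    have *: "N (\<lambda>t. f t * indicator A t) \<le> e"
      if "A \<in> sets M" "\<And>x. x \<in> F \<Longrightarrow> measure (V x) A < (1 / 2) ^ n" for A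
      by (rule N_le) (use none that not_less in \<open>unfold Q_def, blast\<close>)
    have "thesis"
      by (rule witness[of F "(1 / 2) ^ n"]) (use F * in auto)
    then show False using no by contradiction
  qed
  then obtain a \<xi> where Q: "\<And>F n. finite F \<Longrightarrow> F \<subseteq> cball 0 1 \<Longrightarrow> Q F n (a F n) (\<xi> F n)"
    by metis
  \<comment> \<open>Each new functional joins the finite set for the next step, so
    \<open>A n\<close> is small for all earlier \<open>x i\<close>. The geometric thresholds are
    summable, as Borel-Cantelli requires.\<close>
  define FF where "FF = rec_nat {} (\<lambda>n F. insert (\<xi> F n) F)"
  define x where "x n = \<xi> (FF n) n" for n
  define A where "A n = a (FF n) n" for n
  have FF_Suc: "FF (Suc n) = insert (x n) (FF n)" and FF_0: "FF 0 = {}" for n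
    by (simp_all add: FF_def x_def)
  have FF: "finite (FF n) \<and> FF n \<subseteq> cball 0 1" for n
  proof (induction n)
    case (Suc n)
    then show ?case using Q[of "FF n" n] by (auto simp: FF_Suc x_def Q_def)
  qed (simp add: FF_0)
  have x_FF: "x i \<in> FF n" if "i < n" for i n
    using that by (induction n) (auto simp: FF_Suc less_Suc_eq)
  have A [measurable]: "A n \<in> sets M" and x1: "norm (x n) \<le> 1"
    and big: "e < (LINT t|V (x n). \<bar>f t * indicator (A n) t\<bar>)" for n
    using Q[of "FF n" n] FF[of n] by (auto simp: A_def x_def Q_def)
  have small: "measure (V (x i)) (A n) < (1 / 2) ^ n" if "i < n" for i n
    using Q[of "FF n" n] FF[of n] x_FF[OF that] by (auto simp: A_def Q_def)
  define C where "C n = (\<Union>m\<in>{n..}. A m)" for n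
  have C [measurable]: "C n \<in> sets M" for n unfolding C_def by measurable
  have C_inf: "limsup A = (\<Inter>n. C n)"
    by (simp add: limsup_INF_SUP C_def)
  have C_inf_meas [measurable]: "(\<Inter>n. C n) \<in> sets M" by measurable
  have null: "(\<Inter>n. C n) \<in> null_sets (V (x i))" for i
    unfolding C_inf[symmetric]
  proof (rule borel_cantelli_limsup1)
    show "emeasure (V (x i)) (A n) < \<infinity>" for n
      using finite_measure.emeasure_finite[OF finite_V] by (simp add: less_top)
    show "summable (\<lambda>n. measure (V (x i)) (A n))"
    proof (rule summable_comparison_test'[of "\<lambda>n. (1 / 2) ^ n" "Suc i"])
      show "norm (measure (V (x i)) (A n)) \<le> (1 / 2) ^ n" if "n \<ge> Suc i" for n
        using small[of i n] that by simp
    qed (simp add: summable_geometric)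
  qed simp
  \<comment> \<open>The upper limit of the sets is null for every \<open>V (x i)\<close>. Removing
    it gives decreasing sets with empty intersection, while \<open>E n\<close> still contains
    \<open>A n\<close> up to a null set of the very measure \<open>V (x n)\<close> for which
    \<open>A n\<close> matters.\<close>
  define E where "E n = C n - (\<Inter>n. C n)" for n
  have E [measurable]: "E n \<in> sets M" for n unfolding E_def by measurable
  have C_dec: "C n \<subseteq> C m" if "m \<le> n" for m n
    unfolding C_def using that by (intro UN_mono) auto
  have "(\<lambda>k. N (\<lambda>t. f t * indicator (E k) t)) \<longlonglongrightarrow> 0"
  proof (rule N_decseq_tendsto_zero[OF f E])
    show "decseq E" unfolding E_def decseq_def using C_dec by blast
    show "(\<Inter>k. E k) = {}" unfolding E_def by blast
  qed
  then have "eventually (\<lambda>k. N (\<lambda>t. f t * indicator (E k) t) < e) sequentially"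
    using e by (rule order_tendstoD)
  then obtain n where n: "N (\<lambda>t. f t * indicator (E n) t) < e"
    using eventually_happens'[OF sequentially_bot] by blast
  have "(LINT t|V (x n). \<bar>f t * indicator (A n) t\<bar>) \<le> (LINT t|V (x n). \<bar>f t * indicator (E n) t\<bar>)"
  proof (rule integral_mono_AE)
    show "integrable (V (x n)) (\<lambda>t. \<bar>f t * indicator (A n) t\<bar>)"
      "integrable (V (x n)) (\<lambda>t. \<bar>f t * indicator (E n) t\<bar>)"
      by (intro integrable_abs L1_integrable L1_mult_indicator f A E)+
    have An: "A n \<subseteq> C n" unfolding C_def by auto
    show "AE t in V (x n). \<bar>f t * indicator (A n) t\<bar> \<le> \<bar>f t * indicator (E n) t\<bar>"
      using AE_not_in[OF null[of n]]
    proof eventually_elim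
      case (elim t)
      then have "t \<in> A n \<Longrightarrow> t \<in> E n" using An by (auto simp: E_def)
      then show ?case by (cases "t \<in> A n") auto
    qed
  qed
  also have "\<dots> \<le> N (\<lambda>t. f t * indicator (E n) t)"
    by (intro integral_abs_le_N L1_mult_indicator f E x1)
  finally show False using big[of n] n by linarith
qed

text \<open>All later selected sets are removed from \<open>D (r k)\<close>. They were chosen so
  small for the finitely many functionals that control \<open>f (r k)\<close> that this costs at
  most \<open>e\<close>. The error is not made to vanish: a fixed fraction of a lower bound is
  enough in both uses.\<close>

lemma disjoint_subsequence:
  assumes f: "\<And>n. f n \<in> L1" and D [measurable]: "\<And>n. D n \<in> sets M"
    and lim: "\<And>x :: 'a \<Rightarrow>\<^sub>L real. norm x \<le> 1 \<Longrightarrow> (\<lambda>n. measure (V x) (D n)) \<longlonglongrightarrow> 0"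
    and e: "0 < e"
  obtains r A where "strict_mono (r :: nat \<Rightarrow> nat)" "disjoint_family A" "\<And>k. A k \<in> sets M"
    "\<And>k. A k \<subseteq> D (r k)" "\<And>k. N (\<lambda>t. f (r k) t * indicator (D (r k) - A k) t) \<le> e"
proof -
  define R where "R n F \<delta> \<longleftrightarrow> finite F \<and> F \<subseteq> cball 0 1 \<and> 0 < \<delta> \<and>
    (\<forall>A\<in>sets M. (\<forall>x\<in>F. measure (V x) A < \<delta>) \<longrightarrow> N (\<lambda>t. f n t * indicator A t) \<le> e)"
    for n and F :: "('a \<Rightarrow>\<^sub>L real) set" and \<delta>
  have "\<exists>F \<delta>. R n F \<delta>" for n
  proof (rule N_absolutely_continuous[OF f[of n] e])
    fix F :: "('a \<Rightarrow>\<^sub>L real) set" and \<delta> :: real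
    assume *: "finite F" "F \<subseteq> cball 0 1" "0 < \<delta>"
      "\<And>A. A \<in> sets M \<Longrightarrow> (\<And>x. x \<in> F \<Longrightarrow> measure (V x) A < \<delta>) \<Longrightarrow> N (\<lambda>t. f n t * indicator A t) \<le> e"
    have "R n F \<delta>"
      unfolding R_def by (intro conjI ballI impI *) auto
    then show ?thesis by blast
  qed
  then obtain F \<delta> where R: "\<And>n. R n (F n) (\<delta> n)"
    by metis
  have F: "finite (F n)" "F n \<subseteq> cball 0 1" and \<delta>: "0 < \<delta> n" for n
    using R[of n] by (auto simp: R_def)
  have small: "N (\<lambda>t. f n t * indicator A t) \<le> e"
    if "A \<in> sets M" "\<And>x. x \<in> F n \<Longrightarrow> measure (V x) A < \<delta> n" for n A
    using R[of n] that unfolding R_def by blast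
  \<comment> \<open>The quantifier over \<open>i\<close> up to \<open>n\<close> keeps every earlier
    requirement in force at later steps. The factor \<open>(1 / 2) ^ (n + 2)\<close> bounds the
    total measure of the later sets by half of the threshold.\<close>
  define P where "P n m \<longleftrightarrow> (\<forall>i\<in>{..n}. \<forall>x\<in>F i. measure (V x) (D m) < \<delta> i * (1 / 2) ^ (n + 2))" for n m
  have "eventually (P n) sequentially" for n
    unfolding P_def
  proof (intro eventually_ball_finite ballI)
    fix i x assume "x \<in> F i"
    then have "norm x \<le> 1" using F(2)[of i] by auto
    from lim[OF this] show "eventually (\<lambda>m. measure (V x) (D m) < \<delta> i * (1 / 2) ^ (n + 2)) sequentially"
      using \<delta>[of i] by (intro order_tendstoD) auto
  qed (use F in auto)
  then obtain r where r: "strict_mono r" and P: "\<And>k. P (r k) (r (Suc k))"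
    using exists_strict_mono_extension[of P] by blast
  define A where "A k = D (r k) - (\<Union>j. D (r (Suc (k + j))))" for k
  have A [measurable]: "A k \<in> sets M" for k unfolding A_def by measurable
  have disj: "disjoint_family A"
  proof -
    have "A m \<inter> A n = {}" if mn: "m < n" for m n
    proof -
      obtain j where j: "n = Suc (m + j)" using mn less_iff_Suc_add by auto
      show ?thesis unfolding A_def[of m] A_def[of n] unfolding j by blast
    qed
    note less = this
    show ?thesis
      unfolding disjoint_family_on_def
    proof (intro ballI impI)
      fix m n :: nat assume "m \<noteq> n"
      then consider "m < n" | "n < m" by linarith
      then show "A m \<inter> A n = {}" using less[of m n] less[of n m] by cases blast+
    qed
  qed
  have "N (\<lambda>t. f (r k) t * indicator (D (r k) - A k) t) \<le> e" for k
  proof (rule small)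
    fix x assume x: "x \<in> F (r k)"
    interpret finite_measure "V x" by (rule finite_V)
    have le: "measure (V x) (D (r (Suc (k + j)))) \<le> \<delta> (r k) / 4 * (1 / 2) ^ j" for j
    proof -
      have "r k \<le> r (k + j)" using strict_mono_less_eq[OF r] by simp
      then have "measure (V x) (D (r (Suc (k + j)))) < \<delta> (r k) * (1 / 2) ^ (r (k + j) + 2)"
        using P[of "k + j"] x unfolding P_def by auto
      also have "\<dots> \<le> \<delta> (r k) * (1 / 2) ^ (j + 2)"
        using seq_suble[OF r, of "k + j"] \<delta>[of "r k"] by (intro mult_left_mono power_decreasing) auto
      finally show ?thesis by (simp add: power_add power2_eq_square)
    qed
    have sums: "(\<lambda>j. \<delta> (r k) / 4 * (1 / 2) ^ j) sums (\<delta> (r k) / 4 * 2)"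
      using geometric_sums[of "1 / 2 :: real"] by (intro sums_mult) simp
    have summ: "summable (\<lambda>j. measure (V x) (D (r (Suc (k + j)))))"
      by (rule summable_comparison_test'[OF sums_summable[OF sums], of 0]) (use le in simp)
    have "measure (V x) (D (r k) - A k) \<le> measure (V x) (\<Union>j. D (r (Suc (k + j))))"
      by (rule finite_measure_mono) (auto simp: A_def)
    also have "\<dots> \<le> (\<Sum>j. measure (V x) (D (r (Suc (k + j)))))"
      by (rule finite_measure_subadditive_countably[OF _ summ]) auto
    also have "\<dots> \<le> (\<Sum>j. \<delta> (r k) / 4 * (1 / 2) ^ j)"
      by (rule suminf_le[OF le summ sums_summable[OF sums]])
    also have "\<dots> < \<delta> (r k)"
      using sums_unique[OF sums] \<delta>[of "r k"] by simp
    finally show "measure (V x) (D (r k) - A k) < \<delta> (r k)" .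
  qed measurable
  then show ?thesis
    using that[of r A] r disj A by (auto simp: A_def)
qed

end

section \<open>Weak convergence of classes and of functions\<close>

text \<open>The counterpart of \<open>bounded_functional\<close> before classes are formed, where
  the operations are pointwise and no representative has to be chosen.\<close>

definition fun_functional :: "('b \<Rightarrow> real) set \<Rightarrow> (('b \<Rightarrow> real) \<Rightarrow> real) \<Rightarrow> (('b \<Rightarrow> real) \<Rightarrow> real) \<Rightarrow> bool" where
  "fun_functional S p \<psi> \<longleftrightarrow>
     (\<forall>f\<in>S. \<forall>g\<in>S. \<psi> (\<lambda>t. f t + g t) = \<psi> f + \<psi> g) \<and>
     (\<forall>c. \<forall>f\<in>S. \<psi> (\<lambda>t. c * f t) = c * \<psi> f) \<and>
     (\<exists>K. \<forall>f\<in>S. \<bar>\<psi> f\<bar> \<le> K * p f)"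

definition fun_weakly_null :: "('b \<Rightarrow> real) set \<Rightarrow> (('b \<Rightarrow> real) \<Rightarrow> real) \<Rightarrow> (nat \<Rightarrow> 'b \<Rightarrow> real) \<Rightarrow> bool" where
  "fun_weakly_null S p f \<longleftrightarrow>
     (\<forall>n. f n \<in> S) \<and> (\<forall>\<psi>. fun_functional S p \<psi> \<longrightarrow> (\<lambda>n. \<psi> (f n)) \<longlonglongrightarrow> 0)"

lemma fun_functionalD:
  assumes "fun_functional S p \<psi>"
  shows "f \<in> S \<Longrightarrow> g \<in> S \<Longrightarrow> \<psi> (\<lambda>t. f t + g t) = \<psi> f + \<psi> g"
    and "f \<in> S \<Longrightarrow> \<psi> (\<lambda>t. c * f t) = c * \<psi> f"
  using assms unfolding fun_functional_def by blast+

lemma fun_functional_bound: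
  assumes "fun_functional S p \<psi>" "\<And>f. f \<in> S \<Longrightarrow> 0 \<le> p f"
  obtains K where "0 \<le> K" "\<And>f. f \<in> S \<Longrightarrow> \<bar>\<psi> f\<bar> \<le> K * p f"
proof -
  obtain K where K: "\<And>f. f \<in> S \<Longrightarrow> \<bar>\<psi> f\<bar> \<le> K * p f"
    using assms(1) unfolding fun_functional_def by blast
  have "\<bar>\<psi> f\<bar> \<le> \<bar>K\<bar> * p f" if "f \<in> S" for f
    using K[OF that] mult_right_mono[OF abs_ge_self assms(2)[OF that], of K] by linarith
  then show ?thesis using that[of "\<bar>K\<bar>"] by simp
qed

lemma fun_weakly_nullD:
  assumes "fun_weakly_null S p f"
  shows "f n \<in> S" "fun_functional S p \<psi> \<Longrightarrow> (\<lambda>n. \<psi> (f n)) \<longlonglongrightarrow> 0"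
  using assms unfolding fun_weakly_null_def by blast+

lemma fun_weakly_null_subseq:
  assumes "fun_weakly_null S p f" "strict_mono r"
  shows "fun_weakly_null S p (\<lambda>n. f (r n))"
  using assms LIMSEQ_subseq_LIMSEQ[OF _ assms(2)]
  unfolding fun_weakly_null_def o_def by fast

text \<open>The properties shared by integrable and essentially bounded functions, so that the
  passage between functions and classes is carried out once.\<close>

locale class_seminorm = vmeasure M \<nu> for M :: "'b measure" and \<nu> :: "'b set \<Rightarrow> 'a::banach" +
  fixes S :: "('b \<Rightarrow> real) set" and p :: "('b \<Rightarrow> real) \<Rightarrow> real"
  assumes S_measurable: "f \<in> S \<Longrightarrow> f \<in> borel_measurable M"
    and S_zero: "(\<lambda>_. 0) \<in> S"
    and S_add: "f \<in> S \<Longrightarrow> g \<in> S \<Longrightarrow> (\<lambda>t. f t + g t) \<in> S"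
    and S_scale: "f \<in> S \<Longrightarrow> (\<lambda>t. c * f t) \<in> S"
    and S_cong: "f \<in> S \<Longrightarrow> g \<in> borel_measurable M \<Longrightarrow> null {t \<in> space M. f t \<noteq> g t} \<Longrightarrow> g \<in> S"
    and p_cong: "f \<in> S \<Longrightarrow> g \<in> borel_measurable M \<Longrightarrow> null {t \<in> space M. f t \<noteq> g t} \<Longrightarrow> p g = p f"
    and p_zero: "p (\<lambda>_. 0) = 0"
    and p_nonneg: "f \<in> S \<Longrightarrow> 0 \<le> p f"
begin

abbreviation E :: "('b \<Rightarrow> real) set normed_lattice" where
  "E \<equiv> class_space M \<nu> S p"

abbreviation cls :: "('b \<Rightarrow> real) \<Rightarrow> ('b \<Rightarrow> real) set" where
  "cls \<equiv> fun_class M \<nu>"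

lemma equiv_ae_equal: "equiv (borel_measurable M) (ae_equal M \<nu>)"
proof (rule equivI)
  show "ae_equal M \<nu> \<subseteq> borel_measurable M \<times> borel_measurable M"
    by (auto simp: ae_equal_def)
  show "refl_on (borel_measurable M) (ae_equal M \<nu>)"
    by (auto simp: refl_on_def ae_equal_def vm_null_empty)
  show "sym (ae_equal M \<nu>)"
    by (auto simp: sym_def ae_equal_def eq_commute)
  show "trans (ae_equal M \<nu>)"
  proof (rule transI)
    fix f g h assume fg: "(f, g) \<in> ae_equal M \<nu>" and gh: "(g, h) \<in> ae_equal M \<nu>"
    then have [measurable]: "f \<in> borel_measurable M" "g \<in> borel_measurable M" "h \<in> borel_measurable M"
      by (auto simp: ae_equal_def)
    have "null {t \<in> space M. f t \<noteq> h t}"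
      by (rule vm_null_subset[OF vm_null_Un[of "{t \<in> space M. f t \<noteq> g t}" "{t \<in> space M. g t \<noteq> h t}"]])
         (use fg gh in \<open>auto simp: ae_equal_def\<close>)
    then show "(f, h) \<in> ae_equal M \<nu>" by (simp add: ae_equal_def)
  qed
qed

lemma rep_fun_class:
  assumes "f \<in> borel_measurable M"
  shows "(f, rep (cls f)) \<in> ae_equal M \<nu>"
proof -
  have "f \<in> cls f"
    using equiv_class_self[OF equiv_ae_equal] assms by blast
  then have "rep (cls f) \<in> cls f"
    unfolding rep_def by (rule someI[of "\<lambda>g. g \<in> cls f"])
  then show ?thesis by simp
qed

lemma rep_fun_class_eq:
  assumes "f \<in> borel_measurable M"
  shows "rep (cls f) \<in> borel_measurable M"
    "null {t \<in> space M. f t \<noteq> rep (cls f) t}"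
  using rep_fun_class[OF assms] by (auto simp: ae_equal_def)

lemma rep_class:
  assumes "F \<in> S // ae_equal M \<nu>"
  shows "rep F \<in> S" "cls (rep F) = F"
proof -
  obtain f where f: "f \<in> S" "F = cls f"
    using assms by (auto simp: quotient_def)
  then have eq: "(f, rep F) \<in> ae_equal M \<nu>"
    using rep_fun_class S_measurable by blast
  then have "rep F \<in> borel_measurable M" "null {t \<in> space M. f t \<noteq> rep F t}"
    by (auto simp: ae_equal_def)
  then show "rep F \<in> S"
    by (rule S_cong[OF f(1)])
  show "cls (rep F) = F"
    unfolding f(2) using equiv_class_eq[OF equiv_ae_equal eq] unfolding f(2) by (rule sym)
qed

lemma fun_class_in_quotient: "f \<in> S \<Longrightarrow> cls f \<in> S // ae_equal M \<nu>"
  by (rule quotientI)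

lemma fun_class_eq:
  assumes "f \<in> borel_measurable M" "g \<in> borel_measurable M" "null {t \<in> space M. f t \<noteq> g t}"
  shows "cls f = cls g"
  using assms by (intro equiv_class_eq[OF equiv_ae_equal]) (simp add: ae_equal_def)

text \<open>The difference of the two functions has seminorm zero, so boundedness makes the
  functional vanish on it.\<close>

lemma fun_functional_cong:
  assumes \<psi>: "fun_functional S p \<psi>" and f: "f \<in> S" and g: "g \<in> borel_measurable M"
    and eq: "null {t \<in> space M. f t \<noteq> g t}"
  shows "\<psi> g = \<psi> f"
proof -
  note [measurable] = S_measurable[OF f] g
  have gS: "g \<in> S" by (rule S_cong[OF f g eq])
  have d: "(\<lambda>t. g t + (- 1) * f t) \<in> S"
    by (intro S_add S_scale f gS)
  have "{t \<in> space M. 0 \<noteq> g t + (- 1) * f t} = {t \<in> space M. f t \<noteq> g t}"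
    by auto
  then have "p (\<lambda>t. g t + (- 1) * f t) = p (\<lambda>_. 0)"
    using eq by (intro p_cong S_zero) (auto intro: S_measurable d)
  moreover obtain K where "\<And>h. h \<in> S \<Longrightarrow> \<bar>\<psi> h\<bar> \<le> K * p h"
    using \<psi> unfolding fun_functional_def by blast
  ultimately have "\<psi> (\<lambda>t. g t + (- 1) * f t) = 0"
    using d p_zero by fastforce
  moreover have "\<psi> (\<lambda>t. g t + (- 1) * f t) = \<psi> g + (- 1) * \<psi> f"
    using fun_functionalD(1)[OF \<psi> gS S_scale[OF f, of "- 1"]] fun_functionalD(2)[OF \<psi> f, of "- 1"]
    by simp
  ultimately show ?thesis by simp
qed

lemma fun_functional_sum:
  assumes \<psi>: "fun_functional S p \<psi>" and f: "\<And>i. i \<in> I \<Longrightarrow> f i \<in> S" and I: "finite I"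
  shows "(\<lambda>t. \<Sum>i\<in>I. c i * f i t) \<in> S"
    "\<psi> (\<lambda>t. \<Sum>i\<in>I. c i * f i t) = (\<Sum>i\<in>I. c i * \<psi> (f i))"
proof -
  have "(\<lambda>t. \<Sum>i\<in>I. c i * f i t) \<in> S \<and>
      \<psi> (\<lambda>t. \<Sum>i\<in>I. c i * f i t) = (\<Sum>i\<in>I. c i * \<psi> (f i))"
    using I f
  proof (induction I)
    case empty
    then show ?case
      using S_zero fun_functionalD(2)[OF \<psi> S_zero, of 0] by simp
  next
    case (insert i I)
    then have IH: "(\<lambda>t. \<Sum>i\<in>I. c i * f i t) \<in> S"
      "\<psi> (\<lambda>t. \<Sum>i\<in>I. c i * f i t) = (\<Sum>i\<in>I. c i * \<psi> (f i))" and fi: "f i \<in> S"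
      by auto
    show ?case
      using insert.hyps S_add[OF S_scale[OF fi, of "c i"] IH(1)] IH(2)
        fun_functionalD(1)[OF \<psi> S_scale[OF fi, of "c i"] IH(1)] fun_functionalD(2)[OF \<psi> fi, of "c i"]
      by simp
  qed
  then show "(\<lambda>t. \<Sum>i\<in>I. c i * f i t) \<in> S"
    "\<psi> (\<lambda>t. \<Sum>i\<in>I. c i * f i t) = (\<Sum>i\<in>I. c i * \<psi> (f i))" by auto
qed

text \<open>A functional on functions is composed with \<open>rep\<close>. Although
  \<open>rep\<close> need not be linear, the composition is, because the functional ignores changes
  on null sets.\<close>

lemma weakly_null_rep:
  assumes "weakly_null E F"
  shows "fun_weakly_null S p (\<lambda>n. rep (F n))"
  unfolding fun_weakly_null_def
proof (intro conjI allI impI)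
  have FE: "F n \<in> S // ae_equal M \<nu>" for n
    using assms unfolding weakly_null_def by (simp add: class_space_def)
  show "rep (F n) \<in> S" for n by (rule rep_class(1)[OF FE])
  fix \<psi> assume \<psi>: "fun_functional S p \<psi>"
  have "bounded_functional E (\<lambda>F. \<psi> (rep F))"
    unfolding bounded_functional_def
  proof (intro conjI ballI allI)
    fix F G assume "F \<in> elems E" "G \<in> elems E"
    then have F: "rep F \<in> S" and G: "rep G \<in> S"
      using rep_class by (auto simp: class_space_def)
    have "\<psi> (rep (cls (\<lambda>t. rep F t + rep G t))) = \<psi> (\<lambda>t. rep F t + rep G t)"
      by (rule fun_functional_cong[OF \<psi> S_add[OF F G]]) (rule rep_fun_class_eq[OF S_measurable[OF S_add[OF F G]]])+
    then show "\<psi> (rep (nl_add E F G)) = \<psi> (rep F) + \<psi> (rep G)"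
      by (simp add: class_space_def fun_functionalD(1)[OF \<psi> F G])
  next
    fix c F assume "F \<in> elems E"
    then have F: "rep F \<in> S"
      using rep_class by (auto simp: class_space_def)
    have "\<psi> (rep (cls (\<lambda>t. c * rep F t))) = \<psi> (\<lambda>t. c * rep F t)"
      by (rule fun_functional_cong[OF \<psi> S_scale[OF F]]) (rule rep_fun_class_eq[OF S_measurable[OF S_scale[OF F]]])+
    then show "\<psi> (rep (nl_scale E c F)) = c * \<psi> (rep F)"
      by (simp add: class_space_def fun_functionalD(2)[OF \<psi> F])
  next
    obtain K where "\<And>h. h \<in> S \<Longrightarrow> \<bar>\<psi> h\<bar> \<le> K * p h"
      using \<psi> unfolding fun_functional_def by blast
    then show "\<exists>K. \<forall>F\<in>elems E. \<bar>\<psi> (rep F)\<bar> \<le> K * nl_norm E F"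
      using rep_class(1) by (auto simp: class_space_def)
  qed
  then show "(\<lambda>n. \<psi> (rep (F n))) \<longlonglongrightarrow> 0"
    using assms unfolding weakly_null_def by blast
qed

lemma weakly_null_fun_class:
  assumes "fun_weakly_null S p f"
  shows "weakly_null E (\<lambda>n. cls (f n))"
  unfolding weakly_null_def
proof (intro conjI allI impI)
  show "cls (f n) \<in> elems E" for n
    using fun_weakly_nullD(1)[OF assms] fun_class_in_quotient by (simp add: class_space_def)
  fix \<phi> assume \<phi>: "bounded_functional E \<phi>"
  have \<phi>_add: "\<phi> (nl_add E F G) = \<phi> F + \<phi> G"
    if "F \<in> elems E" "G \<in> elems E" for F G
    using \<phi> that unfolding bounded_functional_def by blast
  have \<phi>_scale: "\<phi> (nl_scale E c F) = c * \<phi> F"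
    if "F \<in> elems E" for c F
    using \<phi> that unfolding bounded_functional_def by blast
  have inE: "cls f \<in> elems E" if "f \<in> S" for f
    using fun_class_in_quotient[OF that] by (simp add: class_space_def)
  have rep: "rep (cls f) \<in> S" "null {t \<in> space M. f t \<noteq> rep (cls f) t}"
    if "f \<in> S" for f
    using rep_class(1)[OF fun_class_in_quotient[OF that]] rep_fun_class_eq(2)[OF S_measurable[OF that]]
    by auto
  have "fun_functional S p (\<lambda>f. \<phi> (cls f))"
    unfolding fun_functional_def
  proof (intro conjI ballI allI)
    fix f g assume f: "f \<in> S" and g: "g \<in> S"
    note [measurable] = S_measurable[OF f] S_measurable[OF g] S_measurable[OF rep(1)[OF f]] S_measurable[OF rep(1)[OF g]]
    have "cls (\<lambda>t. f t + g t) =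
        cls (\<lambda>t. rep (cls f) t + rep (cls g) t)"
      by (intro fun_class_eq vm_null_subset[OF vm_null_Un[OF rep(2)[OF f] rep(2)[OF g]]]) auto
    then have eq: "cls (\<lambda>t. f t + g t) =
        nl_add E (cls f) (cls g)"
      by (simp add: class_space_def)
    show "\<phi> (cls (\<lambda>t. f t + g t)) = \<phi> (cls f) + \<phi> (cls g)"
      unfolding eq by (rule \<phi>_add[OF inE[OF f] inE[OF g]])
  next
    fix c f assume f: "f \<in> S"
    note [measurable] = S_measurable[OF f] S_measurable[OF rep(1)[OF f]]
    have "cls (\<lambda>t. c * f t) = cls (\<lambda>t. c * rep (cls f) t)"
      by (intro fun_class_eq vm_null_subset[OF rep(2)[OF f]]) auto
    then have eq: "cls (\<lambda>t. c * f t) = nl_scale E c (cls f)"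
      by (simp add: class_space_def)
    show "\<phi> (cls (\<lambda>t. c * f t)) = c * \<phi> (cls f)"
      unfolding eq by (rule \<phi>_scale[OF inE[OF f]])
  next
    obtain K where K: "\<And>F. F \<in> elems E \<Longrightarrow> \<bar>\<phi> F\<bar> \<le> K * nl_norm E F"
      using \<phi> unfolding bounded_functional_def by blast
    have "\<bar>\<phi> (cls f)\<bar> \<le> K * p f" if f: "f \<in> S" for f
      using K[OF inE[OF f]] p_cong[OF f S_measurable[OF rep(1)[OF f]] rep(2)[OF f]]
      by (simp add: class_space_def)
    then show "\<exists>K. \<forall>f\<in>S. \<bar>\<phi> (cls f)\<bar> \<le> K * p f" by blast
  qed
  then show "(\<lambda>n. \<phi> (cls (f n))) \<longlonglongrightarrow> 0"
    by (rule fun_weakly_nullD(2)[OF assms])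
qed

text \<open>The functionals of bound 1 play the role of the dual unit ball. The factor 2 allows for
  norms that are suprema without being attained.\<close>

lemma fun_weakly_null_bounded:
  assumes u: "fun_weakly_null S p u"
    and norming: "\<And>f. f \<in> S \<Longrightarrow> \<exists>\<psi>. fun_functional S p \<psi> \<and> (\<forall>g\<in>S. \<bar>\<psi> g\<bar> \<le> p g) \<and> p f \<le> 2 * \<psi> f"
  shows "\<exists>K. \<forall>n. p (u n) \<le> K"
proof (rule weakly_null_imp_bounded[of "{\<psi>. fun_functional S p \<psi> \<and> (\<forall>g\<in>S. \<bar>\<psi> g\<bar> \<le> p g)}" u p])
  note uS = fun_weakly_nullD(1)[OF u]
  show "\<bar>\<psi> (u n)\<bar> \<le> p (u n)" if "\<psi> \<in> {\<psi>. fun_functional S p \<psi> \<and> (\<forall>g\<in>S. \<bar>\<psi> g\<bar> \<le> p g)}" for \<psi> n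
    using that uS by blast
  show "(\<lambda>n. \<psi> (u n)) \<longlonglongrightarrow> 0" if "\<psi> \<in> {\<psi>. fun_functional S p \<psi> \<and> (\<forall>g\<in>S. \<bar>\<psi> g\<bar> \<le> p g)}" for \<psi>
    using that fun_weakly_nullD(2)[OF u] by blast
  show "\<exists>\<psi>\<in>{\<psi>. fun_functional S p \<psi> \<and> (\<forall>g\<in>S. \<bar>\<psi> g\<bar> \<le> p g)}. p (u n) \<le> 2 * \<psi> (u n)" for n
    using norming[OF uS[of n]] by blast
next
  fix \<phi> :: "nat \<Rightarrow> ('b \<Rightarrow> real) \<Rightarrow> real" and \<sigma>
  assume \<phi>: "range \<phi> \<subseteq> {\<psi>. fun_functional S p \<psi> \<and> (\<forall>g\<in>S. \<bar>\<psi> g\<bar> \<le> p g)}"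
  then have fn: "fun_functional S p (\<phi> k)" for k by blast
  have bd: "\<bar>\<phi> k g\<bar> \<le> p g" if "g \<in> S" for k g using \<phi> that by blast
  let ?\<psi> = "\<lambda>v. \<Sum>k. if k \<in> \<sigma> then (1 / 2) ^ Suc k * \<phi> k v else 0"
  have bound: "\<bar>?\<psi> g\<bar> \<le> p g" if "g \<in> S" for g
    by (rule suminf_half_pow_abs_le(2)[OF bd[OF that]])
  moreover have "fun_functional S p ?\<psi>"
    unfolding fun_functional_def
  proof (intro conjI ballI allI)
    fix f g assume f: "f \<in> S" and g: "g \<in> S"
    show "?\<psi> (\<lambda>t. f t + g t) = ?\<psi> f + ?\<psi> g"
      using linear_half_pow_series[of \<phi> "\<lambda>t. f t + g t" 1 f 1 g, OF _ bd[OF f] bd[OF g]]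
        fun_functionalD(1)[OF fn f g] by simp
  next
    fix c f assume f: "f \<in> S"
    show "?\<psi> (\<lambda>t. c * f t) = c * ?\<psi> f"
      using linear_half_pow_series[of \<phi> "\<lambda>t. c * f t" c f 0 f, OF _ bd[OF f] bd[OF f]]
        fun_functionalD(2)[OF fn f] by simp
  next
    show "\<exists>K. \<forall>f\<in>S. \<bar>?\<psi> f\<bar> \<le> K * p f"
      using bound by (intro exI[of _ 1]) simp
  qed
  ultimately show "?\<psi> \<in> {\<psi>. fun_functional S p \<psi> \<and> (\<forall>g\<in>S. \<bar>\<psi> g\<bar> \<le> p g)}" by blast
qed

lemma class_space_nonneg_iff:
  assumes f: "f \<in> borel_measurable M"
  shows "nl_le E (nl_zero E) (cls f) \<longleftrightarrow>
    null {t \<in> space M. f t < 0}"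
proof -
  define z where "z = rep (cls (\<lambda>_. 0))"
  define g where "g = rep (cls f)"
  have z [measurable]: "z \<in> borel_measurable M" and z0: "null {t \<in> space M. 0 \<noteq> z t}"
    unfolding z_def by (rule rep_fun_class_eq; simp)+
  have g [measurable]: "g \<in> borel_measurable M" and gf: "null {t \<in> space M. f t \<noteq> g t}"
    unfolding g_def by (rule rep_fun_class_eq[OF f])+
  note [measurable] = f
  have null: "null ({t \<in> space M. 0 \<noteq> z t} \<union> {t \<in> space M. f t \<noteq> g t})"
    by (rule vm_null_Un[OF z0 gf])
  have "null {t \<in> space M. \<not> z t \<le> g t} \<longleftrightarrow> null {t \<in> space M. f t < 0}"
  proof
    assume "null {t \<in> space M. \<not> z t \<le> g t}"
    then show "null {t \<in> space M. f t < 0}"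
      by (rule vm_null_subset[OF vm_null_Un[OF _ null]]) auto
  next
    assume "null {t \<in> space M. f t < 0}"
    then show "null {t \<in> space M. \<not> z t \<le> g t}"
      by (rule vm_null_subset[OF vm_null_Un[OF _ null]]) auto
  qed
  then show ?thesis by (simp add: class_space_def z_def g_def)
qed

lemma class_space_norm:
  assumes "f \<in> S"
  shows "nl_norm E (cls f) = p f"
  using p_cong[OF assms rep_fun_class_eq[OF S_measurable[OF assms]]] by (simp add: class_space_def)

end

section \<open>Weakly null sequences of integrable and of essentially bounded functions\<close>

context vmeasure
begin

section \<open>The essential supremum norm\<close>

definition Linf :: "('b \<Rightarrow> real) set" where
  "Linf = {g. ess_bounded M \<nu> g}"

abbreviation Ninf :: "('b \<Rightarrow> real) \<Rightarrow> real" where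
  "Ninf \<equiv> Linf_norm M \<nu>"

abbreviation ess_bounds :: "('b \<Rightarrow> real) \<Rightarrow> real set" where
  "ess_bounds g \<equiv> {C. 0 \<le> C \<and> null {t \<in> space M. \<bar>g t\<bar> > C}}"

lemma Linf_measurable: "g \<in> Linf \<Longrightarrow> g \<in> borel_measurable M"
  by (simp add: Linf_def ess_bounded_def)

lemma ess_bound_mono:
  fixes g :: "'b \<Rightarrow> real"
  assumes [measurable]: "g \<in> borel_measurable M" and "null {t \<in> space M. \<bar>g t\<bar> > C}" "C \<le> D"
  shows "null {t \<in> space M. \<bar>g t\<bar> > D}"
proof (rule vm_null_subset[OF assms(2)])
  show "{t \<in> space M. \<bar>g t\<bar> > D} \<subseteq> {t \<in> space M. \<bar>g t\<bar> > C}"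
    using assms(3) by auto
qed measurable

lemma LinfI:
  assumes "g \<in> borel_measurable M" "\<And>t. \<bar>g t\<bar> \<le> C"
  shows "g \<in> Linf" "Ninf g \<le> C"
proof -
  have "{t \<in> space M. \<bar>g t\<bar> > C} = {}"
    using assms(2) by (auto simp: not_less)
  then have null: "null {t \<in> space M. \<bar>g t\<bar> > C}"
    using vm_null_empty by presburger
  then show "g \<in> Linf"
    using assms(1) unfolding Linf_def ess_bounded_def by blast
  have "0 \<le> C" using assms(2) abs_ge_zero order_trans by blast
  then show "Ninf g \<le> C"
    unfolding Linf_norm_def using null by (intro cInf_lower bdd_belowI[of _ 0]) auto
qed

lemma ess_bounds_nonempty:
  assumes "g \<in> Linf"
  shows "ess_bounds g \<noteq> {}"
proof -
  obtain C where "null {t \<in> space M. \<bar>g t\<bar> > C}"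
    using assms by (auto simp: Linf_def ess_bounded_def)
  then have "max 0 C \<in> ess_bounds g"
    using ess_bound_mono[OF Linf_measurable[OF assms], of C "max 0 C"] by simp
  then show ?thesis by blast
qed

lemma Ninf_nonneg: "g \<in> Linf \<Longrightarrow> 0 \<le> Ninf g"
  unfolding Linf_norm_def by (rule cInf_greatest[OF ess_bounds_nonempty]) auto

text \<open>The infimum of the essential bounds is itself one: the exceptional set is a countable
  union of null sets.\<close>

lemma Ninf_null:
  assumes g: "g \<in> Linf"
  shows "null {t \<in> space M. \<bar>g t\<bar> > Ninf g}"
proof -
  note [measurable] = Linf_measurable[OF g]
  have "null {t \<in> space M. \<bar>g t\<bar> > Ninf g + 1 / real (Suc n)}" for n
  proof -
    have "Inf (ess_bounds g) < Ninf g + 1 / real (Suc n)" by (simp add: Linf_norm_def)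
    then obtain C where "C \<in> ess_bounds g" "C < Ninf g + 1 / real (Suc n)"
      using cInf_lessD[OF ess_bounds_nonempty[OF g]] by blast
    then have "null {t \<in> space M. \<bar>g t\<bar> > C}" "C \<le> Ninf g + 1 / real (Suc n)"
      by simp_all
    then show ?thesis
      by (rule ess_bound_mono[OF Linf_measurable[OF g]])
  qed
  then have "null (\<Union>n. {t \<in> space M. \<bar>g t\<bar> > Ninf g + 1 / real (Suc n)})"
    by (rule vm_null_UN)
  then show ?thesis
  proof (rule vm_null_subset)
    show "{t \<in> space M. \<bar>g t\<bar> > Ninf g} \<subseteq> (\<Union>n. {t \<in> space M. \<bar>g t\<bar> > Ninf g + 1 / real (Suc n)})"
    proof
      fix t assume t: "t \<in> {t \<in> space M. \<bar>g t\<bar> > Ninf g}"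
      then have "0 < \<bar>g t\<bar> - Ninf g" by simp
      then obtain n where "inverse (real (Suc n)) < \<bar>g t\<bar> - Ninf g"
        using reals_Archimedean by blast
      then have "\<bar>g t\<bar> > Ninf g + 1 / real (Suc n)"
        by (simp add: inverse_eq_divide)
      with t show "t \<in> (\<Union>n. {t \<in> space M. \<bar>g t\<bar> > Ninf g + 1 / real (Suc n)})" by blast
    qed
  qed measurable
qed

lemma Ninf_AE: "g \<in> Linf \<Longrightarrow> AE t in V x. \<bar>g t\<bar> \<le> Ninf g"
  using Ninf_null by (intro vm_null_AE) (simp add: not_le)

lemma Ninf_not_null:
  assumes "g \<in> Linf" "0 \<le> C" "C < Ninf g"
  shows "\<not> null {t \<in> space M. \<bar>g t\<bar> > C}"
proof
  assume "null {t \<in> space M. \<bar>g t\<bar> > C}"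
  then have "Ninf g \<le> C"
    unfolding Linf_norm_def using assms(2) by (intro cInf_lower bdd_belowI[of _ 0]) auto
  then show False using assms(3) by simp
qed

lemma class_seminorm_L1: "class_seminorm M \<nu> L1 N"
proof
  show "N (\<lambda>_. 0) = 0"
    using N_scale[OF L1_zero, of 0] by simp
qed (rule L1_measurable L1_zero L1_add L1_scale L1_cong N_nonneg; assumption)+

lemma class_seminorm_Linf: "class_seminorm M \<nu> Linf Ninf"
proof
  show "f \<in> borel_measurable M" if "f \<in> Linf" for f by (rule Linf_measurable[OF that])
  show "0 \<le> Ninf f" if "f \<in> Linf" for f by (rule Ninf_nonneg[OF that])
  show zero: "(\<lambda>_. 0) \<in> Linf" by (rule LinfI[of _ 0]) auto
  show "Ninf (\<lambda>_. 0) = 0"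
    using LinfI(2)[of "\<lambda>_. 0" 0] Ninf_nonneg[OF zero] by (intro antisym) auto
  show "(\<lambda>t. f t + g t) \<in> Linf" if "f \<in> Linf" "g \<in> Linf" for f g
  proof -
    note [measurable] = Linf_measurable[OF that(1)] Linf_measurable[OF that(2)]
    have "null {t \<in> space M. \<bar>f t + g t\<bar> > Ninf f + Ninf g}"
      by (rule vm_null_subset[OF vm_null_Un[OF Ninf_null[OF that(1)] Ninf_null[OF that(2)]]]) auto
    moreover have "(\<lambda>t. f t + g t) \<in> borel_measurable M" by measurable
    ultimately show ?thesis unfolding Linf_def ess_bounded_def by blast
  qed
  show "(\<lambda>t. c * f t) \<in> Linf" if f: "f \<in> Linf" for c f
  proof -
    note [measurable] = Linf_measurable[OF f]
    have "null {t \<in> space M. \<bar>c * f t\<bar> > \<bar>c\<bar> * Ninf f}"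
    proof (rule vm_null_subset[OF Ninf_null[OF f]])
      show "{t \<in> space M. \<bar>c * f t\<bar> > \<bar>c\<bar> * Ninf f} \<subseteq> {t \<in> space M. \<bar>f t\<bar> > Ninf f}"
        by (auto simp: abs_mult mult_less_cancel_left)
    qed measurable
    moreover have "(\<lambda>t. c * f t) \<in> borel_measurable M" by measurable
    ultimately show ?thesis unfolding Linf_def ess_bounded_def by blast
  qed
  fix f g assume f: "f \<in> Linf" and g [measurable]: "g \<in> borel_measurable M"
    and eq: "null {t \<in> space M. f t \<noteq> g t}"
  note [measurable] = Linf_measurable[OF f]
  have iff: "null {t \<in> space M. \<bar>g t\<bar> > C} \<longleftrightarrow> null {t \<in> space M. \<bar>f t\<bar> > C}" for C
  proof
    assume "null {t \<in> space M. \<bar>g t\<bar> > C}"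
    then show "null {t \<in> space M. \<bar>f t\<bar> > C}"
      by (rule vm_null_subset[OF vm_null_Un[OF _ eq]]) auto
  next
    assume "null {t \<in> space M. \<bar>f t\<bar> > C}"
    then show "null {t \<in> space M. \<bar>g t\<bar> > C}"
      by (rule vm_null_subset[OF vm_null_Un[OF _ eq]]) auto
  qed
  show "g \<in> Linf" using f g by (simp add: Linf_def ess_bounded_def iff)
  show "Ninf g = Ninf f" by (simp add: Linf_norm_def iff)
qed

interpretation L1: class_seminorm M \<nu> L1 N
  by (rule class_seminorm_L1)

interpretation Linf: class_seminorm M \<nu> Linf Ninf
  by (rule class_seminorm_Linf)

lemma L1_space_eq: "L1_space M \<nu> = class_space M \<nu> L1 N"
  by (simp add: L1_space_def L1_def)

lemma Linf_space_eq: "Linf_space M \<nu> = class_space M \<nu> Linf Ninf"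
  by (simp add: Linf_space_def Linf_def)

section \<open>Norming functionals and boundedness of weakly null sequences\<close>

lemma integral_functional:
  fixes k :: "'b \<Rightarrow> real"
  assumes x: "norm x \<le> 1" and k [measurable]: "k \<in> borel_measurable M" "\<And>t. \<bar>k t\<bar> \<le> 1"
  shows "fun_functional L1 N (\<lambda>f. LINT t|V x. f t * k t)"
    and "f \<in> L1 \<Longrightarrow> \<bar>LINT t|V x. f t * k t\<bar> \<le> N f"
proof -
  show le: "\<bar>LINT t|V x. f t * k t\<bar> \<le> N f" if f: "f \<in> L1" for f
    using abs_integral_le[OF L1_integrable[OF f] k, of x] integral_abs_le_N[OF f x] by simp
  show "fun_functional L1 N (\<lambda>f. LINT t|V x. f t * k t)"
    unfolding fun_functional_def
  proof (intro conjI ballI allI)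
    fix f g assume f: "f \<in> L1" and g: "g \<in> L1"
    show "(LINT t|V x. (f t + g t) * k t) = (LINT t|V x. f t * k t) + (LINT t|V x. g t * k t)"
      unfolding distrib_right
      by (intro Bochner_Integration.integral_add integrable_mult_bounded[OF L1_integrable[OF f] k]
          integrable_mult_bounded[OF L1_integrable[OF g] k])
  next
    show "\<exists>K. \<forall>f\<in>L1. \<bar>LINT t|V x. f t * k t\<bar> \<le> K * N f"
      using le by (intro exI[of _ 1]) simp
  qed (simp add: mult.assoc)
qed

lemma L1_weakly_null_bounded:
  assumes "fun_weakly_null L1 N u"
  shows "\<exists>K. \<forall>n. N (u n) \<le> K"
proof (rule L1.fun_weakly_null_bounded[OF assms])
  fix f assume f: "f \<in> L1"
  note [measurable] = L1_measurable[OF f]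
  have "\<exists>x :: 'a \<Rightarrow>\<^sub>L real. norm x \<le> 1 \<and> N f \<le> 2 * (LINT t|V x. \<bar>f t\<bar>)"
  proof (cases "N f = 0")
    case True
    have "0 \<le> (LINT t|V 0. \<bar>f t\<bar>)" by (rule Bochner_Integration.integral_nonneg) simp
    then show ?thesis using True by (intro exI[of _ 0]) simp
  next
    case False
    then have "N f / 2 < N f" using N_nonneg[OF f] by simp
    then show ?thesis
    proof (rule N_gt)
      fix x :: "'a \<Rightarrow>\<^sub>L real" assume "norm x \<le> 1" "N f / 2 < (LINT t|V x. \<bar>f t\<bar>)"
      then show ?thesis by (intro exI[of _ x]) simp
    qed
  qed
  then obtain x :: "'a \<Rightarrow>\<^sub>L real" where x: "norm x \<le> 1" "N f \<le> 2 * (LINT t|V x. \<bar>f t\<bar>)"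
    by blast
  have k: "(\<lambda>t. sgn (f t)) \<in> borel_measurable M" by measurable
  have k1: "\<bar>sgn (f t)\<bar> \<le> 1" for t by (simp add: abs_sgn_eq)
  have "(LINT t|V x. f t * sgn (f t)) = (LINT t|V x. \<bar>f t\<bar>)"
    by (simp add: abs_sgn)
  then show "\<exists>\<psi>. fun_functional L1 N \<psi> \<and> (\<forall>g\<in>L1. \<bar>\<psi> g\<bar> \<le> N g) \<and> N f \<le> 2 * \<psi> f"
    using integral_functional[OF x(1) k k1] x(2)
    by (intro exI[of _ "\<lambda>g. LINT t|V x. g t * sgn (f t)"]) auto
qed

lemma Linf_integrable:
  assumes "g \<in> Linf"
  shows "integrable (V x) g"
proof -
  interpret finite_measure "V x" by (rule finite_V)
  show ?thesis
    using Ninf_AE[OF assms, of x] Linf_measurable[OF assms]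
    by (intro integrable_const_bound[of _ "Ninf g"]) simp_all
qed

lemma integrable_indicator_V: "B \<in> sets M \<Longrightarrow> integrable (V x) (\<lambda>t. c * indicator B t :: real)"
  using finite_measure.emeasure_finite[OF finite_V, of x B]
  by (intro integrable_mult_right integrable_real_indicator) (simp_all add: less_top)

text \<open>If \<open>B\<close> is null, the average below is the zero functional because of division by zero.\<close>

lemma average_functional:
  fixes k :: "'b \<Rightarrow> real"
  assumes k [measurable]: "k \<in> borel_measurable M" and k_le: "\<And>t. \<bar>k t\<bar> \<le> indicator B t"
    and B [measurable]: "B \<in> sets M"
  shows "fun_functional Linf Ninf (\<lambda>g. (LINT t|V x. g t * k t) / measure (V x) B)"
    and "g \<in> Linf \<Longrightarrow> \<bar>(LINT t|V x. g t * k t) / measure (V x) B\<bar> \<le> Ninf g"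
proof -
  have k1: "\<bar>k t\<bar> \<le> 1" for t
    by (rule order_trans[OF k_le indicator_le_1])
  have int: "integrable (V x) (\<lambda>t. g t * k t)" if "g \<in> Linf" for g
    by (rule integrable_mult_bounded[OF Linf_integrable[OF that] k k1])
  interpret finite_measure "V x" by (rule finite_V)
  show le: "\<bar>(LINT t|V x. g t * k t) / measure (V x) B\<bar> \<le> Ninf g" if g: "g \<in> Linf" for g
  proof -
    have "\<bar>LINT t|V x. g t * k t\<bar> \<le> (LINT t|V x. \<bar>g t * k t\<bar>)"
      by (rule integral_abs_bound)
    also have "\<dots> \<le> (LINT t|V x. Ninf g * indicator B t)"
    proof (rule integral_mono_AE)
      show "integrable (V x) (\<lambda>t. \<bar>g t * k t\<bar>)" using int[OF g] by simp
      show "integrable (V x) (\<lambda>t. Ninf g * indicator B t)" by (rule integrable_indicator_V[OF B])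
      show "AE t in V x. \<bar>g t * k t\<bar> \<le> Ninf g * indicator B t"
        using Ninf_AE[OF g]
      proof eventually_elim
        case (elim t)
        then show ?case
          using k_le[of t] Ninf_nonneg[OF g] unfolding abs_mult by (intro mult_mono) auto
      qed
    qed
    also have "\<dots> = Ninf g * measure (V x) B" by simp
    finally show ?thesis
      using Ninf_nonneg[OF g] by (cases "measure (V x) B = 0") (simp_all add: field_simps zero_less_measure_iff)
  qed
  show "fun_functional Linf Ninf (\<lambda>g. (LINT t|V x. g t * k t) / measure (V x) B)"
    unfolding fun_functional_def
  proof (intro conjI ballI allI)
    fix f g assume f: "f \<in> Linf" and g: "g \<in> Linf"
    show "(LINT t|V x. (f t + g t) * k t) / measure (V x) B =
        (LINT t|V x. f t * k t) / measure (V x) B + (LINT t|V x. g t * k t) / measure (V x) B"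
      unfolding distrib_right Bochner_Integration.integral_add[OF int[OF f] int[OF g]] add_divide_distrib ..
  next
    show "\<exists>K. \<forall>g\<in>Linf. \<bar>(LINT t|V x. g t * k t) / measure (V x) B\<bar> \<le> K * Ninf g"
      using le by (intro exI[of _ 1]) simp
  qed (simp add: mult.assoc)
qed

text \<open>If the norm is positive, the set where the modulus exceeds half of it has positive
  measure for some \<open>V x\<close>. Averaging over this set with the sign of \<open>g\<close>
  recovers at least half of the norm.\<close>

lemma Linf_weakly_null_bounded:
  assumes "fun_weakly_null Linf Ninf u"
  shows "\<exists>K. \<forall>n. Ninf (u n) \<le> K"
proof (rule Linf.fun_weakly_null_bounded[OF assms])
  fix g assume g: "g \<in> Linf"
  note [measurable] = Linf_measurable[OF g]
  define D where "D = {t \<in> space M. \<bar>g t\<bar> > Ninf g / 2}"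
  have D [measurable]: "D \<in> sets M" unfolding D_def by measurable
  have "\<exists>x. Ninf g = 0 \<or> emeasure (V x) D \<noteq> 0"
    using Ninf_not_null[OF g, of "Ninf g / 2"] Ninf_nonneg[OF g] D
    unfolding D_def[symmetric] vm_null_iff by (cases "Ninf g = 0") auto
  then obtain x where x: "Ninf g = 0 \<or> emeasure (V x) D \<noteq> 0" by blast
  interpret finite_measure "V x" by (rule finite_V)
  define k where "k t = sgn (g t) * indicator D t" for t
  have k [measurable]: "k \<in> borel_measurable M" unfolding k_def by measurable
  have k_le: "\<bar>k t\<bar> \<le> indicator D t" for t
    by (auto simp: k_def indicator_def abs_sgn_eq)
  have "(LINT t|V x. Ninf g / 2 * indicator D t) \<le> (LINT t|V x. g t * k t)"
  proof (rule integral_mono)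
    show "integrable (V x) (\<lambda>t. g t * k t)"
      by (rule integrable_mult_bounded[OF Linf_integrable[OF g] k order_trans[OF k_le indicator_le_1]])
    show "Ninf g / 2 * indicator D t \<le> g t * k t" for t
      by (auto simp: k_def indicator_def D_def abs_sgn[symmetric])
  qed (rule integrable_indicator_V[OF D])
  then have "Ninf g / 2 * measure (V x) D \<le> (LINT t|V x. g t * k t)" by simp
  then have "Ninf g \<le> 2 * ((LINT t|V x. g t * k t) / measure (V x) D)"
    using x by (cases "measure (V x) D = 0")
      (auto simp: field_simps zero_less_measure_iff emeasure_eq_measure)
  then show "\<exists>\<psi>. fun_functional Linf Ninf \<psi> \<and> (\<forall>g\<in>Linf. \<bar>\<psi> g\<bar> \<le> Ninf g) \<and> Ninf g \<le> 2 * \<psi> g"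
    using average_functional[OF k k_le D, where x = x] by blast
qed

text \<open>
  Otherwise, some point lies in infinitely many of the sets \<open>{g n > e}\<close> and in no null intersection
  of finitely many of them. A generalized limit of averages over the finite intersections of those
  infinitely many sets is a functional that does not tend to zero along \<open>g\<close>.
\<close>

lemma Linf_weakly_null_measure_gt:
  assumes g: "fun_weakly_null Linf Ninf g" and e: "0 < e"
  shows "(\<lambda>n. measure (V x) {t \<in> space M. g n t > e}) \<longlonglongrightarrow> 0"
proof (rule ccontr)
  assume not: "\<not> ?thesis"
  interpret finite_measure "V x" by (rule finite_V)
  note gL = fun_weakly_nullD(1)[OF g]
  note [measurable] = Linf_measurable[OF gL]
  obtain d q where d: "0 < d" and q: "strict_mono (q :: nat \<Rightarrow> nat)"
    and "\<And>n. d \<le> \<bar>measure (V x) {t \<in> space M. g (q n) t > e}\<bar>"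
    using not_tendsto_zero_subseq[OF not] by blast
  then have big: "d \<le> measure (V x) {t \<in> space M. g (q n) t > e}" for n by simp
  define D where "D n = {t \<in> space M. g (q n) t > e}" for n
  have D [measurable]: "D n \<in> sets M" for n unfolding D_def by measurable
  define I where "I K = {t \<in> space M. \<forall>n\<in>K. t \<in> D n}" for K
  have I [measurable]: "I K \<in> sets M" for K :: "nat set"
    unfolding I_def Ball_def by measurable
  \<comment> \<open>There are only countably many finite index sets, so the union of the null
    intersections is null.\<close>
  define Z where "Z = (\<Union>K\<in>{K. finite K \<and> emeasure (V x) (I K) = 0}. I K)"
  have Z: "Z \<in> null_sets (V x)"
    unfolding Z_def
  proof (rule null_sets_UN')
    show "countable {K :: nat set. finite K \<and> emeasure (V x) (I K) = 0}"
      by (rule countable_subset[OF _ countable_Collect_finite]) auto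
  qed (auto simp: null_sets_def I)
  define L where "L = (\<Inter>n. \<Union>k\<in>{n..}. D k)"
  have L [measurable]: "L \<in> sets M" unfolding L_def by measurable
  \<comment> \<open>Continuity from above for the finite measure \<open>V x\<close> shows that the
    upper limit \<open>L\<close> of the sets keeps measure at least \<open>d\<close>, so it has a
    point outside \<open>Z\<close>.\<close>
  have "(\<lambda>n. measure (V x) (\<Union>k\<in>{n..}. D k)) \<longlonglongrightarrow> measure (V x) L"
    unfolding L_def
  proof (rule finite_Lim_measure_decseq)
    show "range (\<lambda>n. \<Union>k\<in>{n..}. D k) \<subseteq> sets (V x)" by auto
    show "decseq (\<lambda>n. \<Union>k\<in>{n..}. D k)"
      unfolding decseq_def by (intro allI impI UN_mono) auto
  qed
  then have "d \<le> measure (V x) L"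
  proof (rule LIMSEQ_le_const)
    have "d \<le> measure (V x) (\<Union>k\<in>{n..}. D k)" for n
      by (rule order_trans[OF big[of n, folded D_def] finite_measure_mono]) auto
    then show "\<exists>N. \<forall>n\<ge>N. d \<le> measure (V x) (\<Union>k\<in>{n..}. D k)" by blast
  qed
  moreover have "measure (V x) L = 0" if "L \<subseteq> Z"
  proof -
    have "L \<in> null_sets (V x)" by (rule null_sets_subset[OF Z]) (use that in auto)
    then show ?thesis by (simp add: measure_def null_sets_def)
  qed
  ultimately obtain t where t: "t \<in> L" "t \<notin> Z"
    using d by force
  define J where "J = {n. t \<in> D n}"
  have J_inf: "\<exists>n\<ge>m. n \<in> J" for m
    using t(1) unfolding L_def J_def by auto
  have tM: "t \<in> space M"
    using t(1) L sets.sets_into_space by blast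
  \<comment> \<open>All these sets contain \<open>t\<close>, which avoids \<open>Z\<close>; hence
    none of them is null and the averages over them are genuine. For \<open>n\<close> in
    \<open>J\<close>, the average of \<open>g (q n)\<close> is at least \<open>e\<close> as soon as
    \<open>k\<close> reaches \<open>n\<close>.\<close>
  define B where "B k = I (J \<inter> {..k})" for k
  have B [measurable]: "B k \<in> sets M" for k unfolding B_def by measurable
  have B_pos: "0 < measure (V x) (B k)" for k
  proof -
    have "t \<in> B k" using tM by (auto simp: B_def I_def J_def)
    then have "emeasure (V x) (B k) \<noteq> 0"
      using t(2) unfolding Z_def B_def by auto
    then show ?thesis by (simp add: emeasure_eq_measure zero_less_measure_iff)
  qed
  define \<phi> where "\<phi> k u = (LINT t|V x. u t * indicator (B k) t) / measure (V x) (B k)"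
    for k and u :: "'b \<Rightarrow> real"
  have \<phi>: "fun_functional Linf Ninf (\<phi> k)" "\<And>u. u \<in> Linf \<Longrightarrow> \<bar>\<phi> k u\<bar> \<le> Ninf u" for k
    unfolding \<phi>_def[abs_def] by (rule average_functional; simp)+
  have \<phi>_big: "e \<le> \<phi> k (g (q n))" if "n \<in> J" "n \<le> k" for n k
  proof -
    have "(LINT t|V x. e * indicator (B k) t) \<le> (LINT t|V x. g (q n) t * indicator (B k) t)"
    proof (rule integral_mono)
      show "integrable (V x) (\<lambda>t. g (q n) t * indicator (B k) t)"
        by (rule integrable_mult_bounded[OF Linf_integrable[OF gL], of _ 1]) auto
      show "e * indicator (B k) t \<le> g (q n) t * indicator (B k) t" for t
      proof (cases "t \<in> B k")
        case True
        then have "t \<in> D n" using that by (auto simp: B_def I_def)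
        then show ?thesis using True by (simp add: D_def)
      qed simp
    qed (rule integrable_indicator_V[OF B])
    then show ?thesis
      using B_pos[of k] by (simp add: \<phi>_def field_simps)
  qed
  obtain \<Lambda> where \<Lambda>: "generalized_limit \<Lambda>"
    using exists_generalized_limit by blast
  have bdd: "bounded (range (\<lambda>k. \<phi> k u))" if "u \<in> Linf" for u
    using \<phi>(2)[OF that] by (auto simp: bounded_iff)
  define \<psi> where "\<psi> u = \<Lambda> (\<lambda>k. \<phi> k u)" for u
  have "fun_functional Linf Ninf \<psi>"
    unfolding fun_functional_def
  proof (intro conjI ballI allI)
    fix u v assume u: "u \<in> Linf" and v: "v \<in> Linf"
    show "\<psi> (\<lambda>t. u t + v t) = \<psi> u + \<psi> v"
      unfolding \<psi>_def fun_functionalD(1)[OF \<phi>(1) u v] by (rule generalized_limitD(1)[OF \<Lambda> bdd[OF u] bdd[OF v]])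
  next
    fix c u assume u: "u \<in> Linf"
    show "\<psi> (\<lambda>t. c * u t) = c * \<psi> u"
      unfolding \<psi>_def fun_functionalD(2)[OF \<phi>(1) u] by (rule generalized_limitD(2)[OF \<Lambda> bdd[OF u]])
  next
    have "\<bar>\<psi> u\<bar> \<le> 1 * Ninf u" if "u \<in> Linf" for u
      using generalized_limit_abs_le[OF \<Lambda> \<phi>(2)[OF that]] by (simp add: \<psi>_def)
    then show "\<exists>K. \<forall>u\<in>Linf. \<bar>\<psi> u\<bar> \<le> K * Ninf u" by blast
  qed
  then have "(\<lambda>n. \<psi> (g n)) \<longlonglongrightarrow> 0"
    by (rule fun_weakly_nullD(2)[OF g])
  then have "(\<lambda>n. \<psi> (g (q n))) \<longlonglongrightarrow> 0"
    using LIMSEQ_subseq_LIMSEQ[OF _ q] unfolding o_def by fast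
  then have "eventually (\<lambda>n. \<psi> (g (q n)) < e) sequentially"
    using e by (rule order_tendstoD)
  then obtain m where m: "\<And>n. n \<ge> m \<Longrightarrow> \<psi> (g (q n)) < e"
    unfolding eventually_sequentially by blast
  obtain n where n: "n \<ge> m" "n \<in> J" using J_inf by blast
  have "e \<le> \<psi> (g (q n))"
    unfolding \<psi>_def
  proof (rule generalized_limit_ge[OF \<Lambda> bdd[OF gL]])
    show "eventually (\<lambda>k. e \<le> \<phi> k (g (q n))) sequentially"
      using \<phi>_big[OF n(2)] unfolding eventually_sequentially by blast
  qed
  with m[OF n(1)] show False by simp
qed

lemma Linf_weakly_null_measure:
  assumes g: "fun_weakly_null Linf Ninf g" and e: "0 < e"
  shows "(\<lambda>n. measure (V x) {t \<in> space M. \<bar>g n t\<bar> > e}) \<longlonglongrightarrow> 0"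
proof -
  interpret finite_measure "V x" by (rule finite_V)
  note gL = fun_weakly_nullD(1)[OF g]
  note [measurable] = Linf_measurable[OF gL]
  have neg: "fun_weakly_null Linf Ninf (\<lambda>n t. (- 1) * g n t)"
    unfolding fun_weakly_null_def
  proof (intro conjI allI impI)
    show "(\<lambda>t. (- 1) * g n t) \<in> Linf" for n by (rule Linf.S_scale[OF gL])
    fix \<psi> assume \<psi>: "fun_functional Linf Ninf \<psi>"
    show "(\<lambda>n. \<psi> (\<lambda>t. (- 1) * g n t)) \<longlonglongrightarrow> 0"
      unfolding fun_functionalD(2)[OF \<psi> gL]
      by (rule tendsto_mult_right_zero[OF fun_weakly_nullD(2)[OF g \<psi>]])
  qed
  show ?thesis
  proof (rule Lim_null_comparison)
    show "(\<lambda>n. measure (V x) {t \<in> space M. g n t > e} +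
        measure (V x) {t \<in> space M. (- 1) * g n t > e}) \<longlonglongrightarrow> 0"
      using tendsto_add[OF Linf_weakly_null_measure_gt[OF g e] Linf_weakly_null_measure_gt[OF neg e]]
      by simp
    have "measure (V x) {t \<in> space M. \<bar>g n t\<bar> > e} \<le> measure (V x) {t \<in> space M. g n t > e} +
        measure (V x) {t \<in> space M. (- 1) * g n t > e}" for n
      by (rule order_trans[OF finite_measure_mono measure_Un_le]) auto
    then show "eventually (\<lambda>n. norm (measure (V x) {t \<in> space M. \<bar>g n t\<bar> > e}) \<le>
        measure (V x) {t \<in> space M. g n t > e} + measure (V x) {t \<in> space M. (- 1) * g n t > e}) sequentially"
      by (intro always_eventually) simp
  qed
qed

section \<open>Disjoint sequences of bounded multipliers\<close>

text \<open>Sums of the \<open>h k\<close> with the signs of \<open>\<psi> (h k)\<close> stay in the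
  unit ball, so the values \<open>\<psi> (h k)\<close> are absolutely summable.\<close>

lemma disjoint_fun_weakly_null_Linf:
  fixes h :: "nat \<Rightarrow> 'b \<Rightarrow> real"
  assumes disj: "disjoint_family A" and h: "\<And>k. h k \<in> borel_measurable M"
    and h_le: "\<And>k t. \<bar>h k t\<bar> \<le> indicator (A k) t"
  shows "fun_weakly_null Linf Ninf h"
  unfolding fun_weakly_null_def
proof (intro conjI allI impI)
  show hL: "h k \<in> Linf" for k
    by (rule LinfI(1)[OF h order_trans[OF h_le indicator_le_1]])
  fix \<psi> assume \<psi>: "fun_functional Linf Ninf \<psi>"
  obtain K where K: "0 \<le> K" "\<And>f. f \<in> Linf \<Longrightarrow> \<bar>\<psi> f\<bar> \<le> K * Ninf f"
    using fun_functional_bound[OF \<psi>] Ninf_nonneg by blast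
  have "(\<Sum>k<n. \<bar>\<psi> (h k)\<bar>) \<le> K" for n
  proof -
    let ?u = "\<lambda>t. \<Sum>k<n. sgn (\<psi> (h k)) * h k t"
    have sum: "?u \<in> Linf" "\<psi> ?u = (\<Sum>k<n. sgn (\<psi> (h k)) * \<psi> (h k))"
      by (rule Linf.fun_functional_sum[OF \<psi> hL]; simp)+
    have "\<bar>?u t\<bar> \<le> 1" for t
      by (rule disjoint_support_sum_le[OF disj h_le]) (auto simp: abs_sgn_eq)
    then have "Ninf ?u \<le> 1"
      by (rule LinfI(2)[OF Linf_measurable[OF sum(1)]])
    then have "K * Ninf ?u \<le> K" using K(1) by (simp add: mult_left_le)
    moreover have "(\<Sum>k<n. \<bar>\<psi> (h k)\<bar>) = \<psi> ?u"
      unfolding sum(2) by (intro sum.cong refl) (simp add: abs_sgn mult.commute)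
    ultimately show ?thesis using K(2)[OF sum(1)] by linarith
  qed
  then have "summable (\<lambda>k. \<bar>\<psi> (h k)\<bar>)"
    by (intro summableI_nonneg_bounded) auto
  then show "(\<lambda>k. \<psi> (h k)) \<longlonglongrightarrow> 0"
    by (intro tendsto_rabs_zero_cancel[OF summable_LIMSEQ_zero])
qed

text \<open>For a fixed \<open>u\<close> the numbers \<open>\<psi> (\<lambda>t. u t * h k t)\<close>
  are absolutely summable with total at most \<open>K * N u\<close>. Therefore the sum over any set
  of indices is again a bounded functional of \<open>u\<close>, namely \<open>\<theta>\<close>, and
  it tends to zero along \<open>f\<close>.\<close>

lemma L1_weakly_null_diagonal:
  fixes h :: "nat \<Rightarrow> 'b \<Rightarrow> real"
  assumes f: "fun_weakly_null L1 N f" and disj: "disjoint_family A"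
    and h [measurable]: "\<And>k. h k \<in> borel_measurable M"
    and h_le: "\<And>k t. \<bar>h k t\<bar> \<le> indicator (A k) t" and \<psi>: "fun_functional L1 N \<psi>"
  shows "(\<lambda>k. \<psi> (\<lambda>t. f k t * h k t)) \<longlonglongrightarrow> 0"
proof -
  note fL = fun_weakly_nullD(1)[OF f]
  have h1: "\<bar>h k t\<bar> \<le> 1" for k t by (rule order_trans[OF h_le indicator_le_1])
  have uh: "(\<lambda>t. u t * h k t) \<in> L1" if "u \<in> L1" for u k
    by (rule L1_mult[OF that h h1])
  obtain K where K: "0 \<le> K" "\<And>f. f \<in> L1 \<Longrightarrow> \<bar>\<psi> f\<bar> \<le> K * N f"
    using fun_functional_bound[OF \<psi>] N_nonneg by blast
  have part: "(\<Sum>k<n. \<bar>\<psi> (\<lambda>t. u t * h k t)\<bar>) \<le> K * N u" if u: "u \<in> L1" for u n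
  proof -
    let ?c = "\<lambda>k. sgn (\<psi> (\<lambda>t. u t * h k t))"
    let ?v = "\<lambda>t. \<Sum>k<n. ?c k * (u t * h k t)"
    have sum: "?v \<in> L1" "\<psi> ?v = (\<Sum>k<n. ?c k * \<psi> (\<lambda>t. u t * h k t))"
      by (rule L1.fun_functional_sum[OF \<psi> uh[OF u]]; simp)+
    have "N ?v \<le> 1 * N u"
    proof (rule N_mono[OF sum(1) u])
      fix t
      have "\<bar>\<Sum>k<n. ?c k * h k t\<bar> \<le> 1"
        by (rule disjoint_support_sum_le[OF disj h_le]) (auto simp: abs_sgn_eq)
      from abs_mult_le[OF this, of "u t"] show "\<bar>?v t\<bar> \<le> 1 * \<bar>u t\<bar>"
        by (simp add: sum_distrib_left mult.left_commute)
    qed simp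
    then have "K * N ?v \<le> K * N u" using K(1) by (intro mult_left_mono) auto
    moreover have "(\<Sum>k<n. \<bar>\<psi> (\<lambda>t. u t * h k t)\<bar>) = \<psi> ?v"
      unfolding sum(2) by (intro sum.cong refl) (simp add: abs_sgn mult.commute)
    ultimately show ?thesis using K(2)[OF sum(1)] by linarith
  qed
  have summ: "summable (\<lambda>k. \<bar>\<psi> (\<lambda>t. u t * h k t)\<bar>)" if "u \<in> L1" for u
    using part[OF that] by (intro summableI_nonneg_bounded[of _ "K * N u"]) auto
  show ?thesis
  proof (rule diagonal_tendsto_zero[of "\<lambda>n k. \<psi> (\<lambda>t. f n t * h k t)"])
    show "summable (\<lambda>k. \<bar>\<psi> (\<lambda>t. f n t * h k t)\<bar>)" for n
      by (rule summ[OF fL])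
    fix \<sigma> :: "nat set"
    define \<theta> where "\<theta> u = (\<Sum>k. if k \<in> \<sigma> then \<psi> (\<lambda>t. u t * h k t) else 0)" for u
    have summ\<sigma>: "summable (\<lambda>k. if k \<in> \<sigma> then \<psi> (\<lambda>t. u t * h k t) else 0)"
      and abs\<sigma>: "summable (\<lambda>k. \<bar>if k \<in> \<sigma> then \<psi> (\<lambda>t. u t * h k t) else 0\<bar>)" if "u \<in> L1" for u
      by (rule summable_comparison_test'[OF summ[OF that], of 0]; simp)+
    have "fun_functional L1 N \<theta>"
      unfolding fun_functional_def
    proof (intro conjI ballI allI)
      fix u v assume u: "u \<in> L1" and v: "v \<in> L1"
      have "(if k \<in> \<sigma> then \<psi> (\<lambda>t. (u t + v t) * h k t) else 0) =
          (if k \<in> \<sigma> then \<psi> (\<lambda>t. u t * h k t) else 0) + (if k \<in> \<sigma> then \<psi> (\<lambda>t. v t * h k t) else 0)" for k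
        using fun_functionalD(1)[OF \<psi> uh[OF u, of k] uh[OF v, of k]] by (simp add: distrib_right)
      then show "\<theta> (\<lambda>t. u t + v t) = \<theta> u + \<theta> v"
        unfolding \<theta>_def by (simp add: suminf_add[OF summ\<sigma>[OF u] summ\<sigma>[OF v]])
    next
      fix c u assume u: "u \<in> L1"
      have "(if k \<in> \<sigma> then \<psi> (\<lambda>t. (c * u t) * h k t) else 0) =
          c * (if k \<in> \<sigma> then \<psi> (\<lambda>t. u t * h k t) else 0)" for k
        using fun_functionalD(2)[OF \<psi> uh[OF u, of k], of c] by (simp add: mult.assoc)
      then show "\<theta> (\<lambda>t. c * u t) = c * \<theta> u"
        unfolding \<theta>_def using suminf_mult[OF summ\<sigma>[OF u], of c] by presburger
    next
      have "\<bar>\<theta> u\<bar> \<le> K * N u" if u: "u \<in> L1" for u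
      proof -
        have "\<bar>\<theta> u\<bar> \<le> (\<Sum>k. \<bar>if k \<in> \<sigma> then \<psi> (\<lambda>t. u t * h k t) else 0\<bar>)"
          unfolding \<theta>_def by (rule summable_rabs[OF abs\<sigma>[OF u]])
        also have "\<dots> \<le> (\<Sum>k. \<bar>\<psi> (\<lambda>t. u t * h k t)\<bar>)"
          by (rule suminf_le[OF _ abs\<sigma>[OF u] summ[OF u]]) simp
        also have "\<dots> \<le> K * N u"
          by (rule suminf_le_const[OF summ[OF u] part[OF u]])
        finally show ?thesis .
      qed
      then show "\<exists>K. \<forall>u\<in>L1. \<bar>\<theta> u\<bar> \<le> K * N u" by blast
    qed
    from fun_weakly_nullD(2)[OF f this]
    show "(\<lambda>n. \<Sum>k. if k \<in> \<sigma> then \<psi> (\<lambda>t. f n t * h k t) else 0) \<longlonglongrightarrow> 0"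
      unfolding \<theta>_def .
  qed
qed

end

section \<open>The positive Schur property\<close>

context vmeasure
begin

interpretation L1: class_seminorm M \<nu> L1 N
  by (rule class_seminorm_L1)

interpretation Linf: class_seminorm M \<nu> Linf Ninf
  by (rule class_seminorm_Linf)

text \<open>The left side chooses representatives of both factors and of their product, each of
  which deviates on a null set only. The function \<open>h\<close> is a version of \<open>g\<close>
  that is bounded everywhere, as a multiplier in \<open>L1_mult\<close> has to be.\<close>

lemma integration_operator_class_mult:
  fixes h :: "'b \<Rightarrow> real"
  assumes f: "f \<in> L1" and g: "g \<in> borel_measurable M" and h: "h \<in> borel_measurable M"
    and h_le: "\<And>t. \<bar>h t\<bar> \<le> C" and eq: "null {t \<in> space M. g t \<noteq> h t}"
  shows "integration_operator M \<nu> (class_mult M \<nu> (fun_class M \<nu> f) (fun_class M \<nu> g)) =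
    vint (\<lambda>t. f t * h t)"
proof -
  define f' where "f' = rep (fun_class M \<nu> f)"
  define g' where "g' = rep (fun_class M \<nu> g)"
  have f' [measurable]: "f' \<in> borel_measurable M" and ff': "null {t \<in> space M. f t \<noteq> f' t}"
    unfolding f'_def by (rule L1.rep_fun_class_eq[OF L1_measurable[OF f]])+
  have g' [measurable]: "g' \<in> borel_measurable M" and gg': "null {t \<in> space M. g t \<noteq> g' t}"
    unfolding g'_def by (rule L1.rep_fun_class_eq[OF g])+
  define p where "p = rep (fun_class M \<nu> (\<lambda>t. f' t * g' t))"
  have "(\<lambda>t. f' t * g' t) \<in> borel_measurable M" by measurable
  from L1.rep_fun_class_eq[OF this]
  have p [measurable]: "p \<in> borel_measurable M" and pp': "null {t \<in> space M. f' t * g' t \<noteq> p t}"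
    unfolding p_def by auto
  note [measurable] = L1_measurable[OF f] g h
  have "null {t \<in> space M. f t * h t \<noteq> p t}"
    by (rule vm_null_subset[OF vm_null_Un[OF vm_null_Un[OF ff' gg'] vm_null_Un[OF eq pp']]]) auto
  then have "vint p = vint (\<lambda>t. f t * h t)"
    by (intro L1_cong(3) L1_mult[OF f h h_le] p)
  then show ?thesis
    by (simp add: integration_operator_def class_mult_def p_def f'_def g'_def)
qed

text \<open>Splitting into \<open>A\<close>, \<open>D - A\<close> and the complement of
  \<open>D\<close>, two losses of at most \<open>e / 4\<close> leave \<open>e / 2\<close>.\<close>

lemma N_disjoint_part:
  assumes v: "v \<in> L1" and A [measurable]: "A \<in> sets M" and D [measurable]: "D \<in> sets M"
    and "A \<subseteq> D" and e: "e \<le> N v" "N (\<lambda>t. v t * indicator (D - A) t) \<le> e / 4"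
      "N (\<lambda>t. v t * indicator (space M - D) t) \<le> e / 4"
  shows "e / 2 \<le> N (\<lambda>t. v t * indicator A t)"
proof -
  have L: "(\<lambda>t. v t * indicator B t) \<in> L1" if "B \<in> sets M" for B
    by (rule L1_mult_indicator[OF v that])
  have "N v \<le> N (\<lambda>t. v t * indicator A t) + N (\<lambda>t. v t * indicator (space M - A) t)"
    by (rule N_triangle[OF L L _ v]) (auto simp: indicator_def)
  also have "N (\<lambda>t. v t * indicator (space M - A) t) \<le>
      N (\<lambda>t. v t * indicator (D - A) t) + N (\<lambda>t. v t * indicator (space M - D) t)"
    by (rule N_triangle[OF L L _ L]) (auto simp: indicator_def)
  finally show ?thesis using e by linarith
qed

section \<open>From the positive Schur property to null products\<close>

text \<open>The two bounds on \<open>h\<close> have different roles: domination by \<open>g\<close>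
  transfers smallness in measure from the weakly null sequence, and the bound \<open>K\<close> makes
  \<open>h\<close> a multiplier on \<open>L1\<close>.\<close>

lemma product_tendsto_zero:
  assumes psp: "positive_Schur_property (class_space M \<nu> L1 N)"
    and f: "fun_weakly_null L1 N f" and g: "fun_weakly_null Linf Ninf g"
    and h [measurable]: "\<And>n. h n \<in> borel_measurable M"
    and h_g: "\<And>n t. \<bar>h n t\<bar> \<le> \<bar>g n t\<bar>" and h_K: "\<And>n t. \<bar>h n t\<bar> \<le> K"
  shows "(\<lambda>n. N (\<lambda>t. f n t * h n t)) \<longlonglongrightarrow> 0"
proof (rule ccontr)
  assume not: "\<not> ?thesis"
  note fL = fun_weakly_nullD(1)[OF f] and gL = fun_weakly_nullD(1)[OF g]
  note [measurable] = L1_measurable[OF fL] Linf_measurable[OF gL]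
  have fh: "(\<lambda>t. f n t * h n t) \<in> L1" for n
    by (rule L1_mult[OF fL h h_K])
  obtain e q where e: "0 < e" and q: "strict_mono (q :: nat \<Rightarrow> nat)"
    and "\<And>n. e \<le> \<bar>N (\<lambda>t. f (q n) t * h (q n) t)\<bar>"
    using not_tendsto_zero_subseq[OF not] by blast
  then have big: "e \<le> N (\<lambda>t. f (q n) t * h (q n) t)" for n
    using N_nonneg[OF fh] by simp
  obtain L where L: "\<And>n. N (f n) \<le> L" using L1_weakly_null_bounded[OF f] by blast
  have L0: "0 \<le> L" using L[of 0] N_nonneg[OF fL, of 0] by linarith
  \<comment> \<open>Off \<open>D n\<close> the product is at most
    \<open>\<epsilon> * \<bar>f\<bar>\<close>, so its norm is at most \<open>\<epsilon> * L\<close>,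
    a quarter of \<open>e\<close>. The summand 1 covers the case \<open>L = 0\<close>.\<close>
  define \<epsilon> where "\<epsilon> = e / (4 * (L + 1))"
  have \<epsilon>: "0 < \<epsilon>" "\<epsilon> * L \<le> e / 4"
    using e L0 by (auto simp: \<epsilon>_def field_simps)
  define v where "v n t = f (q n) t * h (q n) t" for n t
  have vL: "v n \<in> L1" for n unfolding v_def[abs_def] by (rule fh)
  note [measurable] = L1_measurable[OF vL]
  define D where "D n = {t \<in> space M. \<bar>h (q n) t\<bar> > \<epsilon>}" for n
  have D [measurable]: "D n \<in> sets M" for n unfolding D_def by measurable
  have D_lim: "(\<lambda>n. measure (V x) (D n)) \<longlonglongrightarrow> 0" for x
  proof (rule Lim_null_comparison)
    interpret finite_measure "V x" by (rule finite_V)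
    show "(\<lambda>n. measure (V x) {t \<in> space M. \<bar>g (q n) t\<bar> > \<epsilon>}) \<longlonglongrightarrow> 0"
      by (rule LIMSEQ_subseq_LIMSEQ[OF Linf_weakly_null_measure[OF g \<epsilon>(1)] q, unfolded o_def])
    have "measure (V x) (D n) \<le> measure (V x) {t \<in> space M. \<bar>g (q n) t\<bar> > \<epsilon>}" for n
    proof (rule finite_measure_mono)
      show "D n \<subseteq> {t \<in> space M. \<bar>g (q n) t\<bar> > \<epsilon>}"
        unfolding D_def using h_g less_le_trans by blast
    qed measurable
    then show "eventually (\<lambda>n. norm (measure (V x) (D n)) \<le> measure (V x) {t \<in> space M. \<bar>g (q n) t\<bar> > \<epsilon>}) sequentially"
      by (intro always_eventually) simp
  qed
  have e4: "0 < e / 4" using e by simp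
  obtain r A where r: "strict_mono (r :: nat \<Rightarrow> nat)" and A_disj: "disjoint_family A"
    and A [measurable]: "\<And>k. A k \<in> sets M" and AD: "\<And>k. A k \<subseteq> D (r k)"
    and small: "\<And>k. N (\<lambda>t. v (r k) t * indicator (D (r k) - A k) t) \<le> e / 4"
    using disjoint_subsequence[of v D, OF vL D D_lim e4] by blast
  have v_big: "e / 2 \<le> N (\<lambda>t. v (r k) t * indicator (A k) t)" for k
  proof (rule N_disjoint_part[OF vL A D AD _ small])
    show "e \<le> N (v (r k))" unfolding v_def[abs_def] by (rule big)
    have "N (\<lambda>t. v (r k) t * indicator (space M - D (r k)) t) \<le> \<epsilon> * N (f (q (r k)))"
    proof (rule N_mono[OF L1_mult_indicator[OF vL] fL])
      fix t assume "t \<in> space M"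
      then show "\<bar>v (r k) t * indicator (space M - D (r k)) t\<bar> \<le> \<epsilon> * \<bar>f (q (r k)) t\<bar>"
        using abs_mult_le[of "h (q (r k)) t" \<epsilon> "f (q (r k)) t"] \<epsilon>(1)
        by (auto simp: D_def indicator_def v_def)
    qed (use \<epsilon> in auto)
    also have "\<dots> \<le> \<epsilon> * L" using L \<epsilon>(1) by (intro mult_left_mono) auto
    finally show "N (\<lambda>t. v (r k) t * indicator (space M - D (r k)) t) \<le> e / 4"
      using \<epsilon>(2) by linarith
  qed
  \<comment> \<open>A positive bound for all \<open>h n\<close>, by which the multipliers are scaled
    into the unit ball.\<close>
  define C where "C = max 1 K"
  have C: "0 < C" "\<And>n t. \<bar>h n t\<bar> \<le> C"
    using order_trans[OF h_K max.cobounded2] by (simp_all add: C_def)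
  \<comment> \<open>The sign of \<open>f\<close> is combined with the modulus of \<open>h\<close>,
    so that \<open>f\<close> times \<open>s k\<close> is the modulus of the product on
    \<open>A k\<close>, up to the factor \<open>1 / C\<close>. Thus one sequence is both positive
    and of the form covered by the diagonal lemma.\<close>
  define s where "s k t = sgn (f (q (r k)) t) * (\<bar>h (q (r k)) t\<bar> / C) * indicator (A k) t" for k t
  have s [measurable]: "s k \<in> borel_measurable M" for k unfolding s_def by measurable
  have s_le: "\<bar>s k t\<bar> \<le> indicator (A k) t" for k t
    using C by (auto simp: s_def indicator_def abs_mult abs_sgn_eq)
  define w where "w k t = f (q (r k)) t * s k t" for k t
  have w_eq: "w k t = \<bar>v (r k) t * indicator (A k) t\<bar> / C" for k t
  proof -
    have "w k t = (f (q (r k)) t * sgn (f (q (r k)) t)) * (\<bar>h (q (r k)) t\<bar> / C) * indicator (A k) t"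
      by (simp add: w_def s_def ac_simps)
    also have "f (q (r k)) t * sgn (f (q (r k)) t) = \<bar>f (q (r k)) t\<bar>"
      by (simp add: abs_sgn)
    finally show ?thesis by (simp add: v_def abs_mult)
  qed
  have wL: "w k \<in> L1" for k
    unfolding w_def[abs_def] by (rule L1_mult[OF fL s order_trans[OF s_le indicator_le_1]])
  have "fun_weakly_null L1 N (\<lambda>n. f (q (r n)))"
    using fun_weakly_null_subseq[OF fun_weakly_null_subseq[OF f q] r] .
  from L1_weakly_null_diagonal[OF this A_disj s s_le]
  have "fun_weakly_null L1 N w"
    unfolding fun_weakly_null_def using wL by (simp add: w_def[abs_def])
  from L1.weakly_null_fun_class[OF this]
  have "weakly_null (class_space M \<nu> L1 N) (\<lambda>n. fun_class M \<nu> (w n))" .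
  moreover have "nl_le (class_space M \<nu> L1 N) (nl_zero (class_space M \<nu> L1 N)) (fun_class M \<nu> (w n))" for n
  proof -
    have "{t \<in> space M. w n t < 0} = {}"
      using C(1) by (auto simp: w_eq divide_less_0_iff)
    then show ?thesis
      using L1.class_space_nonneg_iff[OF L1_measurable[OF wL, of n]] vm_null_empty by presburger
  qed
  ultimately have "(\<lambda>n. nl_norm (class_space M \<nu> L1 N) (fun_class M \<nu> (w n))) \<longlonglongrightarrow> 0"
    using psp unfolding positive_Schur_property_def by blast
  then have "(\<lambda>n. N (w n)) \<longlonglongrightarrow> 0"
    unfolding L1.class_space_norm[OF wL] .
  then have "eventually (\<lambda>n. N (w n) < e / (2 * C)) sequentially"
    using e C(1) by (intro order_tendstoD) auto
  then obtain n where n: "N (w n) < e / (2 * C)"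
    using eventually_happens'[OF sequentially_bot] by blast
  have "N (\<lambda>t. v (r n) t * indicator (A n) t) \<le> C * N (w n)"
  proof (rule N_mono[OF L1_mult_indicator[OF vL A] wL])
    show "\<bar>v (r n) t * indicator (A n) t\<bar> \<le> C * \<bar>w n t\<bar>" for t
      using C(1) by (simp add: w_eq)
  qed (use C in simp)
  then have "e / 2 \<le> C * N (w n)" using v_big[of n] by linarith
  then show False using n C(1) by (simp add: field_simps)
qed

section \<open>From null integrals to the positive Schur property\<close>

text \<open>The premise \<open>prod\<close> speaks of multipliers bounded by 1 everywhere, as the
  signs constructed here are; they can be passed to classes without truncation.\<close>

lemma positive_tendsto_zero:
  assumes prod: "\<And>f h. fun_weakly_null L1 N f \<Longrightarrow> fun_weakly_null Linf Ninf h \<Longrightarrow>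
      (\<And>n t. h n \<in> borel_measurable M \<and> \<bar>h n t\<bar> \<le> 1) \<Longrightarrow>
      (\<lambda>n. vint (\<lambda>t. f n t * h n t)) \<longlonglongrightarrow> 0"
    and f: "fun_weakly_null L1 N f" and pos: "\<And>n. null {t \<in> space M. f n t < 0}"
  shows "(\<lambda>n. N (f n)) \<longlonglongrightarrow> 0"
proof (rule ccontr)
  assume not: "\<not> ?thesis"
  note fL = fun_weakly_nullD(1)[OF f]
  obtain e q where e: "0 < e" and q: "strict_mono (q :: nat \<Rightarrow> nat)"
    and big_abs: "\<And>n. e \<le> \<bar>N (f (q n))\<bar>"
    using not_tendsto_zero_subseq[OF not] by blast
  define v where "v n = f (q n)" for n
  have v: "fun_weakly_null L1 N v"
    unfolding v_def[abs_def] by (rule fun_weakly_null_subseq[OF f q])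
  note vL = fun_weakly_nullD(1)[OF v]
  note [measurable] = L1_measurable[OF vL]
  have big: "e \<le> N (v n)" for n
    using big_abs[of n] N_nonneg[OF fL, of "q n"] by (simp add: v_def)
  \<comment> \<open>Where the values of \<open>v n\<close> do not exceed \<open>\<eta>\<close>, it
    is compared with the integrable constant 1, and its norm there is at most
    \<open>e / 4\<close>.\<close>
  define \<eta> where "\<eta> = e / (4 * (N (\<lambda>_. 1) + 1))"
  have \<eta>: "0 < \<eta>" "\<eta> * N (\<lambda>_. 1) \<le> e / 4"
    using e N_nonneg[OF L1_one] by (auto simp: \<eta>_def field_simps)
  define D where "D n = {t \<in> space M. \<bar>v n t\<bar> > \<eta>}" for n
  have D [measurable]: "D n \<in> sets M" for n unfolding D_def by measurable
  have D_lim: "(\<lambda>n. measure (V x) (D n)) \<longlonglongrightarrow> 0" if x: "norm x \<le> 1" for x :: "'a \<Rightarrow>\<^sub>L real"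
  proof (rule Lim_null_comparison)
    interpret finite_measure "V x" by (rule finite_V)
    \<comment> \<open>Here positivity enters: integration against \<open>V x\<close> is a bounded
      functional, and for functions nonnegative almost everywhere its values control the measure of
      \<open>D n\<close> by Chebyshev's inequality.\<close>
    have "(\<lambda>n. LINT t|V x. v n t * 1) \<longlonglongrightarrow> 0"
      by (rule fun_weakly_nullD(2)[OF v integral_functional(1)[OF x]]) auto
    then show "(\<lambda>n. (LINT t|V x. v n t) / \<eta>) \<longlonglongrightarrow> 0"
      by (intro tendsto_divide_zero) simp
    have "measure (V x) (D n) \<le> (LINT t|V x. v n t) / \<eta>" for n
    proof -
      have "(LINT t|V x. \<eta> * indicator (D n) t) \<le> (LINT t|V x. v n t)"
      proof (rule integral_mono_AE)
        have "AE t in V x. 0 \<le> v n t"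
          by (rule vm_null_AE) (use pos[of "q n"] in \<open>simp add: v_def not_le\<close>)
        then show "AE t in V x. \<eta> * indicator (D n) t \<le> v n t"
          by eventually_elim (auto simp: D_def indicator_def)
      qed (rule integrable_indicator_V[OF D] L1_integrable[OF vL])+
      then show ?thesis using \<eta>(1) by (simp add: field_simps)
    qed
    then show "eventually (\<lambda>n. norm (measure (V x) (D n)) \<le> (LINT t|V x. v n t) / \<eta>) sequentially"
      by (intro always_eventually) simp
  qed
  have e4: "0 < e / 4" using e by simp
  obtain r A where r: "strict_mono (r :: nat \<Rightarrow> nat)" and A_disj: "disjoint_family A"
    and A [measurable]: "\<And>k. A k \<in> sets M" and AD: "\<And>k. A k \<subseteq> D (r k)"
    and small: "\<And>k. N (\<lambda>t. v (r k) t * indicator (D (r k) - A k) t) \<le> e / 4"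
    using disjoint_subsequence[of v D, OF vL D D_lim e4] by blast
  have v_big: "e / 2 \<le> N (\<lambda>t. v (r k) t * indicator (A k) t)" for k
  proof (rule N_disjoint_part[OF vL A D AD big small])
    have "N (\<lambda>t. v (r k) t * indicator (space M - D (r k)) t) \<le> \<eta> * N (\<lambda>_. 1)"
    proof (rule N_mono[OF L1_mult_indicator[OF vL] L1_one])
      fix t assume "t \<in> space M"
      then show "\<bar>v (r k) t * indicator (space M - D (r k)) t\<bar> \<le> \<eta> * \<bar>1\<bar>"
        using \<eta>(1) by (auto simp: D_def indicator_def)
    qed (use \<eta> in auto)
    then show "N (\<lambda>t. v (r k) t * indicator (space M - D (r k)) t) \<le> e / 4"
      using \<eta>(2) by linarith
  qed
  have "\<exists>x :: 'a \<Rightarrow>\<^sub>L real. norm x \<le> 1 \<and> e / 4 < (LINT t|V x. \<bar>v (r k) t * indicator (A k) t\<bar>)" for k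
  proof -
    have "e / 4 < N (\<lambda>t. v (r k) t * indicator (A k) t)" using v_big[of k] e by linarith
    then show ?thesis by (elim N_gt) blast
  qed
  then obtain X :: "nat \<Rightarrow> 'a \<Rightarrow>\<^sub>L real" where X: "\<And>k. norm (X k) \<le> 1"
    "\<And>k. e / 4 < (LINT t|V (X k). \<bar>v (r k) t * indicator (A k) t\<bar>)"
    by metis
  \<comment> \<open>The sign of \<open>v\<close> and the density of the scalar measure make
    \<open>X k\<close> at the vector integral equal to the integral of the modulus over
    \<open>A k\<close>, so the norm of the vector integral exceeds \<open>e / 4\<close>.\<close>
  define h where "h k t = indicator (A k) t * (sgn (v (r k) t) * sgd (X k) t)" for k t
  have h [measurable]: "h k \<in> borel_measurable M" for k unfolding h_def by measurable
  have h_le: "\<bar>h k t\<bar> \<le> indicator (A k) t" for k t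
    by (auto simp: h_def indicator_def abs_mult abs_sgn_eq)
  have h1: "\<bar>h k t\<bar> \<le> 1" for k t
    by (rule order_trans[OF h_le indicator_le_1])
  have "(\<lambda>k. vint (\<lambda>t. v (r k) t * h k t)) \<longlonglongrightarrow> 0"
    by (rule prod[OF fun_weakly_null_subseq[OF v r] disjoint_fun_weakly_null_Linf[OF A_disj h h_le]])
       (use h h1 in auto)
  then have "eventually (\<lambda>k. norm (vint (\<lambda>t. v (r k) t * h k t)) < e / 4) sequentially"
    using e by (intro order_tendstoD[OF tendsto_norm_zero]) auto
  then obtain k where k: "norm (vint (\<lambda>t. v (r k) t * h k t)) < e / 4"
    using eventually_happens'[OF sequentially_bot] by blast
  let ?y = "vint (\<lambda>t. v (r k) t * h k t)"
  have "blinfun_apply (X k) ?y = (LINT t|V (X k). v (r k) t * h k t * sgd (X k) t)"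
    by (rule vm_integral_eq[OF L1_mult[OF vL h h1]])
  also have "\<dots> = (LINT t|V (X k). \<bar>v (r k) t * indicator (A k) t\<bar>)"
  proof (rule Bochner_Integration.integral_cong[OF refl])
    fix t
    have "v (r k) t * h k t * sgd (X k) t =
        \<bar>v (r k) t\<bar> * indicator (A k) t * (sgd (X k) t * sgd (X k) t)"
      by (simp only: h_def abs_sgn ac_simps)
    then show "v (r k) t * h k t * sgd (X k) t = \<bar>v (r k) t * indicator (A k) t\<bar>"
      unfolding sgd_mult_self by (simp add: abs_mult)
  qed
  finally have "e / 4 < blinfun_apply (X k) ?y"
    using X(2)[of k] by simp
  moreover have "blinfun_apply (X k) ?y \<le> norm ?y"
    using abs_blinfun_apply_le[OF X(1)[of k], of ?y] by linarith
  ultimately show False using k by linarith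
qed

lemma positive_Schur_property_iff:
  "positive_Schur_property (L1_space M \<nu>) \<longleftrightarrow>
    (\<forall>f g. weakly_null (L1_space M \<nu>) f \<longrightarrow> weakly_null (Linf_space M \<nu>) g \<longrightarrow>
       (\<lambda>n. integration_operator M \<nu> (class_mult M \<nu> (f n) (g n))) \<longlonglongrightarrow> 0)"
  unfolding L1_space_eq Linf_space_eq
proof (intro iffI allI impI)
  fix F G
  assume psp: "positive_Schur_property (class_space M \<nu> L1 N)"
    and F: "weakly_null (class_space M \<nu> L1 N) F" and G: "weakly_null (class_space M \<nu> Linf Ninf) G"
  define f where "f n = rep (F n)" for n
  define g where "g n = rep (G n)" for n
  have f: "fun_weakly_null L1 N f"
    unfolding f_def[abs_def] by (rule L1.weakly_null_rep[OF F])
  have g: "fun_weakly_null Linf Ninf g"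
    unfolding g_def[abs_def] by (rule Linf.weakly_null_rep[OF G])
  note fL = fun_weakly_nullD(1)[OF f] and gL = fun_weakly_nullD(1)[OF g]
  note [measurable] = Linf_measurable[OF gL]
  have F_eq: "F n = fun_class M \<nu> (f n)" for n
    using L1.rep_class(2)[of "F n"] F by (simp add: f_def weakly_null_def class_space_def)
  have G_eq: "G n = fun_class M \<nu> (g n)" for n
    using Linf.rep_class(2)[of "G n"] G by (simp add: g_def weakly_null_def class_space_def)
  obtain K where K: "\<And>n. Ninf (g n) \<le> K" using Linf_weakly_null_bounded[OF g] by blast
  have K0: "0 \<le> K" using K[of 0] Ninf_nonneg[OF gL, of 0] by linarith
  \<comment> \<open>Truncation at a common bound of the essential norms. It changes each
    \<open>g n\<close> on a null set only and makes it bounded everywhere.\<close>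
  define h where "h n t = max (- K) (min K (g n t))" for n t
  have h [measurable]: "h n \<in> borel_measurable M" for n unfolding h_def by measurable
  have h_K: "\<bar>h n t\<bar> \<le> K" and h_g: "\<bar>h n t\<bar> \<le> \<bar>g n t\<bar>" for n t
    using K0 by (auto simp: h_def)
  have gh: "null {t \<in> space M. g n t \<noteq> h n t}" for n
  proof (rule vm_null_subset[OF ess_bound_mono[OF Linf_measurable[OF gL] Ninf_null[OF gL] K]])
    show "{t \<in> space M. g n t \<noteq> h n t} \<subseteq> {t \<in> space M. \<bar>g n t\<bar> > K}"
      by (auto simp: h_def)
  qed measurable
  have "(\<lambda>n. N (\<lambda>t. f n t * h n t)) \<longlonglongrightarrow> 0"
    by (rule product_tendsto_zero[OF psp f g h h_g h_K])
  then have "(\<lambda>n. vint (\<lambda>t. f n t * h n t)) \<longlonglongrightarrow> 0"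
    by (rule Lim_null_comparison[rotated])
       (intro always_eventually allI norm_vm_integral_le L1_mult[OF fL h h_K])
  then show "(\<lambda>n. integration_operator M \<nu> (class_mult M \<nu> (F n) (G n))) \<longlonglongrightarrow> 0"
    unfolding F_eq G_eq integration_operator_class_mult[OF fL Linf_measurable[OF gL] h h_K gh] .
next
  assume ii: "\<forall>f g. weakly_null (class_space M \<nu> L1 N) f \<longrightarrow> weakly_null (class_space M \<nu> Linf Ninf) g \<longrightarrow>
       (\<lambda>n. integration_operator M \<nu> (class_mult M \<nu> (f n) (g n))) \<longlonglongrightarrow> 0"
  show "positive_Schur_property (class_space M \<nu> L1 N)"
    unfolding positive_Schur_property_def
  proof (intro allI impI)
    fix F assume F: "weakly_null (class_space M \<nu> L1 N) F"
      and pos: "\<forall>n. nl_le (class_space M \<nu> L1 N) (nl_zero (class_space M \<nu> L1 N)) (F n)"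
    define f where "f n = rep (F n)" for n
    have f: "fun_weakly_null L1 N f"
      unfolding f_def[abs_def] by (rule L1.weakly_null_rep[OF F])
    note fL = fun_weakly_nullD(1)[OF f]
    have F_eq: "F n = fun_class M \<nu> (f n)" for n
      using L1.rep_class(2)[of "F n"] F by (simp add: f_def weakly_null_def class_space_def)
    have "(\<lambda>n. N (f n)) \<longlonglongrightarrow> 0"
    proof (rule positive_tendsto_zero[OF _ f])
      show "null {t \<in> space M. f n t < 0}" for n
        using pos L1.class_space_nonneg_iff[OF L1_measurable[OF fL]] unfolding F_eq by blast
      fix f h assume f: "fun_weakly_null L1 N f" and h: "fun_weakly_null Linf Ninf h"
        and h_le: "\<And>n t. h n \<in> borel_measurable M \<and> \<bar>h n t\<bar> \<le> 1"
      have hm: "h n \<in> borel_measurable M" and h1: "\<bar>h n t\<bar> \<le> 1" for n t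
        using h_le by blast+
      have null: "null {t \<in> space M. h n t \<noteq> h n t}" for n
        by (simp add: vm_null_empty)
      have "(\<lambda>n. integration_operator M \<nu>
          (class_mult M \<nu> (fun_class M \<nu> (f n)) (fun_class M \<nu> (h n)))) \<longlonglongrightarrow> 0"
        using ii L1.weakly_null_fun_class[OF f] Linf.weakly_null_fun_class[OF h] by blast
      then show "(\<lambda>n. vint (\<lambda>t. f n t * h n t)) \<longlonglongrightarrow> 0"
        unfolding integration_operator_class_mult[OF fun_weakly_nullD(1)[OF f] hm hm h1 null] .
    qed
    then show "(\<lambda>n. nl_norm (class_space M \<nu> L1 N) (F n)) \<longlonglongrightarrow> 0"
      unfolding F_eq L1.class_space_norm[OF fL] .
  qed
qed

end

theorem theorem4p3:
  fixes M :: "'b measure" and \<nu> :: "'b set \<Rightarrow> 'a::banach"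
  assumes "vector_measure M \<nu>"
  shows "positive_Schur_property (L1_space M \<nu>) \<longleftrightarrow>
    (\<forall>f g. weakly_null (L1_space M \<nu>) f \<longrightarrow> weakly_null (Linf_space M \<nu>) g \<longrightarrow>
       (\<lambda>n. integration_operator M \<nu> (class_mult M \<nu> (f n) (g n))) \<longlonglongrightarrow> 0)"
proof -
  interpret vmeasure M \<nu> by unfold_locales (rule assms)
  show ?thesis by (rule positive_Schur_property_iff)
qed

end
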